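(* Let $\theta \in (0, 0.0539\pi]$ and let $\mathcal{P}_{Q_1} = \mathcal{P}_{Q_1}([0,1])$ be an action minimizer connecting the boundary configuration sets $Q_S$ and $Q_{E_1}$, i.e. $\mathcal{P}_{Q_1} \in P(Q_S, Q_{E_1})$ and $\mathcal{A}(\mathcal{P}_{Q_1}) = \inf_{q \in P(Q_S, Q_{E_1})} \mathcal{A}(q)$. Then $\mathcal{P}_{Q_1}$ is collision-free on $[0,1]$, and it can be extended to a periodic or quasi-periodic orbit of the planar equal-mass four-body problem.
   Context: Planar four-body problem with masses $m_1=m_2=m_3=m_4=1$. Positions $q_i=(q_{ix},q_{iy})\in\mathbb{R}^2$ are row vectors, and $q$ is the $4\times 2$ matrix with rows $q_1,\dots,q_4$. Let $\chi=\{q\in\mathbb{R}^{4\times 2} : \sum_{i=1}^4 q_i=0\}$. The Lagrangian action of $q\in H^1([0,1],\chi)$ is $$\mathcal{A}(q)=\int_0^1 \Big[\tfrac12\sum_{i=1}^4|\dot q_i|^2+\sum_{1\le i<j\le 4}\frac{1}{|q_i-q_j|}\Big]dt\in\mathbb{R}\cup\{+\infty\}.$$ Let $R(\theta)=\begin{bmatrix}\cos\theta&\sin\theta\\ -\sin\theta&\cos\theta\end{bmatrix}$ (acting on row vectors from the right). Define $$Q_S=\left\{\begin{bmatrix}-a_1-c_1&0\\ -a_1&0\\ (2a_1+c_1)/2&b_1\\ (2a_1+c_1)/2&-b_1\end{bmatrix} : a_1\in\mathbb{R},\ b_1\ge0,\ c_1\ge0\right\},$$ $$Q_{E_1}=\left\{\begin{bmatrix}-b_2&-a_2\\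 -c_2&a_2\\ c_2&a_2\\ b_2&-a_2\end{bmatrix}R(\theta) : a_2\in\mathbb{R},\ b_2\ge0,\ c_2\ge0\right\},$$ $$P(Q_S,Q_{E_1})=\{q\in H^1([0,1],\chi) : q(0)\in Q_S,\ q(1)\in Q_{E_1}\}.$$ For each $\theta\in(0,\pi/4)$ a minimizer of $\mathcal{A}$ over $P(Q_S,Q_{E_1})$ exists. A path has a collision at time $t$ if $q_i(t)=q_j(t)$ for some $i\ne j$; it is collision-free if it has no collision at any time. An orbit is a classical (collision-free) solution, defined for all $t\in\mathbb{R}$, of Newton's equations $\ddot q_i=\sum_{j\neq i}(q_j-q_i)/|q_j-q_i|^3$, $i=1,\dots,4$; it extends $\mathcal{P}_{Q_1}$ if it coincides with $\mathcal{P}_{Q_1}$ on $[0,1]$. *)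

theory Defs
  imports "HOL-Analysis.Analysis"
begin

text \<open>A configuration is a \<open>4 \<times> 2\<close> matrix; its \<open>i\<close>-th row \<open>q $ i\<close> is the position of body \<open>i\<close>.
  A path is a function on \<open>real\<close> of which only the values on \<open>{0..1}\<close> matter.\<close>

type_synonym config = "real ^ 2 ^ 4"

definition chi :: "config set" where
  "chi = {q. (\<Sum>i\<in>UNIV. q $ i) = 0}"

text \<open>Absolutely continuous with square-integrable derivative, i.e. the continuous
  representatives of the Sobolev class \<open>H\<^sup>1([0,1])\<close>. At the points (a null set) where \<open>q\<close> is not
  differentiable \<^const>\<open>vector_derivative\<close> has an unspecified value, which affects no integral.\<close>

definition H1 :: "(real \<Rightarrow> 'a::euclidean_space) set" where
  "H1 = {q. (AE t in lebesgue_on {0..1}. q differentiable (at t))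
     \<and> (\<lambda>t. vector_derivative q (at t)) \<in> borel_measurable (lebesgue_on {0..1})
     \<and> integrable (lebesgue_on {0..1}) (\<lambda>t. (norm (vector_derivative q (at t)))\<^sup>2)
     \<and> (\<forall>t\<in>{0..1}. ((\<lambda>s. vector_derivative q (at s)) has_integral (q t - q 0)) {0..t})}"

text \<open>The potential is \<^typ>\<open>ennreal\<close>-valued so that \<open>1 / 0 = \<infinity>\<close> at collisions (over the reals
  \<open>1 / 0\<close> would be \<open>0\<close>). The index pairs range over the linear order of the type \<open>4\<close>, in which
  \<open>4 = 0\<close> is the least element; each unordered pair occurs exactly once.\<close>

definition potential :: "config \<Rightarrow> ennreal" where
  "potential q = (\<Sum>(i, j)\<in>{(i, j). i < j}. 1 / ennreal (norm (q $ i - q $ j)))"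

definition action :: "(real \<Rightarrow> config) \<Rightarrow> ennreal" where
  "action q = (\<integral>\<^sup>+t. (ennreal (1/2 * (\<Sum>i\<in>UNIV. (norm (vector_derivative q (at t) $ i))\<^sup>2))
                      + potential (q t)) \<partial>lebesgue_on {0..1})"

definition R :: "real \<Rightarrow> real ^ 2 ^ 2" where
  "R \<theta> = vector [vector [cos \<theta>, sin \<theta>],
                  vector [- sin \<theta>, cos \<theta>]]"

definition Q_S :: "config set" where
  "Q_S = {vector [vector [- a - c, 0],
                  vector [- a, 0],
                  vector [(2 * a + c) / 2, b],
                  vector [(2 * a + c) / 2, - b]] | a b c. b \<ge> 0 \<and> c \<ge> 0}"

definition Q_E1 :: "real \<Rightarrow> config set" where
  "Q_E1 \<theta> = {(vector [vector [- b, - a],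
                      vector [- c, a],
                      vector [c, a],
                      vector [b, - a]] :: config) ** R \<theta> | a b c. b \<ge> 0 \<and> c \<ge> 0}"

definition paths :: "config set \<Rightarrow> config set \<Rightarrow> (real \<Rightarrow> config) set" where
  "paths A B = {q \<in> H1. (\<forall>t\<in>{0..1}. q t \<in> chi) \<and> q 0 \<in> A \<and> q 1 \<in> B}"

definition is_minimizer :: "(real \<Rightarrow> config) \<Rightarrow> config set \<Rightarrow> config set \<Rightarrow> bool" where
  "is_minimizer q A B \<longleftrightarrow> q \<in> paths A B \<and> action q = (INF p\<in>paths A B. action p)"

definition has_collision :: "config \<Rightarrow> bool" where
  "has_collision q \<longleftrightarrow> (\<exists>i j. i \<noteq> j \<and> q $ i = q $ j)"

definition force :: "config \<Rightarrow> config" where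
  "force q = (\<chi> i. \<Sum>j\<in>UNIV - {i}. (q $ j - q $ i) /\<^sub>R (norm (q $ j - q $ i)) ^ 3)"

definition is_orbit :: "(real \<Rightarrow> config) \<Rightarrow> bool" where
  "is_orbit x \<longleftrightarrow> (\<forall>t. \<not> has_collision (x t)) \<and>
     (\<exists>v. \<forall>t. (x has_vector_derivative v t) (at t) \<and>
               (v has_vector_derivative force (x t)) (at t))"

definition periodic :: "(real \<Rightarrow> 'a) \<Rightarrow> bool" where
  "periodic x \<longleftrightarrow> (\<exists>T>0. \<forall>t. x (t + T) = x t)"

text \<open>\<open>x t = F (t \<omega>\<^sub>0, \<dots>, t \<omega>\<^bsub>k-1\<^esub>)\<close> with \<open>k \<ge> 2\<close> rationally independent frequencies and \<open>F\<close>
  continuous and 1-periodic in each of \<open>k\<close> variables, i.e. a continuous function on the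
  \<open>k\<close>-torus. A point of \<open>\<real>\<^sup>k\<close> is a function on \<^typ>\<open>nat\<close> vanishing from \<open>k\<close> on; the topology is
  the product topology.\<close>

definition quasi_periodic :: "(real \<Rightarrow> 'a::topological_space) \<Rightarrow> bool" where
  "quasi_periodic x \<longleftrightarrow> (\<exists>(k::nat) (\<omega> :: nat \<Rightarrow> real) (F :: (nat \<Rightarrow> real) \<Rightarrow> 'a).
      k \<ge> 2
    \<and> (\<forall>n :: nat \<Rightarrow> int. (\<Sum>i<k. of_int (n i) * \<omega> i) = 0 \<longrightarrow> (\<forall>i<k. n i = 0))
    \<and> continuous_on {u. \<forall>i\<ge>k. u i = 0} F
    \<and> (\<forall>u. (\<forall>i\<ge>k. u i = 0) \<longrightarrow> (\<forall>i<k. F (u(i := u i + 1)) = F u))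
    \<and> (\<forall>t. x t = F (\<lambda>i. if i < k then t * \<omega> i else 0)))"

end

(* Let w = q_j - q_i collide and pair i, j with the two remaining bodies k, l; put w' = q_l - q_k and
   let y join the two centres of mass. The kinetic energy is |w|^2/4 + |w'|^2/4 + |y|^2/2 (in the
   velocities), and 1/r >= 3/(2 rho) - r^2/(2 rho^3) bounds the four cross potentials by a constant minus a
   quadratic form in w, w', y. The boundary conditions control that form by the kinetic energy (Poincare
   inequalities; for the pairs 12 and 34 the angle theta enters, with rho^3 = 4/theta^2), so what remains is
   a Kepler problem for w with a slightly smaller mass, in which a collision costs at least
   (9/2) (m/3)^(1/3). For theta <= 0.0539 pi every collision path is therefore more expensive than
   two perpendicular circular binaries whose centres turn by theta. A minimizer is thus collision-free and
   solves Newton's equations, meets both boundary sets in their relative interior and orthogonally, and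
   is continued by the reflections fixing the boundary sets. Four of the resulting return maps compose to
   the rotation by 8 theta, so the orbit is a periodic motion seen in a uniformly rotating frame. *)
theory Submission
  imports Defs
begin

text \<open>Replacing 1/r by its tangent in the variable r^2 decouples the cross potentials: the
  four squared distances add up to a diagonal form in w, w' and y. For the pairs 12 and 34, \<rho>
  minimises \<rho>^2 \<theta>^2/2 + 4/\<rho>, the action rate of two bodies of mass 2 turning at
  rate \<theta>. With this \<rho> the negative term in y is exactly what the kinetic energy of y
  dominates. The competitor uses the same \<rho>, so up to 0.083/\<rho> both actions share the term
  6/\<rho>, and what is compared is a collision with a pair of circular binaries. For the other
  pairs the fixed value \<rho> = 4 is enough. The reduced mass of w is 1/2, that is A^3 = 6 in m =
  3/A^3; taking A = 1.85 or A = 2.15 instead gives up part of its kinetic energy to pay for the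
  quadratic terms. At the largest \<theta> a margin of about 0.1 is left in an action near 3.5. A
  second difficulty is that a minimizer is a priori only of class H^1: its velocity is compared in
  L^2 with that of a twice differentiable path.\<close>

section \<open>Square-integrable weak derivatives on an interval\<close>

text \<open>\<open>v\<close> is any representative of the weak derivative instead of
  \<open>vector_derivative\<close>, so that sums, linear images and restrictions to subintervals
  stay in the notion without tracking where \<open>u\<close> is differentiable.\<close>

definition H1_deriv :: "real \<Rightarrow> real \<Rightarrow> (real \<Rightarrow> 'a::euclidean_space) \<Rightarrow> (real \<Rightarrow> 'a) \<Rightarrow> bool" where
  "H1_deriv a b u v \<longleftrightarrow> v \<in> borel_measurable (lebesgue_on {a..b})
     \<and> (\<lambda>t. (norm (v t))\<^sup>2) integrable_on {a..b}
     \<and> (\<forall>t\<in>{a..b}. (v has_integral (u t - u a)) {a..t})"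

abbreviation energy :: "(real \<Rightarrow> 'a::real_normed_vector) \<Rightarrow> real" where
  "energy v \<equiv> integral {0..1} (\<lambda>t. (norm (v t))\<^sup>2)"

lemma integrable_lebesgue_on_iff:
  fixes f :: "'a::euclidean_space \<Rightarrow> 'b::euclidean_space"
  assumes "S \<in> sets lebesgue"
  shows "integrable (lebesgue_on S) f \<longleftrightarrow> f absolutely_integrable_on S"
  using assms by (simp add: set_integrable_def integrable_restrict_space)

lemma integral_mono_negligible:
  fixes f g :: "real \<Rightarrow> real"
  assumes "f integrable_on S" "g integrable_on S" "negligible N"
    and le: "\<And>t. t \<in> S \<Longrightarrow> t \<notin> N \<Longrightarrow> f t \<le> g t"
  shows "integral S f \<le> integral S g"
proof -
  let ?g = "\<lambda>t. if t \<in> N then f t else g t"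
  have gi: "?g integrable_on S"
    by (rule integrable_spike[OF assms(2,3)]) auto
  have "integral S f \<le> integral S ?g"
    by (rule integral_le[OF assms(1) gi]) (use le in auto)
  also have "integral S ?g = integral S g"
    by (rule integral_spike[OF assms(3)]) auto
  finally show ?thesis .
qed

lemma square_integrable_imp_abs_integrable:
  fixes v :: "real \<Rightarrow> 'a::euclidean_space"
  assumes "v \<in> borel_measurable (lebesgue_on {a..b})" "(\<lambda>t. (norm (v t))\<^sup>2) integrable_on {a..b}"
  shows "v absolutely_integrable_on {a..b}"
proof (rule measurable_bounded_by_integrable_imp_absolutely_integrable[OF assms(1)])
  show "(\<lambda>t. 1 + (norm (v t))\<^sup>2) integrable_on {a..b}"
    by (intro integrable_add assms(2) integrable_const_ivl)
  fix t
  have "0 \<le> (norm (v t) - 1/2)\<^sup>2" by simp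
  then show "norm (v t) \<le> 1 + (norm (v t))\<^sup>2"
    by (simp add: power2_eq_square algebra_simps)
qed simp

lemma inner_L2_abs_integrable:
  fixes v w :: "real \<Rightarrow> 'a::euclidean_space"
  assumes "v \<in> borel_measurable (lebesgue_on {a..b})" "(\<lambda>t. (norm (v t))\<^sup>2) integrable_on {a..b}"
    and "w \<in> borel_measurable (lebesgue_on {a..b})" "(\<lambda>t. (norm (w t))\<^sup>2) integrable_on {a..b}"
  shows "(\<lambda>t. v t \<bullet> w t) absolutely_integrable_on {a..b}"
proof (rule measurable_bounded_by_integrable_imp_absolutely_integrable)
  show "(\<lambda>t. v t \<bullet> w t) \<in> borel_measurable (lebesgue_on {a..b})"
    using assms by measurable
  show "(\<lambda>t. (norm (v t))\<^sup>2 + (norm (w t))\<^sup>2) integrable_on {a..b}"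
    by (intro integrable_add assms)
  fix t
  have "\<bar>v t \<bullet> w t\<bar> \<le> norm (v t) * norm (w t)" by (rule Cauchy_Schwarz_ineq2)
  also have "\<dots> \<le> (norm (v t))\<^sup>2 + (norm (w t))\<^sup>2"
    using sum_squares_bound[of "norm (v t)" "norm (w t)"] mult_nonneg_nonneg[OF norm_ge_zero norm_ge_zero, of "v t" "w t"]
    by linarith
  finally show "norm (v t \<bullet> w t) \<le> (norm (v t))\<^sup>2 + (norm (w t))\<^sup>2" by simp
qed simp

lemma continuous_measurable_on:
  fixes u :: "real \<Rightarrow> 'a::euclidean_space"
  shows "continuous_on {a..b} u \<Longrightarrow> u \<in> borel_measurable (lebesgue_on {a..b})"
  by (rule continuous_imp_measurable_on_sets_lebesgue) auto

lemma continuous_norm_square_integrable: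
  fixes u :: "real \<Rightarrow> 'a::euclidean_space"
  shows "continuous_on {a..b} u \<Longrightarrow> (\<lambda>t. (norm (u t))\<^sup>2) integrable_on {a..b}"
  by (intro integrable_continuous_real continuous_intros)

lemma H1_derivD:
  assumes "H1_deriv a b u v"
  shows "v \<in> borel_measurable (lebesgue_on {a..b})"
    "(\<lambda>t. (norm (v t))\<^sup>2) integrable_on {a..b}"
    "v absolutely_integrable_on {a..b}"
    "(\<lambda>t. norm (v t)) integrable_on {a..b}"
    "v integrable_on {a..b}"
proof -
  show 1: "v \<in> borel_measurable (lebesgue_on {a..b})" "(\<lambda>t. (norm (v t))\<^sup>2) integrable_on {a..b}"
    using assms by (auto simp: H1_deriv_def)
  show "v absolutely_integrable_on {a..b}"
    by (rule square_integrable_imp_abs_integrable[OF 1])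
  then show "(\<lambda>t. norm (v t)) integrable_on {a..b}" "v integrable_on {a..b}"
    by (auto simp: absolutely_integrable_on_def)
qed

lemma H1_deriv_has_integral:
  assumes "H1_deriv a b u v" "a \<le> s" "s \<le> t" "t \<le> b"
  shows "(v has_integral (u t - u s)) {s..t}"
proof -
  have s: "(v has_integral (u s - u a)) {a..s}" and t: "(v has_integral (u t - u a)) {a..t}"
    using assms by (auto simp: H1_deriv_def)
  have "v integrable_on {s..t}"
    using t assms by (intro integrable_on_subinterval[OF has_integral_integrable[OF t]]) auto
  then have st: "(v has_integral integral {s..t} v) {s..t}"
    by (rule integrable_integral)
  have "(v has_integral (u s - u a + integral {s..t} v)) {a..t}"
    using has_integral_combine[OF assms(2,3) s st] .
  then have "u s - u a + integral {s..t} v = u t - u a"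
    using t has_integral_unique by blast
  then have "integral {s..t} v = u t - u s" by (simp add: algebra_simps)
  with st show ?thesis by simp
qed

lemma H1_deriv_subinterval:
  assumes "H1_deriv a b u v" "a \<le> c" "d \<le> b"
  shows "H1_deriv c d u v"
  unfolding H1_deriv_def
proof (intro conjI ballI)
  have sub: "{c..d} \<subseteq> {a..b}" using assms by auto
  show "v \<in> borel_measurable (lebesgue_on {c..d})"
    using measurable_restrict_mono[OF H1_derivD(1)[OF assms(1)] sub] .
  show "(\<lambda>t. (norm (v t))\<^sup>2) integrable_on {c..d}"
    using integrable_on_subinterval[OF H1_derivD(2)[OF assms(1)] sub] .
  show "(v has_integral (u t - u c)) {c..t}" if "t \<in> {c..d}" for t
    using that assms by (intro H1_deriv_has_integral[OF assms(1)]) auto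
qed

lemma H1_deriv_continuous:
  assumes "H1_deriv a b u v"
  shows "continuous_on {a..b} u"
proof -
  have "continuous_on {a..b} (\<lambda>t. u a + integral {a..t} v)"
    by (intro continuous_intros indefinite_integral_continuous_1 H1_derivD[OF assms])
  moreover have "u a + integral {a..t} v = u t" if "t \<in> {a..b}" for t
    using integral_unique[OF H1_deriv_has_integral[OF assms, of a t]] that by auto
  ultimately show ?thesis
    by (rule continuous_on_eq)
qed

lemma H1_deriv_linear:
  fixes L :: "'a::euclidean_space \<Rightarrow> 'b::euclidean_space"
  assumes "H1_deriv a b u v" "bounded_linear L"
  shows "H1_deriv a b (\<lambda>t. L (u t)) (\<lambda>t. L (v t))"
proof -
  interpret bounded_linear L by fact
  have Lc: "continuous_on UNIV L" by (simp add: linear_continuous_on bounded_linear_axioms)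
  have m: "(\<lambda>t. L (v t)) \<in> borel_measurable (lebesgue_on {a..b})"
    using borel_measurable_continuous_onI[OF Lc] H1_derivD(1)[OF assms(1)] by measurable
  obtain K where K: "\<And>x. norm (L x) \<le> norm x * K" using bounded by blast
  have "(\<lambda>t. (norm (L (v t)))\<^sup>2) absolutely_integrable_on {a..b}"
  proof (rule measurable_bounded_by_integrable_imp_absolutely_integrable)
    show "(\<lambda>t. (norm (L (v t)))\<^sup>2) \<in> borel_measurable (lebesgue_on {a..b})"
      using m by measurable
    show "(\<lambda>t. (norm (v t))\<^sup>2 * K\<^sup>2) integrable_on {a..b}"
      by (intro integrable_on_mult_left H1_derivD[OF assms(1)])
    show "norm ((norm (L (v t)))\<^sup>2) \<le> (norm (v t))\<^sup>2 * K\<^sup>2" for t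
      using power_mono[OF K, of "v t" 2] by (simp add: power_mult_distrib)
  qed simp
  moreover have "((\<lambda>t. L (v t)) has_integral (L (u t) - L (u a))) {a..t}" if "t \<in> {a..b}" for t
    using has_integral_linear[OF _ assms(2), of v "u t - u a" "{a..t}"] assms(1) that
    by (auto simp: H1_deriv_def diff o_def)
  ultimately show ?thesis
    using m by (auto simp: H1_deriv_def absolutely_integrable_on_def)
qed

lemma H1_deriv_add:
  fixes u1 :: "real \<Rightarrow> 'a::euclidean_space"
  assumes "H1_deriv a b u1 v1" "H1_deriv a b u2 v2"
  shows "H1_deriv a b (\<lambda>t. u1 t + u2 t) (\<lambda>t. v1 t + v2 t)"
proof -
  have m: "(\<lambda>t. v1 t + v2 t) \<in> borel_measurable (lebesgue_on {a..b})"
    using H1_derivD(1)[OF assms(1)] H1_derivD(1)[OF assms(2)] by measurable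
  have "(\<lambda>t. (norm (v1 t + v2 t))\<^sup>2) integrable_on {a..b}"
  proof -
    have "(\<lambda>t. (norm (v1 t))\<^sup>2 + 2 * (v1 t \<bullet> v2 t) + (norm (v2 t))\<^sup>2) integrable_on {a..b}"
      by (intro integrable_add integrable_on_mult_right H1_derivD[OF assms(1)] H1_derivD[OF assms(2)]
          set_lebesgue_integral_eq_integral inner_L2_abs_integrable)
    moreover have "(norm (v1 t + v2 t))\<^sup>2 = (norm (v1 t))\<^sup>2 + 2 * (v1 t \<bullet> v2 t) + (norm (v2 t))\<^sup>2" for t
      by (simp add: power2_norm_eq_inner inner_add inner_commute)
    ultimately show ?thesis by simp
  qed
  moreover have "((\<lambda>t. v1 t + v2 t) has_integral (u1 t + u2 t - (u1 a + u2 a))) {a..t}" if "t \<in> {a..b}" for t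
    using has_integral_add[of v1 "u1 t - u1 a" "{a..t}" v2 "u2 t - u2 a"] assms that
    by (auto simp: H1_deriv_def algebra_simps)
  ultimately show ?thesis using m by (auto simp: H1_deriv_def)
qed

lemma H1_deriv_diff:
  fixes u1 :: "real \<Rightarrow> 'a::euclidean_space"
  assumes "H1_deriv a b u1 v1" "H1_deriv a b u2 v2"
  shows "H1_deriv a b (\<lambda>t. u1 t - u2 t) (\<lambda>t. v1 t - v2 t)"
proof -
  have "H1_deriv a b (\<lambda>t. - u2 t) (\<lambda>t. - v2 t)"
    by (rule H1_deriv_linear[OF assms(2)]) (intro bounded_linear_minus bounded_linear_ident)
  from H1_deriv_add[OF assms(1) this] show ?thesis by simp
qed

lemma H1_deriv_C1:
  fixes u :: "real \<Rightarrow> 'a::euclidean_space"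
  assumes d: "\<And>t. t \<in> {a..b} \<Longrightarrow> (u has_vector_derivative v t) (at t within {a..b})"
    and c: "continuous_on {a..b} v"
  shows "H1_deriv a b u v"
  unfolding H1_deriv_def
proof (intro conjI ballI)
  show "v \<in> borel_measurable (lebesgue_on {a..b})" by (rule continuous_measurable_on[OF c])
  show "(\<lambda>t. (norm (v t))\<^sup>2) integrable_on {a..b}" by (rule continuous_norm_square_integrable[OF c])
  fix t assume t: "t \<in> {a..b}"
  show "(v has_integral u t - u a) {a..t}"
  proof (rule fundamental_theorem_of_calculus)
    fix x assume "x \<in> {a..t}"
    then show "(u has_vector_derivative v x) (at x within {a..t})"
      using t by (intro has_vector_derivative_within_subset[OF d]) auto
  qed (use t in auto)
qed

lemma H1_imp_H1_deriv:
  fixes q :: "real \<Rightarrow> 'a::euclidean_space"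
  assumes "q \<in> H1"
  shows "H1_deriv 0 1 q (\<lambda>t. vector_derivative q (at t))"
proof -
  have "(\<lambda>t. (norm (vector_derivative q (at t)))\<^sup>2) absolutely_integrable_on {0..1}"
    using assms by (subst integrable_lebesgue_on_iff[symmetric]) (auto simp: H1_def)
  then show ?thesis
    using assms by (auto simp: H1_def H1_deriv_def absolutely_integrable_on_def)
qed

text \<open>Cauchy-Schwarz: with \<open>c\<close> the mean velocity on \<open>{s..t}\<close>, the
  integral of |v - c|^2 is nonnegative, and expanding it gives the bound.\<close>

lemma H1_deriv_increment:
  fixes u :: "real \<Rightarrow> 'a::euclidean_space"
  assumes "H1_deriv a b u v" "a \<le> s" "s \<le> t" "t \<le> b"
  shows "(norm (u t - u s))\<^sup>2 \<le> (t - s) * integral {s..t} (\<lambda>t. (norm (v t))\<^sup>2)"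
proof (cases "s = t")
  case False
  then have st: "s < t" using assms by simp
  define c where "c = (u t - u s) /\<^sub>R (t - s)"
  have h: "H1_deriv s t u v" by (rule H1_deriv_subinterval) (use assms in auto)
  have "((\<lambda>r. (norm (v r))\<^sup>2 - 2 * (v r \<bullet> c) + (norm c)\<^sup>2) has_integral
     (integral {s..t} (\<lambda>t. (norm (v t))\<^sup>2) - 2 * ((u t - u s) \<bullet> c) + (t - s) * (norm c)\<^sup>2)) {s..t}"
    using has_integral_const_real[of "(norm c)\<^sup>2" s t] st
    by (intro has_integral_add has_integral_diff has_integral_mult_right integrable_integral H1_derivD[OF h]
      has_integral_linear[OF H1_deriv_has_integral[OF assms] bounded_linear_inner_left, unfolded o_def]) auto
  moreover have "(norm (v r))\<^sup>2 - 2 * (v r \<bullet> c) + (norm c)\<^sup>2 = (norm (v r - c))\<^sup>2" for r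
    by (simp add: power2_norm_eq_inner inner_diff inner_commute)
  ultimately have "0 \<le> integral {s..t} (\<lambda>t. (norm (v t))\<^sup>2) - 2 * ((u t - u s) \<bullet> c) + (t - s) * (norm c)\<^sup>2"
    by (auto intro: has_integral_nonneg)
  also have "2 * ((u t - u s) \<bullet> c) = 2 * (norm (u t - u s))\<^sup>2 / (t - s)"
    by (simp add: c_def power2_norm_eq_inner divide_inverse)
  also have "(t - s) * (norm c)\<^sup>2 = (norm (u t - u s))\<^sup>2 / (t - s)"
  proof -
    have "norm c = norm (u t - u s) / (t - s)" using st by (simp add: c_def divide_inverse mult.commute)
    then show ?thesis using st by (simp add: power2_eq_square)
  qed
  finally have "(norm (u t - u s))\<^sup>2 / (t - s) \<le> integral {s..t} (\<lambda>t. (norm (v t))\<^sup>2)" by simp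
  then show ?thesis using st by (simp add: field_simps)
qed simp

section \<open>Integration by parts for weak derivatives\<close>

lemma constant_of_quadratic_increments:
  fixes F E :: "real \<Rightarrow> real"
  assumes "a \<le> b"
    and le: "\<And>s t. a \<le> s \<Longrightarrow> s \<le> t \<Longrightarrow> t \<le> b \<Longrightarrow> \<bar>F t - F s\<bar> \<le> (t - s) * (E t - E s)"
  shows "F b = F a"
proof -
  \<comment> \<open>On a partition into \<open>n\<close> equal parts the increments of
    \<open>E\<close> telescope and leave a bound of order 1/n. Constancy is obtained this way
    without differentiating \<open>F\<close> anywhere.\<close>
  have "\<bar>F b - F a\<bar> \<le> (b - a) * (E b - E a) / real n" if n: "n > 0" for n :: nat
  proof -
    define x where "x i = a + (b - a) * real i / real n" for i
    have x: "x 0 = a" "x n = b" using n by (auto simp: x_def)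
    have step: "\<bar>F (x (Suc i)) - F (x i)\<bar> \<le> (b - a) / real n * (E (x (Suc i)) - E (x i))" if "i < n" for i
    proof -
      have "(b - a) * real (Suc i) / real n \<le> (b - a) * 1"
        unfolding times_divide_eq_right[symmetric] using n that assms(1) by (intro mult_left_mono) auto
      then have "x (Suc i) \<le> b" by (simp add: x_def)
      moreover have "a \<le> x i" using assms(1) by (simp add: x_def)
      moreover have d: "x (Suc i) - x i = (b - a) / real n" by (simp add: x_def algebra_simps add_divide_distrib diff_divide_distrib)
      moreover have "x i \<le> x (Suc i)" using d assms(1) divide_nonneg_nonneg[of "b - a" "real n"] by linarith
      ultimately show ?thesis using le[of "x i" "x (Suc i)"] by simp
    qed
    have "\<bar>F b - F a\<bar> = \<bar>\<Sum>i<n. F (x (Suc i)) - F (x i)\<bar>"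
      using sum_lessThan_telescope[of "\<lambda>i. F (x i)" n] by (simp add: x)
    also have "\<dots> \<le> (\<Sum>i<n. \<bar>F (x (Suc i)) - F (x i)\<bar>)" by (rule sum_abs)
    also have "\<dots> \<le> (\<Sum>i<n. (b - a) / real n * (E (x (Suc i)) - E (x i)))"
      by (intro sum_mono step) auto
    also have "\<dots> = (b - a) * (E b - E a) / real n"
      using sum_lessThan_telescope[of "\<lambda>i. E (x i)" n]
      unfolding sum_distrib_left[symmetric] by (simp add: x)
    finally show ?thesis .
  qed
  then have ev: "eventually (\<lambda>n. \<bar>F b - F a\<bar> \<le> (b - a) * (E b - E a) / real n) sequentially"
    by (auto simp: eventually_sequentially intro: exI[of _ 1])
  have "(\<lambda>n. (b - a) * (E b - E a) / real n) \<longlonglongrightarrow> 0"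
    by (rule lim_const_over_n)
  then have "\<bar>F b - F a\<bar> \<le> 0"
    by (rule tendsto_lowerbound[OF _ ev]) simp
  then show ?thesis by simp
qed

lemma inner_continuous_abs_integrable:
  fixes v u :: "real \<Rightarrow> 'a::euclidean_space"
  assumes "v \<in> borel_measurable (lebesgue_on {a..b})" "(\<lambda>t. (norm (v t))\<^sup>2) integrable_on {a..b}"
    and "continuous_on {a..b} u"
  shows "(\<lambda>t. v t \<bullet> u t) integrable_on {a..b}" "(\<lambda>t. u t \<bullet> v t) integrable_on {a..b}"
  using inner_L2_abs_integrable[OF assms(1,2) continuous_measurable_on[OF assms(3)]
      continuous_norm_square_integrable[OF assms(3)]]
  by (auto simp: absolutely_integrable_on_def inner_commute)

text \<open>The product minus the integral of its formal derivative has increments of the order (t -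
  s) times the energy spent on \<open>{s..t}\<close>, hence is constant by
  \<open>constant_of_quadratic_increments\<close>. The argument works with increments alone.\<close>

lemma H1_deriv_inner:
  fixes u1 u2 :: "real \<Rightarrow> 'a::euclidean_space"
  assumes h1: "H1_deriv a b u1 v1" and h2: "H1_deriv a b u2 v2" and "a \<le> b"
  shows "((\<lambda>t. v1 t \<bullet> u2 t + u1 t \<bullet> v2 t) has_integral (u1 b \<bullet> u2 b - u1 a \<bullet> u2 a)) {a..b}"
proof -
  let ?f = "\<lambda>t. v1 t \<bullet> u2 t + u1 t \<bullet> v2 t"
  let ?e = "\<lambda>t. (norm (v1 t))\<^sup>2 + (norm (v2 t))\<^sup>2"
  define F where "F t = u1 t \<bullet> u2 t - integral {a..t} ?f" for t
  define E where "E t = integral {a..t} ?e" for t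
  have fi: "?f integrable_on {a..b}"
    by (intro integrable_add inner_continuous_abs_integrable H1_derivD[OF h1] H1_derivD[OF h2]
       H1_deriv_continuous[OF h1] H1_deriv_continuous[OF h2])
  have ei: "?e integrable_on {a..b}"
    by (intro integrable_add H1_derivD[OF h1] H1_derivD[OF h2])
  have "F b = F a"
  proof (rule constant_of_quadratic_increments[OF \<open>a \<le> b\<close>])
    fix s t assume st: "a \<le> s" "s \<le> t" "t \<le> b"
    have g1: "H1_deriv s t u1 v1" and g2: "H1_deriv s t u2 v2"
      using H1_deriv_subinterval[OF h1] H1_deriv_subinterval[OF h2] st by auto
    have Fd: "integral {a..t} ?f = integral {a..s} ?f + integral {s..t} ?f"
      using st by (intro Henstock_Kurzweil_Integration.integral_combine[symmetric]
           integrable_on_subinterval[OF fi]) auto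
    have Ed: "E t - E s = integral {s..t} ?e"
      using st Henstock_Kurzweil_Integration.integral_combine[of a s t ?e]
          integrable_on_subinterval[OF ei, of a t] by (auto simp: E_def)
    have fst: "(?f has_integral integral {s..t} ?f) {s..t}"
      using st by (intro integrable_integral integrable_on_subinterval[OF fi]) auto
    have est: "(?e has_integral (E t - E s)) {s..t}" unfolding Ed
      using st by (intro integrable_integral integrable_on_subinterval[OF ei]) auto
    \<comment> \<open>The discrete Leibniz rule, with \<open>u2\<close> frozen at \<open>t\<close>
      and \<open>u1\<close> at \<open>s\<close>; each term of its difference to \<open>?f\<close>
      then contains a small increment.\<close>
    have "((\<lambda>r. v1 r \<bullet> u2 t + u1 s \<bullet> v2 r) has_integral
        ((u1 t - u1 s) \<bullet> u2 t + u1 s \<bullet> (u2 t - u2 s))) {s..t}"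
      by (intro has_integral_add
        has_integral_linear[OF H1_deriv_has_integral[OF h1 st] bounded_linear_inner_left, unfolded o_def]
        has_integral_linear[OF H1_deriv_has_integral[OF h2 st] bounded_linear_inner_right, unfolded o_def])
    from has_integral_diff[OF this fst]
    have "((\<lambda>r. v1 r \<bullet> (u2 t - u2 r) + (u1 s - u1 r) \<bullet> v2 r) has_integral
        ((u1 t - u1 s) \<bullet> u2 t + u1 s \<bullet> (u2 t - u2 s) - integral {s..t} ?f)) {s..t}"
      by (simp add: inner_diff_left inner_diff_right algebra_simps)
    moreover have "F t - F s = (u1 t - u1 s) \<bullet> u2 t + u1 s \<bullet> (u2 t - u2 s) - integral {s..t} ?f"
      unfolding F_def Fd by (simp add: inner_diff_left inner_diff_right)
    ultimately have hi: "((\<lambda>r. v1 r \<bullet> (u2 t - u2 r) + (u1 s - u1 r) \<bullet> v2 r) has_integral (F t - F s)) {s..t}"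
      by simp
    have ee: "integral {s..t} ?e = integral {s..t} (\<lambda>t. (norm (v1 t))\<^sup>2) + integral {s..t} (\<lambda>t. (norm (v2 t))\<^sup>2)"
      by (intro integral_add H1_derivD[OF g1] H1_derivD[OF g2])
    define G where "G = sqrt ((t - s) * (E t - E s))"
    have E0: "0 \<le> E t - E s" unfolding Ed by (intro integral_nonneg integrable_on_subinterval[OF ei]) (use st in auto)
    have b1: "norm (u1 s - u1 r) \<le> G" and b2: "norm (u2 t - u2 r) \<le> G" if r: "r \<in> {s..t}" for r
    proof -
      have i1: "integral {s..r} (\<lambda>t. (norm (v1 t))\<^sup>2) \<le> integral {s..t} (\<lambda>t. (norm (v1 t))\<^sup>2)"
        using r by (intro integral_subset_le integrable_on_subinterval[OF H1_derivD(2)[OF g1]]) auto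
      have i2: "integral {r..t} (\<lambda>t. (norm (v2 t))\<^sup>2) \<le> integral {s..t} (\<lambda>t. (norm (v2 t))\<^sup>2)"
        using r by (intro integral_subset_le integrable_on_subinterval[OF H1_derivD(2)[OF g2]]) auto
      have p1: "0 \<le> integral {s..t} (\<lambda>t. (norm (v1 t))\<^sup>2)" and p2: "0 \<le> integral {s..t} (\<lambda>t. (norm (v2 t))\<^sup>2)"
        by (auto intro!: integral_nonneg H1_derivD[OF g1] H1_derivD[OF g2])
      have "(norm (u1 r - u1 s))\<^sup>2 \<le> (r - s) * integral {s..r} (\<lambda>t. (norm (v1 t))\<^sup>2)"
        using r by (intro H1_deriv_increment[OF g1]) auto
      also have "\<dots> \<le> (t - s) * (E t - E s)"
        unfolding Ed ee using r i1 p2 by (intro mult_mono integral_nonneg integrable_on_subinterval[OF H1_derivD(2)[OF g1]]) auto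
      finally show "norm (u1 s - u1 r) \<le> G" unfolding G_def by (simp add: norm_minus_commute real_le_rsqrt)
      have "(norm (u2 t - u2 r))\<^sup>2 \<le> (t - r) * integral {r..t} (\<lambda>t. (norm (v2 t))\<^sup>2)"
        using r by (intro H1_deriv_increment[OF g2]) auto
      also have "\<dots> \<le> (t - s) * (E t - E s)"
        unfolding Ed ee using r i2 p1 by (intro mult_mono integral_nonneg integrable_on_subinterval[OF H1_derivD(2)[OF g2]]) auto
      finally show "norm (u2 t - u2 r) \<le> G" unfolding G_def by (simp add: real_le_rsqrt)
    qed
    \<comment> \<open>\<open>|v| G \<le> (t - s) |v|\<^sup>2 / 2 + G\<^sup>2 / (2 (t - s))\<close>, which makes both terms of the order of \<open>(t - s) (E t - E s)\<close>.\<close>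
    show "\<bar>F t - F s\<bar> \<le> (t - s) * ((\<lambda>t. 2 * E t) t - (\<lambda>t. 2 * E t) s)"
    proof (cases "s = t")
      case False
      then have st': "s < t" using st by simp
      have G2: "G\<^sup>2 = (t - s) * (E t - E s)" unfolding G_def using E0 st by simp
      have "norm (F t - F s) \<le> (t - s) * (E t - E s) / 2 + (t - s) * (E t - E s)"
      proof (rule order.trans)
        show "norm (F t - F s) \<le> integral {s..t} (\<lambda>r. (t - s) / 2 * ?e r + (E t - E s))"
          unfolding integral_unique[OF hi, symmetric]
        proof (rule integral_norm_bound_integral)
          show "(\<lambda>r. v1 r \<bullet> (u2 t - u2 r) + (u1 s - u1 r) \<bullet> v2 r) integrable_on {s..t}" using hi by blast
          show "(\<lambda>r. (t - s) / 2 * ?e r + (E t - E s)) integrable_on {s..t}"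
            by (intro integrable_add integrable_on_mult_right has_integral_integrable[OF est] integrable_const_ivl)
          fix r assume r: "r \<in> {s..t}"
          have y: "x * G \<le> (t - s) / 2 * x\<^sup>2 + (E t - E s) / 2" for x
          proof -
            have "0 \<le> ((t - s) * x - G)\<^sup>2 / (2 * (t - s))" using st' by simp
            also have "\<dots> = (t - s) / 2 * x\<^sup>2 + G\<^sup>2 / (2 * (t - s)) - x * G"
              using st' by (simp add: power2_eq_square field_simps)
            also have "G\<^sup>2 / (2 * (t - s)) = (E t - E s) / 2" unfolding G2 using st' by (simp add: field_simps)
            finally show ?thesis by simp
          qed
          have "norm (v1 r \<bullet> (u2 t - u2 r) + (u1 s - u1 r) \<bullet> v2 r)
             \<le> norm (v1 r) * norm (u2 t - u2 r) + norm (u1 s - u1 r) * norm (v2 r)"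
            using Cauchy_Schwarz_ineq2[of "v1 r" "u2 t - u2 r"] Cauchy_Schwarz_ineq2[of "u1 s - u1 r" "v2 r"]
            by simp
          also have "\<dots> \<le> norm (v1 r) * G + norm (v2 r) * G"
            using mult_left_mono[OF b2[OF r], of "norm (v1 r)"] mult_right_mono[OF b1[OF r], of "norm (v2 r)"]
            by (simp add: mult.commute)
          also have "\<dots> \<le> (t - s) / 2 * ?e r + (E t - E s)"
            using add_mono[OF y[of "norm (v1 r)"] y[of "norm (v2 r)"]] by (simp add: distrib_left)
          finally show "norm (v1 r \<bullet> (u2 t - u2 r) + (u1 s - u1 r) \<bullet> v2 r) \<le> (t - s) / 2 * ?e r + (E t - E s)" .
        qed
        show "integral {s..t} (\<lambda>r. (t - s) / 2 * ?e r + (E t - E s)) \<le> (t - s) * (E t - E s) / 2 + (t - s) * (E t - E s)"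
          using integral_unique[OF has_integral_add[OF has_integral_mult_right[OF est, of "(t - s) / 2"]
             has_integral_const_real[of "E t - E s" s t]]] st by simp
      qed
      moreover have "0 \<le> (t - s) * (E t - E s)" using E0 st by simp
      moreover have "(t - s) * (2 * E t - 2 * E s) = 2 * ((t - s) * (E t - E s))" by (simp add: algebra_simps)
      ultimately have "\<bar>F t - F s\<bar> \<le> (t - s) * (2 * E t - 2 * E s)" unfolding real_norm_def by linarith
      then show ?thesis .
    qed (simp add: F_def)
  qed
  then have "integral {a..b} ?f = u1 b \<bullet> u2 b - u1 a \<bullet> u2 a"
    using \<open>a \<le> b\<close> by (simp add: F_def)
  then show ?thesis using fi by (metis integrable_integral)
qed

section \<open>A lower bound for the action of a collision\<close>

text \<open>A lower bound by duality for the Kepler action of mass m = 3/A^3 on one side of a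
  collision; \<epsilon> tells at which end of the interval the collision sits. Let \<rho> = A
  \<sigma>^2 with \<sigma> the cube root of the time distance to the collision, which is the growth
  of a collision orbit. The tangent of 1/r at \<rho> makes the potential linear with force
  1/\<rho>^2; integrating this force against the path by parts and completing the square in the
  velocity leaves an explicit integral. For e = 0 it equals B (6/A - 9/(2 m A^4)), and A^3 = 3/m
  maximises this.\<close>

lemma collision_half_bound:
  fixes w v :: "real \<Rightarrow> 'a::euclidean_space" and U :: "real \<Rightarrow> real" and \<epsilon> :: real
  assumes h: "H1_deriv a b w v" and ab: "a \<le> b"
    and dir: "\<epsilon> = 1 \<and> c = a \<and> d = b \<or> \<epsilon> = -1 \<and> c = b \<and> d = a"
    and wc: "w c = 0"
    and U: "U integrable_on {a..b}" "negligible N"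
      "\<And>t. t \<in> {a..b} - N \<Longrightarrow> w t \<noteq> 0 \<and> 1 / norm (w t) \<le> U t"
    and A: "0 < A" and e: "0 < e" and B: "B = (b - a + e ^ 3) powr (1/3)"
  shows "9 / (2 * A) * (B - e) \<le> integral {a..b} (\<lambda>t. 3 / (2 * A ^ 3) * (norm (v t))\<^sup>2 + U t)"
proof -
  \<comment> \<open>The shift e^3 keeps \<sigma> at least \<open>e\<close>, so that \<Phi> stays
    bounded up to the collision; it disappears in the limit of
    \<open>collision_bound\<close>.\<close>
  define \<sigma> where "\<sigma> t = (\<epsilon> * (t - c) + e ^ 3) powr (1/3)" for t
  \<comment> \<open>The momentum produced by the force 1/(A \<sigma>^2)^2, normalised to vanish at
    the end opposite to the collision, as it does at a free end point.\<close>
  define \<Phi> where "\<Phi> t = 3 / A\<^sup>2 * (1 / \<sigma> t - 1 / B)" for t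
  \<comment> \<open>The length of the path between the collision and \<open>t\<close>: a majorant of
    |w| with weak derivative \<epsilon> |v|, which spares differentiating the norm.\<close>
  define g where "g t = \<epsilon> * (integral {a..t} (\<lambda>t. norm (v t)) - integral {a..c} (\<lambda>t. norm (v t)))" for t
  \<comment> \<open>A primitive, in the variable \<sigma>, of what completing the square
    leaves.\<close>
  define \<Psi> where "\<Psi> x = 6 * x / A - 3 / (2 * A) * (3 * x - 3 * x\<^sup>2 / B + x ^ 3 / B\<^sup>2)" for x
  have eps: "\<epsilon> * \<epsilon> = 1" "\<bar>\<epsilon>\<bar> = 1" using dir by auto
  have e3: "0 < e ^ 3" using e by simp
  have pos: "0 < \<epsilon> * (t - c) + e ^ 3" if "t \<in> {a..b}" for t
  proof -
    have "0 < \<epsilon> * (t - c) + x" if "0 < x" for x using dir \<open>t \<in> {a..b}\<close> that by auto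
    from this[OF e3] show ?thesis .
  qed
  have spos: "0 < \<sigma> t" if "t \<in> {a..b}" for t using pos[OF that] by (simp add: \<sigma>_def)
  have "0 < b - a + e ^ 3" using ab e3 by linarith
  then have Bpos: "0 < B" using B by simp
  have ee: "(e ^ 3) powr (1/3) = e"
  proof -
    have "(e powr 3) powr (1/3) = e" unfolding powr_powr using e by simp
    then show ?thesis using e by simp
  qed
  have ende: "\<sigma> c = e" "\<sigma> d = B"
    using dir B ee by (auto simp: \<sigma>_def)
  have eB: "e \<le> B"
  proof -
    have "(e ^ 3) powr (1/3) \<le> B" unfolding B using ab e3 by (intro powr_mono2) auto
    then show ?thesis using ende(1) by (simp add: \<sigma>_def)
  qed
  have dsig: "(\<sigma> has_real_derivative \<epsilon> / (3 * (\<sigma> t)\<^sup>2)) (at t within S)" if "t \<in> {a..b}" for t S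
  proof -
    have "(\<sigma> has_real_derivative (1/3) * (\<epsilon> * (t - c) + e ^ 3) powr (1/3 - 1) * \<epsilon>) (at t within S)"
      unfolding \<sigma>_def using pos[OF that] by (auto intro!: derivative_eq_intros)
    moreover have "(\<epsilon> * (t - c) + e ^ 3) powr (1/3 - 1) = 1 / (\<sigma> t)\<^sup>2"
    proof -
      have "(\<sigma> t)\<^sup>2 = (\<epsilon> * (t - c) + e ^ 3) powr (2/3)"
        using pos[OF that] by (simp add: \<sigma>_def power2_eq_square powr_add[symmetric])
      then show ?thesis using pos[OF that] by (simp add: powr_minus_divide[symmetric])
    qed
    ultimately show ?thesis by (simp add: field_simps)
  qed
  have nvi: "(\<lambda>t. norm (v t)) integrable_on {a..b}" by (rule H1_derivD[OF h])
  have hg: "H1_deriv a b g (\<lambda>t. \<epsilon> * norm (v t))"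
    unfolding H1_deriv_def
  proof (intro conjI ballI)
    show "(\<lambda>t. \<epsilon> * norm (v t)) \<in> borel_measurable (lebesgue_on {a..b})"
      using H1_derivD(1)[OF h] by measurable
    show "(\<lambda>t. (norm (\<epsilon> * norm (v t)))\<^sup>2) integrable_on {a..b}"
      using H1_derivD(2)[OF h] by (simp add: abs_mult eps)
    fix t assume t: "t \<in> {a..b}"
    have "((\<lambda>t. norm (v t)) has_integral integral {a..t} (\<lambda>t. norm (v t))) {a..t}"
      using t by (intro integrable_integral integrable_on_subinterval[OF nvi]) auto
    from has_integral_mult_right[OF this, of \<epsilon>]
    show "((\<lambda>t. \<epsilon> * norm (v t)) has_integral g t - g a) {a..t}"
      by (simp add: g_def algebra_simps)
  qed
  have wg: "norm (w t) \<le> g t" if t: "t \<in> {a..b}" for t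
  proof -
    have key: "norm (w y - w x) \<le> integral {a..y} (\<lambda>t. norm (v t)) - integral {a..x} (\<lambda>t. norm (v t))"
      if "a \<le> x" "x \<le> y" "y \<le> b" for x y
    proof -
      have "norm (w y - w x) \<le> integral {x..y} (\<lambda>t. norm (v t))"
        unfolding integral_unique[OF H1_deriv_has_integral[OF h that], symmetric]
        using that by (intro integral_norm_bound_integral integrable_on_subinterval[OF H1_derivD(5)[OF h]]
          integrable_on_subinterval[OF nvi]) auto
      also have "\<dots> = integral {a..y} (\<lambda>t. norm (v t)) - integral {a..x} (\<lambda>t. norm (v t))"
        using that Henstock_Kurzweil_Integration.integral_combine[of a x y "\<lambda>t. norm (v t)"]
          integrable_on_subinterval[OF nvi, of a y] by auto
      finally show ?thesis .
    qed
    show ?thesis using dir key[of c t] key[of t c] t wc by (auto simp: g_def)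
  qed
  have hPhi: "H1_deriv a b \<Phi> (\<lambda>t. - \<epsilon> / (A\<^sup>2 * (\<sigma> t) ^ 4))"
  proof (rule H1_deriv_C1)
    fix t assume t: "t \<in> {a..b}"
    show "(\<Phi> has_vector_derivative - \<epsilon> / (A\<^sup>2 * (\<sigma> t) ^ 4)) (at t within {a..b})"
      unfolding has_real_derivative_iff_has_vector_derivative[symmetric] \<Phi>_def
      using spos[OF t] A by (auto intro!: derivative_eq_intros dsig[OF t] simp: field_simps power4_eq_xxxx power2_eq_square)
    next
    have "continuous_on {a..b} \<sigma>"
      using DERIV_continuous_on[OF dsig] by blast
    then show "continuous_on {a..b} (\<lambda>t. - \<epsilon> / (A\<^sup>2 * (\<sigma> t) ^ 4))"
      using spos A by (intro continuous_intros) (auto simp: less_le)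
  qed
  \<comment> \<open>\<open>g\<close> vanishes at the collision and \<Phi> at the other end, so the
    integration by parts has no boundary terms.\<close>
  have "g c = 0" by (simp add: g_def)
  moreover have "\<Phi> d = 0" by (simp add: \<Phi>_def ende)
  ultimately have z: "g b * \<Phi> b - g a * \<Phi> a = 0" using dir by auto
  have "((\<lambda>t. \<epsilon> * norm (v t) * \<Phi> t + g t * (- \<epsilon> / (A\<^sup>2 * (\<sigma> t) ^ 4))) has_integral 0) {a..b}"
    using H1_deriv_inner[OF hg hPhi ab] z by simp
  from has_integral_mult_right[OF this, of \<epsilon>]
  have i1: "((\<lambda>t. norm (v t) * \<Phi> t - g t / (A\<^sup>2 * (\<sigma> t) ^ 4)) has_integral 0) {a..b}"
    using dir by (elim disjE conjE) (simp_all add: algebra_simps)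
  have "((\<lambda>t. \<epsilon> * (2 / (A * (\<sigma> t)\<^sup>2) - A ^ 3 / 6 * (\<Phi> t)\<^sup>2)) has_integral (\<Psi> (\<sigma> b) - \<Psi> (\<sigma> a))) {a..b}"
  proof (rule fundamental_theorem_of_calculus[OF ab])
    fix t assume t: "t \<in> {a..b}"
    have "((\<lambda>t. \<Psi> (\<sigma> t)) has_real_derivative
        (6 / A - 3 / (2 * A) * (3 - 6 * \<sigma> t / B + 3 * (\<sigma> t)\<^sup>2 / B\<^sup>2)) * (\<epsilon> / (3 * (\<sigma> t)\<^sup>2))) (at t within {a..b})"
      unfolding \<Psi>_def using A Bpos by (auto intro!: derivative_eq_intros dsig[OF t] simp: field_simps)
    moreover have "(6 / A - 3 / (2 * A) * (3 - 6 * \<sigma> t / B + 3 * (\<sigma> t)\<^sup>2 / B\<^sup>2)) * (\<epsilon> / (3 * (\<sigma> t)\<^sup>2))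
       = \<epsilon> * (2 / (A * (\<sigma> t)\<^sup>2) - A ^ 3 / 6 * (\<Phi> t)\<^sup>2)"
      unfolding \<Phi>_def using spos[OF t] A Bpos by (simp add: field_simps power2_eq_square power3_eq_cube)
    ultimately show "((\<lambda>t. \<Psi> (\<sigma> t)) has_vector_derivative \<epsilon> * (2 / (A * (\<sigma> t)\<^sup>2) - A ^ 3 / 6 * (\<Phi> t)\<^sup>2)) (at t within {a..b})"
      by (simp add: has_real_derivative_iff_has_vector_derivative)
  qed
  from has_integral_mult_right[OF this, of \<epsilon>]
  have i2: "((\<lambda>t. 2 / (A * (\<sigma> t)\<^sup>2) - A ^ 3 / 6 * (\<Phi> t)\<^sup>2) has_integral (\<Psi> B - \<Psi> e)) {a..b}"
    using dir ende by auto
  have "9 / (2 * A) * (B - e) \<le> \<Psi> B - \<Psi> e"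
  proof -
    have "\<Psi> B - \<Psi> e - 9 / (2 * A) * (B - e) = 3 / (2 * A) * ((B - e) - (B - e) ^ 3 / B\<^sup>2)"
      unfolding \<Psi>_def using A Bpos by (simp add: field_simps power2_eq_square power3_eq_cube)
    moreover have "(B - e) ^ 3 / B\<^sup>2 \<le> B - e"
    proof -
      have "(B - e) ^ 3 = (B - e) * (B - e)\<^sup>2" by (simp add: power2_eq_square power3_eq_cube)
      also have "\<dots> \<le> (B - e) * B\<^sup>2" using eB e by (intro mult_left_mono power_mono) auto
      finally show ?thesis using Bpos by (simp add: field_simps)
    qed
    moreover have "0 \<le> 3 / (2 * A)" using A by simp
    ultimately have "0 \<le> \<Psi> B - \<Psi> e - 9 / (2 * A) * (B - e)" by simp
    then show ?thesis by simp
  qed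
  also have "\<Psi> B - \<Psi> e = integral {a..b} (\<lambda>t. 2 / (A * (\<sigma> t)\<^sup>2) - A ^ 3 / 6 * (\<Phi> t)\<^sup>2
      + (norm (v t) * \<Phi> t - g t / (A\<^sup>2 * (\<sigma> t) ^ 4)))"
    using integral_unique[OF has_integral_add[OF i2 i1]] by simp
  also have "\<dots> \<le> integral {a..b} (\<lambda>t. 3 / (2 * A ^ 3) * (norm (v t))\<^sup>2 + U t)"
  proof (rule integral_mono_negligible[OF _ _ U(2)])
    show "(\<lambda>t. 2 / (A * (\<sigma> t)\<^sup>2) - A ^ 3 / 6 * (\<Phi> t)\<^sup>2
      + (norm (v t) * \<Phi> t - g t / (A\<^sup>2 * (\<sigma> t) ^ 4))) integrable_on {a..b}"
      using has_integral_add[OF i2 i1] by blast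
    show "(\<lambda>t. 3 / (2 * A ^ 3) * (norm (v t))\<^sup>2 + U t) integrable_on {a..b}"
      by (intro integrable_add integrable_on_mult_right H1_derivD[OF h] U)
    fix t assume t: "t \<in> {a..b}" "t \<notin> N"
    have w0: "0 < norm (w t)" using U(3)[of t] t by simp
    define \<rho> where "\<rho> = A * (\<sigma> t)\<^sup>2"
    have rho: "0 < \<rho>" using A spos[OF t(1)] by (simp add: \<rho>_def)
    \<comment> \<open>The tangent of 1/r at r = \<rho>.\<close>
    have "0 \<le> (norm (w t) - \<rho>)\<^sup>2 / (\<rho>\<^sup>2 * norm (w t))" using w0 by simp
    also have "\<dots> = 1 / norm (w t) - (2 / \<rho> - norm (w t) / \<rho>\<^sup>2)"
      using w0 rho by (simp add: field_simps power2_eq_square)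
    finally have "2 / \<rho> - norm (w t) / \<rho>\<^sup>2 \<le> U t" using U(3)[of t] t by auto
    moreover have "norm (w t) / \<rho>\<^sup>2 \<le> g t / \<rho>\<^sup>2" by (intro divide_right_mono wg[OF t(1)]) simp
    moreover have "\<rho>\<^sup>2 = A\<^sup>2 * (\<sigma> t) ^ 4" by (simp add: \<rho>_def power_mult_distrib flip: power_mult)
    ultimately have 1: "2 / (A * (\<sigma> t)\<^sup>2) - g t / (A\<^sup>2 * (\<sigma> t) ^ 4) \<le> U t" by (simp add: \<rho>_def)
    \<comment> \<open>Completing the square with m/2 = 3/(2 A^3).\<close>
    have "0 \<le> 3 / (2 * A ^ 3) * (norm (v t) - A ^ 3 / 3 * \<Phi> t)\<^sup>2" using A by simp
    also have "\<dots> = 3 / (2 * A ^ 3) * (norm (v t))\<^sup>2 + A ^ 3 / 6 * (\<Phi> t)\<^sup>2 - norm (v t) * \<Phi> t"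
      using A by (simp add: field_simps power2_eq_square)
    finally show "2 / (A * (\<sigma> t)\<^sup>2) - A ^ 3 / 6 * (\<Phi> t)\<^sup>2 + (norm (v t) * \<Phi> t - g t / (A\<^sup>2 * (\<sigma> t) ^ 4))
      \<le> 3 / (2 * A ^ 3) * (norm (v t))\<^sup>2 + U t" using 1 by simp
  qed
  finally show ?thesis .
qed

text \<open>The half bound is applied on both sides of \<open>s\<close>, and e tends to 0. A
  collision at an end point is cheapest: the two sides contribute the cube roots of 1 - s and s,
  whose sum is at least 1.\<close>

lemma collision_bound:
  fixes w v :: "real \<Rightarrow> 'a::euclidean_space" and U :: "real \<Rightarrow> real"
  assumes h: "H1_deriv 0 1 w v" and s: "s \<in> {0..1}" "w s = 0"
    and U: "U integrable_on {0..1}" "negligible N"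
      "\<And>t. t \<in> {0..1} - N \<Longrightarrow> w t \<noteq> 0 \<and> 1 / norm (w t) \<le> U t"
    and A: "0 < A"
  shows "9 / (2 * A) \<le> integral {0..1} (\<lambda>t. 3 / (2 * A ^ 3) * (norm (v t))\<^sup>2 + U t)"
    (is "_ \<le> integral _ ?f")
proof -
  have fi: "?f integrable_on {0..1}"
    by (intro integrable_add integrable_on_mult_right H1_derivD[OF h] U)
  have *: "9 / (2 * A) * (1 - 2 * e) \<le> integral {0..1} ?f" if e: "0 < e" for e
  proof -
    define B1 where "B1 = (1 - s + e ^ 3) powr (1/3)"
    define B2 where "B2 = (s - 0 + e ^ 3) powr (1/3)"
    have "9 / (2 * A) * (B1 - e) \<le> integral {s..1} ?f"
    proof (rule collision_half_bound[where \<epsilon>=1 and c=s and d=1 and w=w])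
      show "H1_deriv s 1 w v" using s by (intro H1_deriv_subinterval[OF h]) auto
      show "U integrable_on {s..1}" using s by (intro integrable_on_subinterval[OF U(1)]) auto
    qed (use s U A e B1_def in auto)
    moreover have "9 / (2 * A) * (B2 - e) \<le> integral {0..s} ?f"
    proof (rule collision_half_bound[where \<epsilon>="-1" and c=s and d=0 and w=w])
      show "H1_deriv 0 s w v" using s by (intro H1_deriv_subinterval[OF h]) auto
      show "U integrable_on {0..s}" using s by (intro integrable_on_subinterval[OF U(1)]) auto
    qed (use s U A e B2_def in auto)
    moreover have "integral {0..s} ?f + integral {s..1} ?f = integral {0..1} ?f"
      using s fi by (intro Henstock_Kurzweil_Integration.integral_combine) auto
    ultimately have "9 / (2 * A) * (B1 - e) + 9 / (2 * A) * (B2 - e) \<le> integral {0..1} ?f" by linarith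
    \<comment> \<open>If the sum were below 1, neither number would be less than its cube, but the
      cubes add up to 1 + 2 e^3.\<close>
    moreover have "1 \<le> B1 + B2"
    proof (rule ccontr)
      have e3: "0 < e ^ 3" using e by simp
      have cb: "(x powr (1/3)) ^ 3 = x" if "0 < x" for x :: real
        using that by (simp add: powr_powr flip: powr_realpow)
      have "0 < 1 - s + x" "0 < s + x" if "0 < x" for x using s that by auto
      note * = this[OF e3]
      have p: "0 < B1" "0 < B2" using * unfolding B1_def B2_def by simp_all
      have c: "B1 ^ 3 = 1 - s + e ^ 3" "B2 ^ 3 = s + e ^ 3"
        using cb[OF *(1)] cb[OF *(2)] unfolding B1_def B2_def by auto
      assume "\<not> 1 \<le> B1 + B2"
      then have "B1 \<le> 1" "B2 \<le> 1" "B1 + B2 < 1" using p by auto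
      moreover have "B1 ^ 3 \<le> B1 ^ 1" "B2 ^ 3 \<le> B2 ^ 1"
        using p \<open>B1 \<le> 1\<close> \<open>B2 \<le> 1\<close> by (intro power_decreasing; simp)+
      ultimately show False using c e3 by simp
    qed
    then have "9 / (2 * A) * (1 - 2 * e) \<le> 9 / (2 * A) * (B1 + B2 - 2 * e)"
      using A by (intro mult_left_mono) auto
    moreover have "9 / (2 * A) * (B1 + B2 - 2 * e) = 9 / (2 * A) * (B1 - e) + 9 / (2 * A) * (B2 - e)"
      unfolding distrib_left[symmetric] by simp
    ultimately show ?thesis by linarith
  qed
  show ?thesis
  proof (rule field_le_epsilon)
    fix \<delta> :: real assume "0 < \<delta>"
    then have "9 / (2 * A) * (1 - 2 * (\<delta> * A / 9)) \<le> integral {0..1} ?f"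
      using A by (intro *) simp
    moreover have "9 / (2 * A) * (1 - 2 * (\<delta> * A / 9)) = 9 / (2 * A) - \<delta>"
      using A by (simp add: field_simps)
    ultimately show "9 / (2 * A) \<le> integral {0..1} ?f + \<delta>" by linarith
  qed
qed

section \<open>The action as a real integral\<close>

lemma less_4: "(4::4) < 1" "(1::4) < 2" "(2::4) < 3"
  by (simp_all add: less_bit0_def bit0.Rep_numeral bit0.Rep_1 bit0.Rep_0)

lemma distinct_4: "(1::4) \<noteq> 2" "(1::4) \<noteq> 3" "(1::4) \<noteq> 4" "(2::4) \<noteq> 3" "(2::4) \<noteq> 4" "(3::4) \<noteq> 4"
proof -
  show "(1::4) \<noteq> 2" "(1::4) \<noteq> 3" "(1::4) \<noteq> 4" "(2::4) \<noteq> 3" "(2::4) \<noteq> 4" "(3::4) \<noteq> 4"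
    using less_4 by simp_all
qed

lemma pairs_4: "{(i::4, j). i < j} = {(4, 1), (4, 2), (4, 3), (1, 2), (1, 3), (2, 3)}"
proof -
  have "(i, j) \<in> {(i::4, j). i < j} \<longleftrightarrow> (i, j) \<in> {(4, 1), (4, 2), (4, 3), (1, 2), (1, 3), (2, 3)}" for i j
    using exhaust_4[of i] exhaust_4[of j] less_4 distinct_4 less_trans[OF less_4(1,2)] less_trans[OF less_4(2,3)]
      less_trans[OF less_trans[OF less_4(1,2)] less_4(3)]
    by (elim disjE) (simp_all add: less_not_sym)
  then show ?thesis by blast
qed

lemma vector_4:
  "(vector [a, b, c, d] :: 'a::zero ^ 4) $ 1 = a"
  "(vector [a, b, c, d] :: 'a ^ 4) $ 2 = b"
  "(vector [a, b, c, d] :: 'a ^ 4) $ 3 = c"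
  "(vector [a, b, c, d] :: 'a ^ 4) $ 4 = d"
proof -
  show
  "(vector [a, b, c, d] :: 'a::zero ^ 4) $ 1 = a"
  "(vector [a, b, c, d] :: 'a ^ 4) $ 2 = b"
  "(vector [a, b, c, d] :: 'a ^ 4) $ 3 = c"
  "(vector [a, b, c, d] :: 'a ^ 4) $ 4 = d"
  using distinct_4 by (auto simp: vector_def)
qed

text \<open>The real counterpart of \<open>potential\<close>. Here 1/0 = 0, so a collision makes
  \<open>pot\<close> too small; it stands for the potential only where collisions are excluded or
  form a null set.\<close>

definition pot :: "config \<Rightarrow> real" where
  "pot q = 1 / norm (q $ 1 - q $ 2) + 1 / norm (q $ 1 - q $ 3) + 1 / norm (q $ 1 - q $ 4)
         + 1 / norm (q $ 2 - q $ 3) + 1 / norm (q $ 2 - q $ 4) + 1 / norm (q $ 3 - q $ 4)"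

lemma potential_sum:
  "potential q = 1 / ennreal (norm (q $ 1 - q $ 2)) + 1 / ennreal (norm (q $ 1 - q $ 3)) + 1 / ennreal (norm (q $ 1 - q $ 4))
         + 1 / ennreal (norm (q $ 2 - q $ 3)) + 1 / ennreal (norm (q $ 2 - q $ 4)) + 1 / ennreal (norm (q $ 3 - q $ 4))"
proof -
  define f where "f i j = 1 / ennreal (norm (q $ i - q $ j))" for i j
  have sym: "f i j = f j i" for i j by (simp only: f_def norm_minus_commute)
  have "potential q = f 4 1 + (f 4 2 + (f 4 3 + (f 1 2 + (f 1 3 + f 2 3))))"
    unfolding potential_def f_def[symmetric] pairs_4 using distinct_4 distinct_4[symmetric] by simp
  then show ?thesis unfolding sym[of 4] f_def[symmetric] by (simp only: ac_simps)
qed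

lemma not_has_collision_iff:
  "\<not> has_collision q \<longleftrightarrow> q $ 1 \<noteq> q $ 2 \<and> q $ 1 \<noteq> q $ 3 \<and> q $ 1 \<noteq> q $ 4 \<and> q $ 2 \<noteq> q $ 3 \<and> q $ 2 \<noteq> q $ 4 \<and> q $ 3 \<noteq> q $ 4"
  (is "_ \<longleftrightarrow> ?R")
proof -
  have "q $ i \<noteq> q $ j" if ?R "i \<noteq> j" for i j
    using that exhaust_4[of i] exhaust_4[of j] by (elim disjE) auto
  then show ?thesis unfolding has_collision_def using distinct_4 by blast
qed

lemma inverse_ennreal_pos: "0 < x \<Longrightarrow> 1 / ennreal x = ennreal (1 / x)"
  using divide_ennreal[of 1 x] by simp

lemma potential_eq_pot:
  assumes "\<not> has_collision q"
  shows "potential q = ennreal (pot q)"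
proof -
  have p: "0 < norm (q $ i - q $ j)" if "i \<noteq> j" for i j
    using assms that by (auto simp: has_collision_def)
  show ?thesis
    unfolding potential_sum pot_def p[THEN inverse_ennreal_pos, OF distinct_4(1)] p[THEN inverse_ennreal_pos, OF distinct_4(2)]
      p[THEN inverse_ennreal_pos, OF distinct_4(3)] p[THEN inverse_ennreal_pos, OF distinct_4(4)]
      p[THEN inverse_ennreal_pos, OF distinct_4(5)] p[THEN inverse_ennreal_pos, OF distinct_4(6)]
    by (subst ennreal_plus, simp, simp)+ (rule refl)
qed

lemma potential_collision:
  assumes "has_collision q"
  shows "potential q = \<infinity>"
proof -
  have "1 / ennreal 0 = \<infinity>" by (simp add: divide_ennreal_def)
  then show ?thesis
    using assms not_has_collision_iff[of q] unfolding potential_sum by auto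
qed

abbreviation lagrangian :: "(real \<Rightarrow> config) \<Rightarrow> real \<Rightarrow> real" where
  "lagrangian q t \<equiv> 1/2 * (norm (vector_derivative q (at t)))\<^sup>2 + pot (q t)"

lemma pot_nonneg: "0 \<le> pot q" by (simp add: pot_def)

lemma norm_config_square: "(\<Sum>i\<in>UNIV. (norm (v $ i))\<^sup>2) = (norm (v :: config))\<^sup>2"
proof -
  have "norm v = sqrt (\<Sum>i\<in>UNIV. (norm (v $ i))\<^sup>2)" unfolding norm_vec_def[of v] L2_set_def ..
  then show ?thesis using sum_nonneg[of UNIV "\<lambda>i. (norm (v $ i))\<^sup>2"] by simp
qed

lemma action_eq:
  "action q = (\<integral>\<^sup>+t. (ennreal (1/2 * (norm (vector_derivative q (at t)))\<^sup>2) + potential (q t)) \<partial>lebesgue_on {0..1})"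
  by (simp only: action_def norm_config_square)

lemma negligible_of_AE:
  assumes "AE t in lebesgue_on {a..b::real}. P t"
  shows "negligible {t\<in>{a..b}. \<not> P t}"
proof -
  have "AE t in lebesgue. t \<in> {a..b} \<longrightarrow> P t"
    using assms by (subst (asm) AE_restrict_space_iff) auto
  then obtain N where "{t. \<not> (t \<in> {a..b} \<longrightarrow> P t)} \<subseteq> N" "N \<in> null_sets lebesgue"
    by (auto simp: eventually_ae_filter)
  then show ?thesis
    by (intro negligible_subset[OF iffD2[OF negligible_iff_null_sets]]) blast+
qed

lemma potential_measurable:
  fixes q :: "real \<Rightarrow> config"
  assumes "continuous_on {0..1} q"
  shows "(\<lambda>t. potential (q t)) \<in> borel_measurable (lebesgue_on {0..1})"
proof -
  have "(\<lambda>t. norm (q t $ i - q t $ j)) \<in> borel_measurable (lebesgue_on {0..1})" for i j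
    by (intro continuous_measurable_on continuous_intros continuous_on_component assms)
  then show ?thesis unfolding potential_sum by measurable
qed

text \<open>The potential is infinite at a collision, so finite action confines collisions to a null
  set, off which \<open>pot\<close> agrees with \<open>potential\<close>. A path of finite action
  may still collide, which is why later pointwise bounds exclude a negligible set.\<close>

lemma action_finite_imp:
  assumes h: "H1_deriv 0 1 q (\<lambda>t. vector_derivative q (at t))" and fin: "action q < \<infinity>"
  shows "negligible {t\<in>{0..1}. has_collision (q t)}" "(\<lambda>t. pot (q t)) integrable_on {0..1}"
    "action q = ennreal (integral {0..1} (lagrangian q))"
proof -
  let ?M = "lebesgue_on {0..1::real}"
  let ?v = "\<lambda>t. vector_derivative q (at t)"
  have qc: "continuous_on {0..1} q" by (rule H1_deriv_continuous[OF h])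
  have pm: "(\<lambda>t. potential (q t)) \<in> borel_measurable ?M" by (rule potential_measurable[OF qc])
  have vm: "?v \<in> borel_measurable ?M" by (rule H1_derivD[OF h])
  have tot: "(\<integral>\<^sup>+t. potential (q t) \<partial>?M) \<le> action q"
    unfolding action_eq by (intro nn_integral_mono) simp
  then have "(\<integral>\<^sup>+t. potential (q t) \<partial>?M) \<noteq> \<infinity>" using fin by auto
  from nn_integral_PInf_AE[OF pm this]
  have ae: "AE t in ?M. \<not> has_collision (q t)"
    by eventually_elim (use potential_collision in auto)
  from negligible_of_AE[OF this] show "negligible {t\<in>{0..1}. has_collision (q t)}" by simp
  have nm: "(\<lambda>t. norm (q t $ i - q t $ j)) \<in> borel_measurable ?M" for i j
    by (intro continuous_measurable_on continuous_intros continuous_on_component qc)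
  have pr: "(\<lambda>t. pot (q t)) \<in> borel_measurable ?M"
    unfolding pot_def using nm by measurable
  have eq: "action q = (\<integral>\<^sup>+t. ennreal (1/2 * (norm (?v t))\<^sup>2 + pot (q t)) \<partial>?M)"
    unfolding action_eq
  proof (rule nn_integral_cong_AE, use ae in eventually_elim)
    case (elim t)
    then show ?case by (simp add: potential_eq_pot ennreal_plus[symmetric] pot_nonneg del: ennreal_plus)
  qed
  have int: "integrable ?M (\<lambda>t. 1/2 * (norm (?v t))\<^sup>2 + pot (q t))"
  proof (rule integrableI_nonneg)
    show "(\<lambda>t. 1/2 * (norm (?v t))\<^sup>2 + pot (q t)) \<in> borel_measurable ?M" using vm pr by measurable
    show "AE t in ?M. 0 \<le> 1/2 * (norm (?v t))\<^sup>2 + pot (q t)" by (simp add: pot_nonneg)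
    show "(\<integral>\<^sup>+t. ennreal (1/2 * (norm (?v t))\<^sup>2 + pot (q t)) \<partial>?M) < \<infinity>" using fin eq by simp
  qed
  have hk: "(\<lambda>t. 1/2 * (norm (?v t))\<^sup>2 + pot (q t)) integrable_on {0..1}"
    using int by (subst (asm) integrable_lebesgue_on_iff) (auto simp: absolutely_integrable_on_def)
  from integrable_diff[OF hk integrable_on_mult_right[OF H1_derivD(2)[OF h], of "1/2"]]
  show "(\<lambda>t. pot (q t)) integrable_on {0..1}" by simp
  have "action q = ennreal (integral\<^sup>L ?M (\<lambda>t. 1/2 * (norm (?v t))\<^sup>2 + pot (q t)))"
    unfolding eq by (rule nn_integral_eq_integral[OF int]) (simp add: pot_nonneg)
  also have "integral\<^sup>L ?M (\<lambda>t. 1/2 * (norm (?v t))\<^sup>2 + pot (q t)) = integral {0..1} (\<lambda>t. 1/2 * (norm (?v t))\<^sup>2 + pot (q t))"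
    by (rule lebesgue_integral_eq_integral[OF int]) simp
  finally show "action q = ennreal (integral {0..1} (\<lambda>t. 1/2 * (norm (?v t))\<^sup>2 + pot (q t)))" .
qed

lemma pot_continuous_on:
  fixes q :: "'a::topological_space \<Rightarrow> config"
  assumes q: "continuous_on S q" and nc: "\<And>t. t \<in> S \<Longrightarrow> \<not> has_collision (q t)"
  shows "continuous_on S (\<lambda>t. pot (q t))"
proof -
  have a: "continuous_on S (\<lambda>t. norm (q t $ i - q t $ j))" for i j
    by (intro continuous_on_norm continuous_on_diff continuous_on_component q)
  have b: "\<forall>t\<in>S. norm (q t $ i - q t $ j) \<noteq> 0" if ij: "i \<noteq> j" for i j
    proof
      fix t assume t: "t \<in> S"
      have "q t $ i \<noteq> q t $ j" using nc[OF t] ij unfolding has_collision_def by metis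
      then show "norm (q t $ i - q t $ j) \<noteq> 0" by simp
    qed
  have c: "continuous_on S (\<lambda>t. 1 / norm (q t $ i - q t $ j))" if ij: "i \<noteq> j" for i j
    by (rule continuous_on_divide[OF continuous_on_const a b[OF ij]])
  show ?thesis unfolding pot_def
    by (intro continuous_on_add c distinct_4)
qed

text \<open>The version for competitors: without collisions \<open>pot\<close> is continuous on the
  compact interval, which gives its integrability.\<close>

lemma action_collision_free:
  assumes h: "H1_deriv 0 1 q (\<lambda>t. vector_derivative q (at t))"
    and nc: "\<And>t. t \<in> {0..1} \<Longrightarrow> \<not> has_collision (q t)"
  shows "(\<lambda>t. pot (q t)) integrable_on {0..1}"
    "action q = ennreal (integral {0..1} (lagrangian q))"
proof -
  let ?M = "lebesgue_on {0..1::real}"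
  let ?v = "\<lambda>t. vector_derivative q (at t)"
  have qc: "continuous_on {0..1} q" by (rule H1_deriv_continuous[OF h])
  show pi: "(\<lambda>t. pot (q t)) integrable_on {0..1}"
    by (rule integrable_continuous_real, rule pot_continuous_on[OF qc]) (rule nc)
  have hk: "(\<lambda>t. 1/2 * (norm (?v t))\<^sup>2 + pot (q t)) absolutely_integrable_on {0..1}"
    by (rule nonnegative_absolutely_integrable_1[OF integrable_add[OF integrable_on_mult_right[OF H1_derivD(2)[OF h]] pi]])
      (simp add: pot_nonneg)
  then have int: "integrable ?M (\<lambda>t. 1/2 * (norm (?v t))\<^sup>2 + pot (q t))"
    by (subst integrable_lebesgue_on_iff) auto
  have "action q = (\<integral>\<^sup>+t. ennreal (1/2 * (norm (?v t))\<^sup>2 + pot (q t)) \<partial>?M)"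
    unfolding action_eq
  proof (rule nn_integral_cong)
    fix t assume "t \<in> space ?M"
    then have "\<not> has_collision (q t)" using nc by simp
    then show "ennreal (1/2 * (norm (?v t))\<^sup>2) + potential (q t) = ennreal (1/2 * (norm (?v t))\<^sup>2 + pot (q t))"
      by (simp add: potential_eq_pot ennreal_plus[symmetric] pot_nonneg del: ennreal_plus)
  qed
  also have "\<dots> = ennreal (integral\<^sup>L ?M (\<lambda>t. 1/2 * (norm (?v t))\<^sup>2 + pot (q t)))"
    by (rule nn_integral_eq_integral[OF int]) (simp add: pot_nonneg)
  also have "integral\<^sup>L ?M (\<lambda>t. 1/2 * (norm (?v t))\<^sup>2 + pot (q t)) = integral {0..1} (\<lambda>t. 1/2 * (norm (?v t))\<^sup>2 + pot (q t))"
    by (rule lebesgue_integral_eq_integral[OF int]) simp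
  finally show "action q = ennreal (integral {0..1} (\<lambda>t. 1/2 * (norm (?v t))\<^sup>2 + pot (q t)))" .
qed

section \<open>Quadratic lower bounds for the remaining terms\<close>

lemma H1_deriv_increment_energy:
  fixes u :: "real \<Rightarrow> 'a::euclidean_space"
  assumes h: "H1_deriv 0 1 u v" and "s \<in> {0..1}" "t \<in> {0..1}"
  shows "(norm (u t - u s))\<^sup>2 \<le> \<bar>t - s\<bar> * energy v"
proof -
  have *: "(norm (u y - u x))\<^sup>2 \<le> (y - x) * energy v"
    if "0 \<le> x" "x \<le> y" "y \<le> 1" for x y
  proof -
    have "(norm (u y - u x))\<^sup>2 \<le> (y - x) * integral {x..y} (\<lambda>t. (norm (v t))\<^sup>2)"
      by (rule H1_deriv_increment[OF h]) (use that in auto)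
    also have "\<dots> \<le> (y - x) * energy v"
      using that by (intro mult_left_mono integral_subset_le integrable_on_subinterval[OF H1_derivD(2)[OF h]]
          H1_derivD(2)[OF h]) auto
    finally show ?thesis .
  qed
  show ?thesis
  proof (cases "s \<le> t")
    case True then show ?thesis using *[of s t] assms by simp
  next
    case False then show ?thesis using *[of t s] assms by (simp add: norm_minus_commute)
  qed
qed

lemma energy_nonneg:
  assumes "H1_deriv 0 1 u v"
  shows "0 \<le> energy v"
  by (rule integral_nonneg[OF H1_derivD(2)[OF assms]]) simp

lemma norm_add_square_le: "(norm (x + y))\<^sup>2 \<le> 2 * (norm (x::'a::real_inner))\<^sup>2 + 2 * (norm y)\<^sup>2"
proof -
  have "0 \<le> (norm (x - y))\<^sup>2" by simp
  then show ?thesis by (simp add: power2_norm_eq_inner inner_add inner_diff inner_commute)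
qed

lemma has_integral_affine_01: "((\<lambda>t. a + b * t) has_integral (a + b / 2)) {0..1::real}"
proof -
  have "((\<lambda>t. a + b * t) has_integral ((a * 1 + b * 1\<^sup>2 / 2) - (a * 0 + b * 0\<^sup>2 / 2))) {0..1::real}"
    by (rule fundamental_theorem_of_calculus)
      (auto intro!: derivative_eq_intros simp: has_real_derivative_iff_has_vector_derivative[symmetric])
  then show ?thesis by simp
qed

text \<open>For paths without a known zero. With E the energy of \<open>v\<close> one has |u t - u
  c|^2 \<le> |t - c| E, and |t - c| has integral 1/2; the factor 2 comes from splitting the square
  of a sum.\<close>

lemma integral_square_le_endpoint:
  fixes u :: "real \<Rightarrow> 'a::euclidean_space"
  assumes h: "H1_deriv 0 1 u v" and c: "c = 0 \<or> c = 1"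
  shows "energy u \<le> 2 * (norm (u c))\<^sup>2 + energy v"
proof -
  define E where "E = energy v"
  define a where "a = 2 * (norm (u c))\<^sup>2 + 2 * c * E"
  define b where "b = (if c = 0 then 2 * E else - 2 * E)"
  have "energy u \<le> integral {0..1} (\<lambda>t. a + b * t)"
  proof (rule integral_le)
    show "(\<lambda>t. (norm (u t))\<^sup>2) integrable_on {0..1}"
      by (rule continuous_norm_square_integrable[OF H1_deriv_continuous[OF h]])
    show "(\<lambda>t. a + b * t) integrable_on {0..1}" using has_integral_affine_01 by blast
    fix t :: real assume t: "t \<in> {0..1}"
    have "(norm (u t))\<^sup>2 \<le> 2 * (norm (u c))\<^sup>2 + 2 * (norm (u t - u c))\<^sup>2"
      using norm_add_square_le[of "u c" "u t - u c"] by simp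
    also have "(norm (u t - u c))\<^sup>2 \<le> \<bar>t - c\<bar> * E"
      unfolding E_def by (rule H1_deriv_increment_energy[OF h]) (use c t in auto)
    also have "2 * (norm (u c))\<^sup>2 + 2 * (\<bar>t - c\<bar> * E) = a + b * t"
      using c t by (auto simp: a_def b_def algebra_simps)
    finally show "(norm (u t))\<^sup>2 \<le> a + b * t" by simp
  qed
  also have "\<dots> = a + b / 2" by (rule integral_unique[OF has_integral_affine_01])
  also have "\<dots> = 2 * (norm (u c))\<^sup>2 + E" using c by (auto simp: a_def b_def)
  finally show ?thesis unfolding E_def .
qed

text \<open>Here |u t|^2 \<le> |t - s| E, and the convex function |t - s| lies below its chord s +
  (1 - 2 s) t, whose integral is 1/2 wherever \<open>s\<close> is. The two ends contribute s E and
  (1 - s) E.\<close>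

lemma integral_square_le_zero:
  fixes u :: "real \<Rightarrow> 'a::euclidean_space"
  assumes h: "H1_deriv 0 1 u v" and s: "s \<in> {0..1}" "u s = 0"
  shows "energy u \<le> energy v / 2"
    and "(norm (u 0))\<^sup>2 + (norm (u 1))\<^sup>2 \<le> energy v"
proof -
  define E where "E = energy v"
  have E0: "0 \<le> E" unfolding E_def by (rule energy_nonneg[OF h])
  have ut: "(norm (u t))\<^sup>2 \<le> \<bar>t - s\<bar> * E" if "t \<in> {0..1}" for t
    using H1_deriv_increment_energy[OF h s(1) that] s(2) by (simp add: E_def)
  have "energy u \<le> integral {0..1} (\<lambda>t. s * E + (1 - 2 * s) * E * t)"
  proof (rule integral_le)
    show "(\<lambda>t. (norm (u t))\<^sup>2) integrable_on {0..1}"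
      by (rule continuous_norm_square_integrable[OF H1_deriv_continuous[OF h]])
    show "(\<lambda>t. s * E + (1 - 2 * s) * E * t) integrable_on {0..1}" using has_integral_affine_01 by blast
    fix t :: real assume t: "t \<in> {0..1}"
    have "\<bar>t - s\<bar> \<le> s + (1 - 2 * s) * t"
    proof (cases "s \<le> t")
      case True
      have "0 \<le> 2 * (s * (1 - t))" using s t by simp
      then show ?thesis using True by (simp add: algebra_simps)
    next
      case False
      have "0 \<le> 2 * ((1 - s) * t)" using s t by simp
      then show ?thesis using False by (simp add: algebra_simps)
    qed
    from mult_right_mono[OF this E0] ut[OF t]
    show "(norm (u t))\<^sup>2 \<le> s * E + (1 - 2 * s) * E * t" by (simp add: algebra_simps)
  qed
  also have "\<dots> = s * E + (1 - 2 * s) * E / 2" by (rule integral_unique[OF has_integral_affine_01])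
  also have "\<dots> = E / 2" by (simp add: field_simps)
  finally show "energy u \<le> energy v / 2"
    unfolding E_def .
  have "(norm (u 0))\<^sup>2 + (norm (u 1))\<^sup>2 \<le> s * E + (1 - s) * E"
    using ut[of 0] ut[of 1] s by simp
  then show "(norm (u 0))\<^sup>2 + (norm (u 1))\<^sup>2 \<le> energy v"
    by (simp add: E_def algebra_simps)
qed

section \<open>A Poincare inequality in a rotating frame\<close>

lemma H1_deriv_scaled_C1:
  fixes u v :: "real \<Rightarrow> real"
  assumes h: "H1_deriv a b u v"
    and c: "\<And>t. (c has_real_derivative c' t) (at t)" and c': "continuous_on UNIV c'"
  shows "H1_deriv a b (\<lambda>t. c t * u t) (\<lambda>t. c' t * u t + c t * v t)"
proof -
  have hc: "H1_deriv s t c c'" for s t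
    by (rule H1_deriv_C1) (auto intro: DERIV_subset[OF c] continuous_on_subset[OF c']
       simp: has_real_derivative_iff_has_vector_derivative[symmetric])
  have cc: "continuous_on {a..b} c" by (rule H1_deriv_continuous[OF hc])
  have uc: "continuous_on {a..b} u" by (rule H1_deriv_continuous[OF h])
  have cu: "continuous_on {a..b} (\<lambda>t. c' t * u t)"
    by (intro continuous_intros uc continuous_on_subset[OF c']) auto
  have m: "(\<lambda>t. c t * v t) \<in> borel_measurable (lebesgue_on {a..b})"
    using H1_derivD(1)[OF h] continuous_measurable_on[OF cc] by measurable
  have m2: "(\<lambda>t. c' t * u t) \<in> borel_measurable (lebesgue_on {a..b})"
    by (rule continuous_measurable_on[OF cu])
  obtain K where "\<forall>x\<in>c ` {a..b}. norm x \<le> K"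
    using compact_imp_bounded[OF compact_continuous_image[OF cc compact_Icc]] unfolding bounded_iff by blast
  then have K: "\<bar>c t\<bar> \<le> K" if "t \<in> {a..b}" for t using that by simp
  have i1: "(\<lambda>t. (c t * v t)\<^sup>2) integrable_on {a..b}"
  proof -
    have "(\<lambda>t. (c t * v t)\<^sup>2) absolutely_integrable_on {a..b}"
    proof (rule measurable_bounded_by_integrable_imp_absolutely_integrable)
      show "(\<lambda>t. (c t * v t)\<^sup>2) \<in> borel_measurable (lebesgue_on {a..b})" using m by measurable
      show "(\<lambda>t. K\<^sup>2 * (norm (v t))\<^sup>2) integrable_on {a..b}"
        by (intro integrable_on_mult_right H1_derivD[OF h])
      fix t assume "t \<in> {a..b}"
      then have "(c t)\<^sup>2 \<le> K\<^sup>2" using K[of t] abs_le_square_iff[of "c t" K] by auto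
      then show "norm ((c t * v t)\<^sup>2) \<le> K\<^sup>2 * (norm (v t))\<^sup>2"
        by (simp add: power_mult_distrib mult_right_mono)
    qed simp
    then show ?thesis by (simp add: absolutely_integrable_on_def)
  qed
  show ?thesis unfolding H1_deriv_def
  proof (intro conjI ballI)
    show "(\<lambda>t. c' t * u t + c t * v t) \<in> borel_measurable (lebesgue_on {a..b})"
      using m m2 by measurable
    have "(\<lambda>t. (c' t * u t)\<^sup>2 + 2 * ((c' t * u t) \<bullet> (c t * v t)) + (c t * v t)\<^sup>2) integrable_on {a..b}"
      using continuous_norm_square_integrable[OF cu]
      by (intro integrable_add integrable_on_mult_right i1 set_lebesgue_integral_eq_integral(1)[OF inner_L2_abs_integrable]
         m m2) (use i1 in auto)
    then show "(\<lambda>t. (norm (c' t * u t + c t * v t))\<^sup>2) integrable_on {a..b}"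
      by (simp add: power2_sum ac_simps)
    fix t assume t: "t \<in> {a..b}"
    have "((\<lambda>t. c' t \<bullet> u t + c t \<bullet> v t) has_integral (c t \<bullet> u t - c a \<bullet> u a)) {a..t}"
      using t by (intro H1_deriv_inner hc H1_deriv_subinterval[OF h]) auto
    then show "((\<lambda>t. c' t * u t + c t * v t) has_integral (c t * u t - c a * u a)) {a..t}" by simp
  qed
qed

lemma norm_2_square: "(norm (x :: real^2))\<^sup>2 = (x $ 1)\<^sup>2 + (x $ 2)\<^sup>2"
  unfolding power2_norm_eq_inner inner_vec_def sum_2 by (simp add: power2_eq_square)

text \<open>The path starts on the horizontal axis and ends on the line at angle \<theta>. In the
  frame turning at rate \<theta>, with \<open>a\<close> along the moving line and \<open>b\<close>
  across it, \<open>b\<close> vanishes at both ends. The squared speed is \<theta>^2 |y|^2 + b'^2 -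
  4 \<theta>^2 b^2, plus the square of a' - 2 \<theta> b, plus the derivative of 2 \<theta> a b,
  which integrates to 0. Equality holds for uniform circular motion with b = 0.\<close>

lemma rotation_poincare:
  fixes y v :: "real \<Rightarrow> real^2"
  assumes h: "H1_deriv 0 1 y v" and th: "0 \<le> \<theta>" "\<theta> \<le> 1/2"
    and y0: "y 0 $ 2 = 0" and y1: "y 1 $ 2 * cos \<theta> = y 1 $ 1 * sin \<theta>"
  shows "\<theta>\<^sup>2 * energy y \<le> energy v"
proof -
  have hi: "H1_deriv 0 1 (\<lambda>t. y t $ i) (\<lambda>t. v t $ i)" for i
    by (rule H1_deriv_linear[OF h bounded_linear_vec_nth])
  define a where "a t = cos (\<theta> * t) * y t $ 1 + sin (\<theta> * t) * y t $ 2" for t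
  define b where "b t = - sin (\<theta> * t) * y t $ 1 + cos (\<theta> * t) * y t $ 2" for t
  define a' where "a' t = \<theta> * b t + (cos (\<theta> * t) * v t $ 1 + sin (\<theta> * t) * v t $ 2)" for t
  define b' where "b' t = - \<theta> * a t + (- sin (\<theta> * t) * v t $ 1 + cos (\<theta> * t) * v t $ 2)" for t
  have ha: "H1_deriv 0 1 a a'"
  proof -
    have "H1_deriv 0 1 (\<lambda>t. cos (\<theta> * t) * y t $ 1 + sin (\<theta> * t) * y t $ 2)
       (\<lambda>t. ((- \<theta> * sin (\<theta> * t)) * y t $ 1 + cos (\<theta> * t) * v t $ 1) + ((\<theta> * cos (\<theta> * t)) * y t $ 2 + sin (\<theta> * t) * v t $ 2))"
      by (intro H1_deriv_add H1_deriv_scaled_C1 hi) (auto intro!: derivative_eq_intros continuous_intros)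
    then show ?thesis unfolding a_def a'_def b_def by (simp add: algebra_simps)
  qed
  have hb: "H1_deriv 0 1 b b'"
  proof -
    have "H1_deriv 0 1 (\<lambda>t. (- sin (\<theta> * t)) * y t $ 1 + cos (\<theta> * t) * y t $ 2)
       (\<lambda>t. ((- \<theta> * cos (\<theta> * t)) * y t $ 1 + (- sin (\<theta> * t)) * v t $ 1) + ((- \<theta> * sin (\<theta> * t)) * y t $ 2 + cos (\<theta> * t) * v t $ 2))"
      by (intro H1_deriv_add H1_deriv_scaled_C1 hi) (auto intro!: derivative_eq_intros continuous_intros)
    then show ?thesis unfolding a_def b'_def b_def by (simp add: algebra_simps)
  qed
  have sc: "(sin x)\<^sup>2 + (cos x)\<^sup>2 = 1" for x :: real by simp
  have n1: "(norm (y t))\<^sup>2 = (a t)\<^sup>2 + (b t)\<^sup>2" for t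
    unfolding norm_2_square a_def b_def using sc[of "\<theta> * t"] by algebra
  have n2: "(norm (v t))\<^sup>2 = (a' t - \<theta> * b t)\<^sup>2 + (b' t + \<theta> * a t)\<^sup>2" for t
    unfolding norm_2_square a'_def b'_def using sc[of "\<theta> * t"] by algebra
  have b0: "b 0 = 0" "b 1 = 0" using y0 y1 by (auto simp: b_def mult.commute)
  have ab: "((\<lambda>t. a' t * b t + a t * b' t) has_integral 0) {0..1}"
    using H1_deriv_inner[OF ha hb] b0 by simp
  have bb: "integral {0..1} (\<lambda>t. (b t)\<^sup>2) \<le> integral {0..1} (\<lambda>t. (b' t)\<^sup>2) / 2"
    using integral_square_le_zero(1)[OF hb, of 0] b0 by simp
  have bi: "(\<lambda>t. (b t)\<^sup>2) integrable_on {0..1}"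
    using continuous_norm_square_integrable[OF H1_deriv_continuous[OF hb]] by simp
  have b'i: "(\<lambda>t. (b' t)\<^sup>2) integrable_on {0..1}" using H1_derivD(2)[OF hb] by simp
  have yi: "(\<lambda>t. (norm (y t))\<^sup>2) integrable_on {0..1}"
    by (rule continuous_norm_square_integrable[OF H1_deriv_continuous[OF h]])
  \<comment> \<open>The zeros of \<open>b\<close> and \<theta> \<le> 1/2 let the integral of b'^2
    pay for that of 4 \<theta>^2 b^2.\<close>
  have "4 * \<theta>\<^sup>2 * integral {0..1} (\<lambda>t. (b t)\<^sup>2) \<le> 4 * \<theta>\<^sup>2 * (integral {0..1} (\<lambda>t. (b' t)\<^sup>2) / 2)"
    by (intro mult_left_mono bb) simp
  also have "\<dots> \<le> 1 * integral {0..1} (\<lambda>t. (b' t)\<^sup>2)"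
  proof -
    have "\<theta>\<^sup>2 \<le> (1/2)\<^sup>2" using th by (intro power_mono) auto
    then have "2 * \<theta>\<^sup>2 \<le> 1" by (simp add: power2_eq_square)
    from mult_right_mono[OF this integral_nonneg[OF b'i]] show ?thesis by simp
  qed
  finally have key: "0 \<le> integral {0..1} (\<lambda>t. (b' t)\<^sup>2) - 4 * \<theta>\<^sup>2 * integral {0..1} (\<lambda>t. (b t)\<^sup>2)" by simp
  have i1: "((\<lambda>t. (b' t)\<^sup>2 - 4 * \<theta>\<^sup>2 * (b t)\<^sup>2 + \<theta>\<^sup>2 * (norm (y t))\<^sup>2 - 2 * \<theta> * - (a' t * b t + a t * b' t)) has_integral
     (integral {0..1} (\<lambda>t. (b' t)\<^sup>2) - 4 * \<theta>\<^sup>2 * integral {0..1} (\<lambda>t. (b t)\<^sup>2) + \<theta>\<^sup>2 * energy y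
      - 2 * \<theta> * - 0)) {0..1}"
    by (intro has_integral_diff has_integral_add has_integral_mult_right has_integral_neg ab
        integrable_integral bi b'i yi)
  have "integral {0..1} (\<lambda>t. (b' t)\<^sup>2 - 4 * \<theta>\<^sup>2 * (b t)\<^sup>2 + \<theta>\<^sup>2 * (norm (y t))\<^sup>2 - 2 * \<theta> * - (a' t * b t + a t * b' t))
     \<le> energy v"
  proof (rule integral_le[OF has_integral_integrable[OF i1] H1_derivD(2)[OF h]])
    fix t
    have "(norm (v t))\<^sup>2 - ((b' t)\<^sup>2 - 4 * \<theta>\<^sup>2 * (b t)\<^sup>2 + \<theta>\<^sup>2 * (norm (y t))\<^sup>2 - 2 * \<theta> * - (a' t * b t + a t * b' t))
      = (a' t - 2 * \<theta> * b t)\<^sup>2"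
      unfolding n1 n2 by algebra
    then show "(b' t)\<^sup>2 - 4 * \<theta>\<^sup>2 * (b t)\<^sup>2 + \<theta>\<^sup>2 * (norm (y t))\<^sup>2 - 2 * \<theta> * - (a' t * b t + a t * b' t) \<le> (norm (v t))\<^sup>2"
      using zero_le_power2[of "a' t - 2 * \<theta> * b t"] by linarith
  qed
  then show ?thesis using key unfolding integral_unique[OF i1] by simp
qed


text \<open>The pair \<open>w\<close> collides, \<open>w'\<close> is the complementary pair and \<open>y\<close> joins the two centres of mass.
  The four cross distances enter through \<open>1/r \<ge> 3/(2\<rho>) - r\<^sup>2/(2\<rho>\<^sup>3)\<close>.\<close>

lemma pairing_action_bound:
  fixes w w' y vw vw' vy :: "real \<Rightarrow> real^2" and K P :: "real \<Rightarrow> real"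
  assumes hw: "H1_deriv 0 1 w vw" and hw': "H1_deriv 0 1 w' vw'" and hy: "H1_deriv 0 1 y vy"
    and s: "s \<in> {0..1}" "w s = 0"
    and N: "negligible N"
    and K: "K integrable_on {0..1}"
      "\<And>t. (norm (vw t))\<^sup>2 / 4 + (norm (vw' t))\<^sup>2 / 4 + (norm (vy t))\<^sup>2 / 2 \<le> K t"
    and P: "P integrable_on {0..1}"
      "\<And>t. t \<in> {0..1} - N \<Longrightarrow> w t \<noteq> 0 \<and>
        1 / norm (w t) + (6 / \<rho> - (4 * (norm (y t))\<^sup>2 + (norm (w t))\<^sup>2 + (norm (w' t))\<^sup>2) / (2 * \<rho> ^ 3)) \<le> P t"
    and A: "0 < A"
    and C: "2 / \<rho> ^ 3 * energy y
        + 1 / (2 * \<rho> ^ 3) * energy w'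
        + 1 / (2 * \<rho> ^ 3) * energy w
      \<le> energy vy / 2 + energy vw' / 4
        + (1/4 - 3 / (2 * A ^ 3)) * energy vw"
  shows "6 / \<rho> + 9 / (2 * A) \<le> integral {0..1} (\<lambda>t. K t + P t)"
proof -
  \<comment> \<open>What \<open>P\<close> leaves for the Kepler problem of \<open>w\<close> once the
    quadratic bound for the cross potentials is subtracted.\<close>
  define U where "U t = P t - (6 / \<rho> - (4 * (norm (y t))\<^sup>2 + (norm (w t))\<^sup>2 + (norm (w' t))\<^sup>2) / (2 * \<rho> ^ 3))" for t
  note sq = integrable_integral[OF continuous_norm_square_integrable[OF H1_deriv_continuous]]
  note sv = integrable_integral[OF H1_derivD(2)]
  have i1: "((\<lambda>t. 6 / \<rho> - (2 / \<rho> ^ 3 * (norm (y t))\<^sup>2 + 1 / (2 * \<rho> ^ 3) * (norm (w' t))\<^sup>2 + 1 / (2 * \<rho> ^ 3) * (norm (w t))\<^sup>2))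
    has_integral (6 / \<rho> - (2 / \<rho> ^ 3 * energy y
        + 1 / (2 * \<rho> ^ 3) * energy w'
        + 1 / (2 * \<rho> ^ 3) * energy w))) {0..1}"
    using has_integral_const_real[of "6 / \<rho>" 0 1]
    by (intro has_integral_diff has_integral_add has_integral_mult_right sq[OF hw] sq[OF hw'] sq[OF hy]) simp
  have eq: "6 / \<rho> - (2 / \<rho> ^ 3 * (norm (y t))\<^sup>2 + 1 / (2 * \<rho> ^ 3) * (norm (w' t))\<^sup>2 + 1 / (2 * \<rho> ^ 3) * (norm (w t))\<^sup>2)
     = 6 / \<rho> - (4 * (norm (y t))\<^sup>2 + (norm (w t))\<^sup>2 + (norm (w' t))\<^sup>2) / (2 * \<rho> ^ 3)" for t
    by (simp add: add_divide_distrib)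
  have Ui: "U integrable_on {0..1}"
    unfolding U_def eq[symmetric] by (intro integrable_diff P has_integral_integrable[OF i1])
  have Ui': "(\<lambda>t. 3 / (2 * A ^ 3) * (norm (vw t))\<^sup>2 + U t) integrable_on {0..1}"
    by (intro integrable_add integrable_on_mult_right H1_derivD[OF hw] Ui)
  have "9 / (2 * A) \<le> integral {0..1} (\<lambda>t. 3 / (2 * A ^ 3) * (norm (vw t))\<^sup>2 + U t)"
  proof (rule collision_bound[OF hw s Ui N _ A])
    show "w t \<noteq> 0 \<and> 1 / norm (w t) \<le> U t" if "t \<in> {0..1} - N" for t
      using P(2)[OF that] unfolding U_def by linarith
  qed
  moreover have "integral {0..1} (\<lambda>t. 3 / (2 * A ^ 3) * (norm (vw t))\<^sup>2 + U t)
     + (6 / \<rho> - (2 / \<rho> ^ 3 * energy y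
        + 1 / (2 * \<rho> ^ 3) * energy w'
        + 1 / (2 * \<rho> ^ 3) * energy w))
     + (energy vy / 2 + energy vw' / 4
        + (1/4 - 3 / (2 * A ^ 3)) * energy vw)
     \<le> integral {0..1} (\<lambda>t. K t + P t)" (is "?L \<le> _")
  proof -
    \<comment> \<open>Of the kinetic coefficient 1/4 of \<open>w\<close>, the part 3/(2 A^3) stays
      with the Kepler problem; the rest, with the energies of \<open>w'\<close> and
      \<open>y\<close>, dominates the quadratic terms by \<open>C\<close>.\<close>
    let ?f = "\<lambda>t. (3 / (2 * A ^ 3) * (norm (vw t))\<^sup>2 + U t) +
      (6 / \<rho> - (2 / \<rho> ^ 3 * (norm (y t))\<^sup>2 + 1 / (2 * \<rho> ^ 3) * (norm (w' t))\<^sup>2 + 1 / (2 * \<rho> ^ 3) * (norm (w t))\<^sup>2)) +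
      ((norm (vy t))\<^sup>2 / 2 + (norm (vw' t))\<^sup>2 / 4 + (1/4 - 3 / (2 * A ^ 3)) * (norm (vw t))\<^sup>2)"
    have f: "(?f has_integral ?L) {0..1}"
      by (intro has_integral_add i1 integrable_integral[OF Ui'] has_integral_divide has_integral_mult_right
          sv[OF hy] sv[OF hw] sv[OF hw'])
    have "integral {0..1} ?f \<le> integral {0..1} (\<lambda>t. K t + P t)"
    proof (rule integral_le)
      show "?f integrable_on {0..1}" using f by blast
      show "(\<lambda>t. K t + P t) integrable_on {0..1}" by (intro integrable_add K P)
      fix t :: real
      have "?f t = ((norm (vw t))\<^sup>2 / 4 + (norm (vw' t))\<^sup>2 / 4 + (norm (vy t))\<^sup>2 / 2) + P t"
        unfolding eq U_def by (simp add: algebra_simps)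
      then show "?f t \<le> K t + P t" using K(2)[of t] by simp
    qed
    then show ?thesis using integral_unique[OF f] by simp
  qed
  ultimately show ?thesis using C by linarith
qed

lemma component_square_le: "(x $ i)\<^sup>2 \<le> (norm (x :: real^2))\<^sup>2"
  using power_mono[OF component_le_norm_cart, of x i 2] by simp

text \<open>By the choice of \<rho> the coefficient 2/\<rho>^3 is \<theta>^2/2, and
  \<open>rotation_poincare\<close> pays the term in \<open>y\<close> exactly. The path
  \<open>w'\<close> has no known zero, but at t = 1 it is as long as \<open>w\<close>, which is
  controlled by its zero at \<open>s\<close>. The surplus 1/4 - 3/(2 A^3) for A = 1.85 exceeds (5/2)
  0.0036, where 0.0036 bounds \<theta>^2/8.\<close>

lemma double_binary_quadratic_bound:
  fixes w w' y vw vw' vy :: "real \<Rightarrow> real^2"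
  assumes hw: "H1_deriv 0 1 w vw" and hw': "H1_deriv 0 1 w' vw'" and hy: "H1_deriv 0 1 y vy"
    and s: "s \<in> {0..1}" "w s = 0"
    and th: "0 < \<theta>" "\<theta> \<le> (1694/10000)"
    and \<rho>: "\<rho> ^ 3 = 4 / \<theta>\<^sup>2"
    and y0: "y 0 $ 2 = 0" and y1: "y 1 $ 2 * cos \<theta> = y 1 $ 1 * sin \<theta>"
    and n1: "norm (w' 1) = norm (w 1)"
  shows "2 / \<rho> ^ 3 * energy y
        + 1 / (2 * \<rho> ^ 3) * energy w'
        + 1 / (2 * \<rho> ^ 3) * energy w
      \<le> energy vy / 2 + energy vw' / 4
        + (1/4 - 3 / (2 * (185/100) ^ 3)) * energy vw"
proof -
  define k where "k = \<theta>\<^sup>2 / 8"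
  define Y where "Y = energy vy"
  define V where "V = energy vw'"
  define W where "W = energy vw"
  have k: "2 / \<rho> ^ 3 = \<theta>\<^sup>2 / 2" "1 / (2 * \<rho> ^ 3) = k" using \<rho> th by (simp_all add: k_def)
  have "\<theta>\<^sup>2 \<le> (1694/10000)\<^sup>2" using th by (intro power_mono) auto
  then have k0: "0 \<le> k" "k \<le> (36/10000)" by (auto simp: k_def power2_eq_square)
  have p: "0 \<le> V" "0 \<le> W" unfolding V_def W_def using energy_nonneg hw hw' by blast+
  have 1: "\<theta>\<^sup>2 * energy y \<le> Y"
    unfolding Y_def by (rule rotation_poincare[OF hy _ _ y0 y1]) (use th in auto)
  have 2: "energy w' \<le> 2 * (norm (w 1))\<^sup>2 + V"
    using integral_square_le_endpoint[OF hw', of 1] n1 by (simp add: V_def)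
  have 3: "energy w \<le> W / 2" "(norm (w 1))\<^sup>2 \<le> W"
    using integral_square_le_zero[OF hw s] zero_le_power2[of "norm (w 0)"] unfolding W_def by linarith+
  have "k * energy w' + k * energy w \<le> k * (5/2 * W + V)"
    unfolding distrib_left[symmetric] using 2 3 k0 by (intro mult_left_mono) auto
  also have "\<dots> = k * (5/2 * W) + k * V" by (simp add: distrib_left)
  also have "\<dots> \<le> (36/10000) * (5/2 * W) + (36/10000) * V" using k0 p by (intro add_mono mult_right_mono) auto
  also have "\<dots> \<le> V / 4 + (1/4 - 3 / (2 * (185/100) ^ 3)) * W"
  proof -
    have "(9/1000) \<le> 1/4 - 3 / (2 * (185/100) ^ 3 :: real)" by (simp add: power3_eq_cube)
    from mult_right_mono[OF this p(2)] show ?thesis using p(1) by simp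
  qed
  finally show ?thesis using 1 unfolding k Y_def[symmetric] V_def[symmetric] W_def[symmetric] by simp
qed

text \<open>Unlike for the splitting 12|34, \<open>y\<close> does not start on a fixed line; its
  start is tied to those of \<open>w\<close> and \<open>w'\<close>. While \<open>w\<close> is
  controlled by its zero, the end condition bounds the rest: the first alternative, met by 13|24,
  bounds \<open>w'\<close> through \<open>w\<close>, and the second, met by 14|23, bounds
  \<open>y\<close>. With \<rho> = 4 the coefficients are 1/32 and 1/128, and A = 2.15 frees 0.099 of
  the kinetic coefficient of \<open>w\<close>.\<close>

lemma cross_pair_quadratic_bound:
  fixes w w' y vw vw' vy :: "real \<Rightarrow> real^2"
  assumes hw: "H1_deriv 0 1 w vw" and hw': "H1_deriv 0 1 w' vw'" and hy: "H1_deriv 0 1 y vy"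
    and s: "s \<in> {0..1}" "w s = 0"
    and th: "0 < \<theta>" "\<theta> \<le> (1694/10000)"
    and y02: "(y 0 $ 2)\<^sup>2 = (w 0 $ 2)\<^sup>2"
    and w02: "(w' 0 $ 2)\<^sup>2 = (w 0 $ 2)\<^sup>2"
    and y01: "\<bar>w' 0 $ 1 - w 0 $ 1\<bar> = 2 * \<bar>y 0 $ 1\<bar>"
    and alt: "norm (w' 1) = norm (w 1) \<or> y 1 $ 1 * cos \<theta> + y 1 $ 2 * sin \<theta> = 0"
  shows "2 / 4 ^ 3 * energy y
        + 1 / (2 * 4 ^ 3) * energy w'
        + 1 / (2 * 4 ^ 3) * energy w
      \<le> energy vy / 2 + energy vw' / 4
        + (1/4 - 3 / (2 * (215/100) ^ 3)) * energy vw"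
proof -
  define Y where "Y = energy vy"
  define V where "V = energy vw'"
  define W where "W = energy vw"
  define x1 x2 y1 p where "x1 = w 0 $ 1" and "x2 = w 0 $ 2" and "y1 = y 0 $ 1" and "p = w' 0 $ 1"
  have pos: "0 \<le> V" "0 \<le> W" "0 \<le> Y" unfolding V_def W_def Y_def using energy_nonneg hw hw' hy by blast+
  have y: "energy y \<le> 2 * (y1\<^sup>2 + x2\<^sup>2) + Y"
    using integral_square_le_endpoint[OF hy, of 0] y02 by (simp add: Y_def y1_def x2_def norm_2_square)
  have w: "energy w \<le> W / 2" and w01: "x1\<^sup>2 + x2\<^sup>2 + (norm (w 1))\<^sup>2 \<le> W"
    using integral_square_le_zero[OF hw s] by (auto simp: W_def x1_def x2_def norm_2_square)
  have py: "(p - x1)\<^sup>2 = 4 * y1\<^sup>2"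
    using arg_cong[OF y01, of "\<lambda>x. x\<^sup>2"] by (simp add: p_def x1_def y1_def power_mult_distrib)
  have c: "(99/1000) \<le> 1/4 - 3 / (2 * (215/100) ^ 3 :: real)" by (simp add: power3_eq_cube)
  have c': "(99/1000) * W \<le> (1/4 - 3 / (2 * (215/100) ^ 3)) * W" by (rule mult_right_mono[OF c pos(2)])
  \<comment> \<open>The estimates \<open>y\<close> and \<open>w\<close> are already inserted. What
    remains is linear in the squared start values and the energies.\<close>
  have main: "y1\<^sup>2 / 16 + x2\<^sup>2 / 16 + Y / 32 + energy w' / 128 + W / 256
      \<le> Y / 2 + V / 4 + 99 * W / 1000"
    using alt
  proof
    assume n1: "norm (w' 1) = norm (w 1)"
    have "energy w' \<le> 2 * (norm (w 1))\<^sup>2 + V"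
      using integral_square_le_endpoint[OF hw', of 1] n1 by (simp add: V_def)
    moreover have "(norm (w' 0))\<^sup>2 \<le> 2 * (norm (w 1))\<^sup>2 + 2 * V"
      using norm_add_square_le[of "w' 1" "w' 0 - w' 1"] H1_deriv_increment_energy[OF hw', of 1 0] n1
      by (simp add: V_def)
    then have "p\<^sup>2 \<le> 2 * (norm (w 1))\<^sup>2 + 2 * V" using component_square_le[of "w' 0" 1] by (simp add: p_def)
    moreover have "4 * y1\<^sup>2 \<le> 2 * p\<^sup>2 + 2 * x1\<^sup>2"
      using zero_le_power2[of "p + x1"] unfolding py[symmetric] by (simp add: power2_eq_square algebra_simps)
    moreover have "0 \<le> x1\<^sup>2" "0 \<le> x2\<^sup>2" "0 \<le> (norm (w 1))\<^sup>2" by simp_all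
    ultimately show ?thesis using w01 pos by linarith
  next
    assume e: "y 1 $ 1 * cos \<theta> + y 1 $ 2 * sin \<theta> = 0"
    have sin: "0 \<le> sin \<theta>" "sin \<theta> \<le> (1694/10000)" using th sin_x_le_x[of \<theta>] by (auto intro!: sin_ge_zero)
      (use pi_gt3 in linarith)
    have s2: "(sin \<theta>)\<^sup>2 \<le> (287/10000)" using power_mono[OF sin(2,1), of 2] by (simp add: power2_eq_square)
    have cos2: "(9713/10000) \<le> (cos \<theta>)\<^sup>2" using s2 sin_cos_squared_add[of \<theta>] by linarith
    \<comment> \<open>\<open>y 1\<close> is orthogonal to the unit vector (cos \<theta>, sin
      \<theta>), so the projection of \<open>y 0\<close> on it is at most the increment of
      \<open>y\<close>. As sin \<theta> is small, this controls \<open>y1\<close>.\<close>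
    have "(y1 * cos \<theta> + y 0 $ 2 * sin \<theta>)\<^sup>2 \<le> Y"
    proof -
      define u where "u = (vector [cos \<theta>, sin \<theta>] :: real^2)"
      have "(norm u)\<^sup>2 = 1\<^sup>2" using norm_2_square[of u] by (simp add: u_def)
      then have nu: "norm u = 1" by (rule power2_eq_imp_eq) simp_all
      have "y1 * cos \<theta> + y 0 $ 2 * sin \<theta> = (y 0 - y 1) \<bullet> u"
        using e by (simp add: u_def inner_vec_def sum_2 y1_def algebra_simps)
      then have "\<bar>y1 * cos \<theta> + y 0 $ 2 * sin \<theta>\<bar> \<le> norm (y 0 - y 1)"
        using Cauchy_Schwarz_ineq2[of "y 0 - y 1" u] nu by simp
      then have "(y1 * cos \<theta> + y 0 $ 2 * sin \<theta>)\<^sup>2 \<le> (norm (y 0 - y 1))\<^sup>2"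
        using power_mono[of "\<bar>y1 * cos \<theta> + y 0 $ 2 * sin \<theta>\<bar>" _ 2] by simp
      also have "\<dots> \<le> Y" using H1_deriv_increment_energy[OF hy, of 1 0] by (simp add: Y_def)
      finally show ?thesis .
    qed
    moreover have "(y1 * cos \<theta>)\<^sup>2 \<le> 2 * (y1 * cos \<theta> + y 0 $ 2 * sin \<theta>)\<^sup>2 + 2 * (y 0 $ 2 * sin \<theta>)\<^sup>2"
      using zero_le_power2[of "y1 * cos \<theta> + 2 * (y 0 $ 2 * sin \<theta>)"] by (simp add: power2_eq_square algebra_simps)
    ultimately have "y1\<^sup>2 * (cos \<theta>)\<^sup>2 \<le> 2 * Y + 2 * (x2\<^sup>2 * (sin \<theta>)\<^sup>2)"
      using y02 by (simp add: power_mult_distrib x2_def)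
    moreover have "y1\<^sup>2 * (9713/10000) \<le> y1\<^sup>2 * (cos \<theta>)\<^sup>2" by (intro mult_left_mono cos2) simp
    moreover have "x2\<^sup>2 * (sin \<theta>)\<^sup>2 \<le> x2\<^sup>2 * (287/10000)" by (intro mult_left_mono s2) simp
    ultimately have 1: "9713 * y1\<^sup>2 \<le> 20000 * Y + 574 * x2\<^sup>2" by simp
    have 2: "energy w' \<le> 2 * p\<^sup>2 + 2 * x2\<^sup>2 + V"
      using integral_square_le_endpoint[OF hw', of 0] w02 by (simp add: V_def p_def x2_def norm_2_square)
    have 3: "p\<^sup>2 \<le> 2 * x1\<^sup>2 + 8 * y1\<^sup>2"
      using zero_le_power2[of "p - 2 * x1"] py by (simp add: power2_eq_square algebra_simps)
    have "0 \<le> x1\<^sup>2" "0 \<le> x2\<^sup>2" "0 \<le> (norm (w 1))\<^sup>2" by simp_all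
    then show ?thesis using 1 2 3 w01 pos by linarith
  qed
  have "2 / 4 ^ 3 * energy y
        + 1 / (2 * 4 ^ 3) * energy w'
        + 1 / (2 * 4 ^ 3) * energy w \<le> Y / 2 + V / 4 + (99/1000) * W"
    using y w main by simp
  then show ?thesis using c' unfolding Y_def V_def W_def by linarith
qed

section \<open>The action of paths with collisions\<close>

text \<open>Jacobi coordinates: the two sides differ by the kinetic energy of the centre of mass, |a
  + b + c + d|^2 / 8.\<close>

lemma kinetic_pairing_le:
  fixes a b c d :: "'a::real_inner"
  shows "(norm (b - a))\<^sup>2 / 4 + (norm (d - c))\<^sup>2 / 4 + (norm ((1/2) *\<^sub>R (c + d - a - b)))\<^sup>2 / 2
    \<le> ((norm a)\<^sup>2 + (norm b)\<^sup>2 + (norm c)\<^sup>2 + (norm d)\<^sup>2) / 2"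
proof -
  have "((norm a)\<^sup>2 + (norm b)\<^sup>2 + (norm c)\<^sup>2 + (norm d)\<^sup>2) / 2
     - ((norm (b - a))\<^sup>2 / 4 + (norm (d - c))\<^sup>2 / 4 + (norm ((1/2) *\<^sub>R (c + d - a - b)))\<^sup>2 / 2)
     = (norm (a + b + c + d))\<^sup>2 / 8"
    unfolding power2_norm_eq_inner by (simp add: inner_simps inner_commute field_simps)
  moreover have "0 \<le> (norm (a + b + c + d))\<^sup>2 / 8" by simp
  ultimately show ?thesis by linarith
qed

text \<open>In these coordinates the mixed inner products cancel in the sum over the four cross
  distances, so the quadratic bound for the potential has no coupling terms.\<close>

lemma cross_distances_sum:
  fixes a b c d :: "'a::real_inner"
  shows "(norm (a - c))\<^sup>2 + (norm (a - d))\<^sup>2 + (norm (b - c))\<^sup>2 + (norm (b - d))\<^sup>2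
    = 4 * (norm ((1/2) *\<^sub>R (c + d - a - b)))\<^sup>2 + (norm (b - a))\<^sup>2 + (norm (d - c))\<^sup>2"
  unfolding power2_norm_eq_inner by (simp add: inner_simps inner_commute field_simps)

text \<open>The function x^(-1/2) is convex, and the left side is its tangent at \<rho>^2, taken at
  x = r^2.\<close>

lemma inverse_ge_quadratic:
  fixes r \<rho> :: real
  assumes "0 < r" "0 < \<rho>"
  shows "3 / (2 * \<rho>) - r\<^sup>2 / (2 * \<rho> ^ 3) \<le> 1 / r"
proof -
  have "0 \<le> (r - \<rho>)\<^sup>2 * (r + 2 * \<rho>) / (2 * \<rho> ^ 3 * r)" using assms by simp
  also have "\<dots> = 1 / r - (3 / (2 * \<rho>) - r\<^sup>2 / (2 * \<rho> ^ 3))"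
    using assms by (simp add: field_simps power2_eq_square power3_eq_cube)
  finally show ?thesis by simp
qed

text \<open>The three splittings into two pairs, each with either pair in front, because the front
  pair is the colliding one.\<close>

definition pairing :: "4 \<Rightarrow> 4 \<Rightarrow> 4 \<Rightarrow> 4 \<Rightarrow> bool" where
  "pairing i j k l \<longleftrightarrow> (i, j, k, l) \<in> {(1, 2, 3, 4), (3, 4, 1, 2), (1, 3, 2, 4), (2, 4, 1, 3), (1, 4, 2, 3), (2, 3, 1, 4)}"

lemma pairing_sum:
  fixes f :: "4 \<Rightarrow> real"
  assumes "pairing i j k l"
  shows "sum f UNIV = f i + f j + f k + f l"
  using assms unfolding pairing_def by (auto simp: sum_4)

lemma pairing_pot:
  assumes "pairing i j k l"
  shows "pot q = 1 / norm (q $ j - q $ i) + 1 / norm (q $ l - q $ k)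
    + 1 / norm (q $ i - q $ k) + 1 / norm (q $ i - q $ l) + 1 / norm (q $ j - q $ k) + 1 / norm (q $ j - q $ l)"
proof -
  define f where "f i j = 1 / norm (q $ i - q $ j)" for i j
  have sym: "f i j = f j i" for i j by (simp add: f_def norm_minus_commute)
  have "f 1 2 + f 1 3 + f 1 4 + f 2 3 + f 2 4 + f 3 4 = f j i + f l k + f i k + f i l + f j k + f j l"
    using assms sym[of 2 1] sym[of 3 1] sym[of 4 1] sym[of 3 2] sym[of 4 2] sym[of 4 3]
    unfolding pairing_def by auto
  then show ?thesis unfolding pot_def f_def .
qed

lemma pairing_distinct:
  assumes "pairing i j k l"
  shows "i \<noteq> j" "k \<noteq> l" "i \<noteq> k" "i \<noteq> l" "j \<noteq> k" "j \<noteq> l"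
  using assms distinct_4 unfolding pairing_def by auto

abbreviation centre_gap :: "4 \<Rightarrow> 4 \<Rightarrow> 4 \<Rightarrow> 4 \<Rightarrow> config \<Rightarrow> real^2" where
  "centre_gap i j k l p \<equiv> (1/2) *\<^sub>R (p $ k + p $ l - p $ i - p $ j)"

lemma pot_ge_pairing:
  assumes p: "pairing i j k l" and nc: "\<not> has_collision q" and \<rho>: "0 < \<rho>"
  shows "1 / norm (q $ j - q $ i) + (6 / \<rho> - (4 * (norm (centre_gap i j k l q))\<^sup>2
      + (norm (q $ j - q $ i))\<^sup>2 + (norm (q $ l - q $ k))\<^sup>2) / (2 * \<rho> ^ 3)) \<le> pot q"
proof -
  have pos: "0 < norm (q $ m - q $ n)" if "m \<noteq> n" for m n
    using nc that unfolding has_collision_def by auto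
  note ge = inverse_ge_quadratic[OF pos \<rho>]
  have "4 * (3 / (2 * \<rho>)) = 6 / \<rho>" by simp
  then have "6 / \<rho> - ((norm (q $ i - q $ k))\<^sup>2 + (norm (q $ i - q $ l))\<^sup>2 + (norm (q $ j - q $ k))\<^sup>2 + (norm (q $ j - q $ l))\<^sup>2) / (2 * \<rho> ^ 3)
    \<le> 1 / norm (q $ i - q $ k) + 1 / norm (q $ i - q $ l) + 1 / norm (q $ j - q $ k) + 1 / norm (q $ j - q $ l)"
    using ge[OF pairing_distinct(3)[OF p]] ge[OF pairing_distinct(4)[OF p]]
      ge[OF pairing_distinct(5)[OF p]] ge[OF pairing_distinct(6)[OF p]]
    by (simp add: add_divide_distrib)
  \<comment> \<open>The potential of the complementary pair is discarded.\<close>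
  moreover have "0 \<le> 1 / norm (q $ l - q $ k)" by simp
  ultimately show ?thesis
    unfolding cross_distances_sum pairing_pot[OF p] by linarith
qed

lemma config_pairing_bound:
  fixes q v :: "real \<Rightarrow> config"
  assumes h: "H1_deriv 0 1 q v" and p: "pairing i j k l"
    and s: "s \<in> {0..1}" "q s $ i = q s $ j"
    and N: "negligible {t\<in>{0..1}. has_collision (q t)}"
    and P: "(\<lambda>t. pot (q t)) integrable_on {0..1}"
    and \<rho>: "0 < \<rho>" and A: "0 < A"
    and C: "2 / \<rho> ^ 3 * integral {0..1} (\<lambda>t. (norm (centre_gap i j k l (q t)))\<^sup>2)
        + 1 / (2 * \<rho> ^ 3) * integral {0..1} (\<lambda>t. (norm (q t $ l - q t $ k))\<^sup>2)
        + 1 / (2 * \<rho> ^ 3) * integral {0..1} (\<lambda>t. (norm (q t $ j - q t $ i))\<^sup>2)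
      \<le> integral {0..1} (\<lambda>t. (norm (centre_gap i j k l (v t)))\<^sup>2) / 2
        + integral {0..1} (\<lambda>t. (norm (v t $ l - v t $ k))\<^sup>2) / 4
        + (1/4 - 3 / (2 * A ^ 3)) * integral {0..1} (\<lambda>t. (norm (v t $ j - v t $ i))\<^sup>2)"
  shows "6 / \<rho> + 9 / (2 * A) \<le> integral {0..1} (\<lambda>t. 1/2 * (norm (v t))\<^sup>2 + pot (q t))"
proof (rule pairing_action_bound[OF _ _ _ s(1) _ N _ _ P _ A C])
  have hc: "H1_deriv 0 1 (\<lambda>t. q t $ m) (\<lambda>t. v t $ m)" for m
    by (rule H1_deriv_linear[OF h bounded_linear_vec_nth])
  show "H1_deriv 0 1 (\<lambda>t. q t $ j - q t $ i) (\<lambda>t. v t $ j - v t $ i)"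
    "H1_deriv 0 1 (\<lambda>t. q t $ l - q t $ k) (\<lambda>t. v t $ l - v t $ k)"
    by (intro H1_deriv_diff hc)+
  show "H1_deriv 0 1 (\<lambda>t. centre_gap i j k l (q t)) (\<lambda>t. centre_gap i j k l (v t))"
    by (rule H1_deriv_linear[OF _ bounded_linear_scaleR_right]) (intro H1_deriv_diff H1_deriv_add hc)
  show "q s $ j - q s $ i = 0" using s by simp
  show "(\<lambda>t. 1/2 * (norm (v t))\<^sup>2) integrable_on {0..1}"
    by (intro integrable_on_mult_right H1_derivD[OF h])
  show "(norm (v t $ j - v t $ i))\<^sup>2 / 4 + (norm (v t $ l - v t $ k))\<^sup>2 / 4
      + (norm (centre_gap i j k l (v t)))\<^sup>2 / 2 \<le> 1/2 * (norm (v t))\<^sup>2" for t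
    using kinetic_pairing_le[of "v t $ j" "v t $ i" "v t $ l" "v t $ k"]
    unfolding norm_config_square[symmetric] pairing_sum[OF p] by simp
  fix t assume "t \<in> {0..1} - {t\<in>{0..1}. has_collision (q t)}"
  then have nc: "\<not> has_collision (q t)" by simp
  then have "q t $ j \<noteq> q t $ i" using pairing_distinct(1)[OF p] unfolding has_collision_def by metis
  then show "q t $ j - q t $ i \<noteq> 0 \<and> 1 / norm (q t $ j - q t $ i)
     + (6 / \<rho> - (4 * (norm (centre_gap i j k l (q t)))\<^sup>2
      + (norm (q t $ j - q t $ i))\<^sup>2 + (norm (q t $ l - q t $ k))\<^sup>2) / (2 * \<rho> ^ 3)) \<le> pot (q t)"
    using pot_ge_pairing[OF p nc \<rho>] by simp
qed

text \<open>Linear in the parameters, so that with arbitrary signs these are also the tangent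
  vectors of \<open>Q_S\<close>; \<open>E_config\<close> plays the same role for
  \<open>Q_E1\<close>.\<close>

definition S_config :: "real \<Rightarrow> real \<Rightarrow> real \<Rightarrow> config" where
  "S_config a b c = vector [vector [- a - c, 0], vector [- a, 0], vector [(2 * a + c) / 2, b], vector [(2 * a + c) / 2, - b]]"

definition E_config :: "real \<Rightarrow> real \<Rightarrow> real \<Rightarrow> real \<Rightarrow> config" where
  "E_config \<theta> a b c = (vector [vector [- b, - a], vector [- c, a], vector [c, a], vector [b, - a]] :: config) ** R \<theta>"

lemma row_R: "(M ** R \<theta>) $ i $ 1 = M $ i $ 1 * cos \<theta> - M $ i $ 2 * sin \<theta>"
  "(M ** R \<theta>) $ i $ 2 = M $ i $ 1 * sin \<theta> + M $ i $ 2 * cos \<theta>"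
  by (simp_all add: matrix_matrix_mult_def sum_2 R_def vector_2)

lemma Q_S_iff: "q \<in> Q_S \<longleftrightarrow> (\<exists>a b c. q = S_config a b c \<and> 0 \<le> b \<and> 0 \<le> c)"
  unfolding Q_S_def S_config_def by blast

lemma Q_E1_iff: "q \<in> Q_E1 \<theta> \<longleftrightarrow> (\<exists>a b c. q = E_config \<theta> a b c \<and> 0 \<le> b \<and> 0 \<le> c)"
  unfolding Q_E1_def E_config_def by blast

lemma S_config_components:
  "S_config a b c $ 1 $ 1 = - a - c" "S_config a b c $ 1 $ 2 = 0"
  "S_config a b c $ 2 $ 1 = - a" "S_config a b c $ 2 $ 2 = 0"
  "S_config a b c $ 3 $ 1 = (2 * a + c) / 2" "S_config a b c $ 3 $ 2 = b"
  "S_config a b c $ 4 $ 1 = (2 * a + c) / 2" "S_config a b c $ 4 $ 2 = - b"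
  by (simp_all add: S_config_def vector_4 vector_2)

lemma E_config_components:
  "E_config \<theta> a b c $ 1 $ 1 = - b * cos \<theta> + a * sin \<theta>" "E_config \<theta> a b c $ 1 $ 2 = - b * sin \<theta> - a * cos \<theta>"
  "E_config \<theta> a b c $ 2 $ 1 = - c * cos \<theta> - a * sin \<theta>" "E_config \<theta> a b c $ 2 $ 2 = - c * sin \<theta> + a * cos \<theta>"
  "E_config \<theta> a b c $ 3 $ 1 = c * cos \<theta> - a * sin \<theta>" "E_config \<theta> a b c $ 3 $ 2 = c * sin \<theta> + a * cos \<theta>"
  "E_config \<theta> a b c $ 4 $ 1 = b * cos \<theta> + a * sin \<theta>" "E_config \<theta> a b c $ 4 $ 2 = b * sin \<theta> - a * cos \<theta>"
  by (simp_all add: E_config_def row_R vector_4 vector_2)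

lemma norm_2_eqI: "(x $ 1)\<^sup>2 + (x $ 2)\<^sup>2 = (y $ 1)\<^sup>2 + (y $ 2)\<^sup>2 \<Longrightarrow> norm (x :: real^2) = norm (y :: real^2)"
  using norm_2_square[of x] norm_2_square[of y]
  by (intro power2_eq_imp_eq[of "norm x" "norm y"]) simp_all

text \<open>The splitting 12|34 is special: its two centres lie on the horizontal axis at t = 0 and
  on the line at angle \<theta> at t = 1, so \<open>rotation_poincare\<close> applies. The other
  splittings rely on equal lengths and matching components in the boundary shapes.\<close>

lemma collision_action_bound:
  fixes q :: "real \<Rightarrow> config"
  defines "v \<equiv> \<lambda>t. vector_derivative q (at t)"
  assumes q: "q \<in> paths Q_S (Q_E1 \<theta>)" and th: "0 < \<theta>" "\<theta> \<le> 1694/10000"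
    and N: "negligible {t\<in>{0..1}. has_collision (q t)}"
    and P: "(\<lambda>t. pot (q t)) integrable_on {0..1}"
    and s: "s \<in> {0..1}" "has_collision (q s)"
    and \<rho>: "0 < \<rho>" "\<rho> ^ 3 = 4 / \<theta>\<^sup>2"
  shows "min (6 / \<rho> + 9 / (2 * (185/100))) (6 / 4 + 9 / (2 * (215/100)))
    \<le> integral {0..1} (\<lambda>t. 1/2 * (norm (v t))\<^sup>2 + pot (q t))"
proof -
  have h: "H1_deriv 0 1 q v" unfolding v_def using q H1_imp_H1_deriv by (auto simp: paths_def)
  have hc: "H1_deriv 0 1 (\<lambda>t. q t $ m) (\<lambda>t. v t $ m)" for m
    by (rule H1_deriv_linear[OF h bounded_linear_vec_nth])
  have hd: "H1_deriv 0 1 (\<lambda>t. q t $ m - q t $ n) (\<lambda>t. v t $ m - v t $ n)" for m n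
    by (intro H1_deriv_diff hc)
  have hy: "H1_deriv 0 1 (\<lambda>t. centre_gap i j k l (q t)) (\<lambda>t. centre_gap i j k l (v t))" for i j k l
    by (rule H1_deriv_linear[OF _ bounded_linear_scaleR_right]) (intro H1_deriv_diff H1_deriv_add hc)
  from q have "q 0 \<in> Q_S" "q 1 \<in> Q_E1 \<theta>" by (auto simp: paths_def)
  obtain a0 b0 c0 where "q 0 = S_config a0 b0 c0" using \<open>q 0 \<in> Q_S\<close> unfolding Q_S_iff by blast
  note q0 = S_config_components[of a0 b0 c0, folded this]
  obtain a b c where "q 1 = E_config \<theta> a b c" using \<open>q 1 \<in> Q_E1 \<theta>\<close> unfolding Q_E1_iff by blast
  note q1 = E_config_components[of \<theta> a b c, folded this]
  have n12: "norm (q 1 $ 2 - q 1 $ 1) = norm (q 1 $ 4 - q 1 $ 3)"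
    by (rule norm_2_eqI, unfold vector_minus_component q1) (simp add: power2_eq_square algebra_simps)
  have n13: "norm (q 1 $ 3 - q 1 $ 1) = norm (q 1 $ 4 - q 1 $ 2)"
    by (rule norm_2_eqI, unfold vector_minus_component q1) (simp add: power2_eq_square algebra_simps)
  have dbl: "6 / \<rho> + 9 / (2 * (185/100)) \<le> integral {0..1} (\<lambda>t. 1/2 * (norm (v t))\<^sup>2 + pot (q t))"
    if p: "pairing i j k l" "(i, j, k, l) \<in> {(1, 2, 3, 4), (3, 4, 1, 2)}" and e: "q s $ i = q s $ j" for i j k l
  proof (rule config_pairing_bound[OF h p(1) s(1) e N P \<rho>(1) _
        double_binary_quadratic_bound[OF hd hd hy s(1) _ th \<rho>(2)]])
    show "0 < (185/100 :: real)" by simp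
    show "q s $ j - q s $ i = 0" using e by simp
    show "(centre_gap i j k l (q 0)) $ 2 = 0" using p(2) by (auto simp: q0)
    show "(centre_gap i j k l (q 1)) $ 2 * cos \<theta> =
          (centre_gap i j k l (q 1)) $ 1 * sin \<theta>" using p(2) by (auto simp: q1 field_simps)
    show "norm (q 1 $ l - q 1 $ k) = norm (q 1 $ j - q 1 $ i)" using p(2) n12 by auto
  qed
  have crs: "6 / 4 + 9 / (2 * (215/100)) \<le> integral {0..1} (\<lambda>t. 1/2 * (norm (v t))\<^sup>2 + pot (q t))"
    if p: "pairing i j k l" "(i, j, k, l) \<in> {(1, 3, 2, 4), (2, 4, 1, 3), (1, 4, 2, 3), (2, 3, 1, 4)}"
      and e: "q s $ i = q s $ j" for i j k l
  proof (rule config_pairing_bound[OF h p(1) s(1) e N P _ _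
        cross_pair_quadratic_bound[OF hd hd hy s(1) _ th]])
    show "0 < (4 :: real)" "0 < (215/100 :: real)" by simp_all
    show "q s $ j - q s $ i = 0" using e by simp
    show "((centre_gap i j k l (q 0)) $ 2)\<^sup>2 = ((q 0 $ j - q 0 $ i) $ 2)\<^sup>2"
        using p(2) by (auto simp: q0 power2_eq_square)
    show "((q 0 $ l - q 0 $ k) $ 2)\<^sup>2 = ((q 0 $ j - q 0 $ i) $ 2)\<^sup>2"
        using p(2) by (auto simp: q0 power2_eq_square)
    show "\<bar>(q 0 $ l - q 0 $ k) $ 1 - (q 0 $ j - q 0 $ i) $ 1\<bar> = 2 * \<bar>(centre_gap i j k l (q 0)) $ 1\<bar>"
        using p(2) by (auto simp: q0 abs_mult[symmetric] field_simps)
    show "norm (q 1 $ l - q 1 $ k) = norm (q 1 $ j - q 1 $ i) \<or>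
          (centre_gap i j k l (q 1)) $ 1 * cos \<theta> +
          (centre_gap i j k l (q 1)) $ 2 * sin \<theta> = 0"
        using p(2) n13 by (auto simp: q1 field_simps)
  qed
  from s(2) have "q s $ 1 = q s $ 2 \<or> q s $ 3 = q s $ 4 \<or> q s $ 1 = q s $ 3 \<or> q s $ 2 = q s $ 4
      \<or> q s $ 1 = q s $ 4 \<or> q s $ 2 = q s $ 3"
    using not_has_collision_iff by blast
  then show ?thesis
    using dbl[of 1 2 3 4] dbl[of 3 4 1 2] crs[of 1 3 2 4] crs[of 2 4 1 3] crs[of 1 4 2 3] crs[of 2 3 1 4]
    unfolding pairing_def min_le_iff_disj by blast
qed

section \<open>A competitor\<close>

lemma C1_imp_H1:
  fixes q :: "real \<Rightarrow> 'a::euclidean_space"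
  assumes d: "\<And>t. (q has_vector_derivative v t) (at t)" and c: "continuous_on UNIV v"
  shows "q \<in> H1" "\<And>t. vector_derivative q (at t) = v t"
proof -
  show vd: "vector_derivative q (at t) = v t" for t
    by (rule vector_derivative_at[OF d])
  have h: "H1_deriv 0 1 q v"
    by (rule H1_deriv_C1) (auto intro: has_vector_derivative_at_within d continuous_on_subset[OF c])
  have "(\<lambda>t. (norm (v t))\<^sup>2) absolutely_integrable_on {0..1}"
    by (rule nonnegative_absolutely_integrable_1[OF H1_derivD(2)[OF h]]) simp
  then have "integrable (lebesgue_on {0..1}) (\<lambda>t. (norm (v t))\<^sup>2)"
    by (subst integrable_lebesgue_on_iff) auto
  moreover have "q differentiable (at t)" for t using d differentiableI_vector by blast
  ultimately show "q \<in> H1"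
    unfolding H1_def using h by (simp add: vd H1_deriv_def)
qed

text \<open>The Taylor coefficient 3/8 is raised to 57/100 so that the bound survives down to z =
  -0.387, where little room is left. Squaring reduces it to the positivity of p^2 (1 + z) - 1, which
  is z^2 times a cubic.\<close>

lemma inverse_sqrt_le_quadratic:
  fixes z :: real
  assumes "\<bar>z\<bar> \<le> 387/1000"
  shows "1 / sqrt (1 + z) \<le> 1 - z / 2 + 57/100 * z\<^sup>2"
proof -
  define p where "p = 1 - z / 2 + 57/100 * z\<^sup>2"
  have z: "- (387/1000) \<le> z" "z \<le> 387/1000" using assms by auto
  have p0: "0 < p" using z zero_le_power2[of z] unfolding p_def by linarith
  have z2: "z\<^sup>2 \<le> 15/100" using power_mono[OF assms, of 2] by (simp add: power2_eq_square)
  have "0 \<le> 39/100 + 82/100 * z - 2451/10000 * z\<^sup>2 + 3249/10000 * z ^ 3"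
  proof -
    have "\<bar>z ^ 3\<bar> \<le> (387/1000) ^ 3" unfolding power_abs by (rule power_mono[OF assms]) simp
    also have "(387/1000 :: real) ^ 3 \<le> 58/1000" by (simp add: power3_eq_cube)
    finally have "- (58/1000) \<le> z ^ 3" by linarith
    then show ?thesis using z z2 by linarith
  qed
  then have "0 \<le> z\<^sup>2 * (39/100 + 82/100 * z - 2451/10000 * z\<^sup>2 + 3249/10000 * z ^ 3)" by simp
  also have "\<dots> = p\<^sup>2 * (1 + z) - 1"
    unfolding p_def by (simp add: power2_eq_square power3_eq_cube field_simps)
  finally have "1 \<le> p\<^sup>2 * (1 + z)" by simp
  then have "sqrt 1 \<le> sqrt (p\<^sup>2 * (1 + z))" by (rule real_sqrt_le_mono)
  then have "1 \<le> p * sqrt (1 + z)" using p0 by (simp add: real_sqrt_mult)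
  moreover have "0 < sqrt (1 + z)" using z by simp
  ultimately show ?thesis unfolding p_def[symmetric] by (simp add: field_simps)
qed

text \<open>The points \<open>\<plusminus>u, \<plusminus>u'\<close> are the vertices of a square, so that the terms linear in \<open>x\<close> cancel
  and the quadratic ones do not depend on its direction.\<close>

lemma inverse_distances_to_square_le:
  fixes x u u' :: "real^2"
  assumes x: "norm x = \<rho>" and \<rho>: "0 < \<rho>"
    and u: "u $ 1 = b" "u $ 2 = c" "u' $ 1 = - c" "u' $ 2 = b" and sg: "(b\<^sup>2 + c\<^sup>2) / \<rho>\<^sup>2 \<le> 315/10000"
  shows "norm (x - u) \<noteq> 0" "norm (x + u) \<noteq> 0" "norm (x - u') \<noteq> 0" "norm (x + u') \<noteq> 0"
    "1 / norm (x - u) + 1 / norm (x + u) + 1 / norm (x - u') + 1 / norm (x + u') \<le> 4083/1000 / \<rho>"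
proof -
  define \<sigma> where "\<sigma> = (b\<^sup>2 + c\<^sup>2) / \<rho>\<^sup>2"
  define d d' where "d = 2 * (x $ 1 * b + x $ 2 * c) / \<rho>\<^sup>2" and "d' = 2 * (x $ 2 * b - x $ 1 * c) / \<rho>\<^sup>2"
  have x2: "(x $ 1)\<^sup>2 + (x $ 2)\<^sup>2 = \<rho>\<^sup>2" using norm_2_square[of x] x by simp
  have s0: "0 \<le> \<sigma>" "\<sigma> \<le> 315/10000" using sg by (auto simp: \<sigma>_def)
  have dd: "d\<^sup>2 + d'\<^sup>2 = 4 * \<sigma>"
  proof -
    have "(2 * (x $ 1 * b + x $ 2 * c))\<^sup>2 + (2 * (x $ 2 * b - x $ 1 * c))\<^sup>2 = 4 * (b\<^sup>2 + c\<^sup>2) * \<rho>\<^sup>2"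
      unfolding x2[symmetric] by (simp add: power2_eq_square algebra_simps)
    then show ?thesis unfolding d_def d'_def \<sigma>_def power_divide add_divide_distrib[symmetric]
      using \<rho> by (simp add: field_simps power2_eq_square)
  qed
  \<comment> \<open>4 \<sigma> is at most 0.126 < 0.355^2, and 0.355 + 0.0315 stays inside the range
    0.387 of \<open>inverse_sqrt_le_quadratic\<close>.\<close>
  have small: "\<bar>e\<bar> \<le> 355/1000" if "e\<^sup>2 \<le> 4 * \<sigma>" for e
  proof -
    have "e\<^sup>2 \<le> (355/1000)\<^sup>2" using that s0 by (simp add: power2_eq_square)
    then show ?thesis using abs_le_square_iff[of e "355/1000"] by simp
  qed
  have d: "\<bar>d\<bar> \<le> 355/1000" "\<bar>d'\<bar> \<le> 355/1000"
    using small[of d] small[of d'] dd zero_le_power2[of d] zero_le_power2[of d'] by linarith+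
  have n: "norm y = \<rho> * sqrt (1 + (\<sigma> + e))"
    if "(norm y)\<^sup>2 = \<rho>\<^sup>2 + (b\<^sup>2 + c\<^sup>2) + \<rho>\<^sup>2 * e" for y :: "real^2" and e
  proof -
    have "\<rho>\<^sup>2 + (b\<^sup>2 + c\<^sup>2) + \<rho>\<^sup>2 * e = \<rho>\<^sup>2 * (1 + (\<sigma> + e))"
      using \<rho> by (simp add: \<sigma>_def field_simps)
    then have "sqrt ((norm y)\<^sup>2) = sqrt (\<rho>\<^sup>2 * (1 + (\<sigma> + e)))" using that by simp
    then show ?thesis using \<rho> by (simp add: real_sqrt_mult)
  qed
  have rd: "\<rho>\<^sup>2 * d = 2 * (x $ 1 * b + x $ 2 * c)" "\<rho>\<^sup>2 * d' = 2 * (x $ 2 * b - x $ 1 * c)"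
    using \<rho> by (auto simp: d_def d'_def)
  have e1: "norm (x - u) = \<rho> * sqrt (1 + (\<sigma> + - d))"
    by (rule n, unfold norm_2_square mult_minus_right rd, unfold x2[symmetric]) (simp add: u power2_eq_square algebra_simps)
  have e2: "norm (x + u) = \<rho> * sqrt (1 + (\<sigma> + d))"
    by (rule n, unfold norm_2_square mult_minus_right rd, unfold x2[symmetric]) (simp add: u power2_eq_square algebra_simps)
  have e3: "norm (x - u') = \<rho> * sqrt (1 + (\<sigma> + - d'))"
    by (rule n, unfold norm_2_square mult_minus_right rd, unfold x2[symmetric]) (simp add: u power2_eq_square algebra_simps)
  have e4: "norm (x + u') = \<rho> * sqrt (1 + (\<sigma> + d'))"
    by (rule n, unfold norm_2_square mult_minus_right rd, unfold x2[symmetric]) (simp add: u power2_eq_square algebra_simps)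
  have q: "1 / (\<rho> * sqrt (1 + (\<sigma> + e))) \<le> (1 - (\<sigma> + e) / 2 + 57/100 * (\<sigma> + e)\<^sup>2) / \<rho>"
    if "\<bar>e\<bar> \<le> 355/1000" for e
  proof -
    have "\<bar>\<sigma> + e\<bar> \<le> 387/1000" using that s0 by linarith
    from divide_right_mono[OF inverse_sqrt_le_quadratic[OF this], of \<rho>] show ?thesis
      using \<rho> by (simp add: mult.commute)
  qed
  have nz: "\<rho> * sqrt (1 + (\<sigma> + e)) \<noteq> 0" if "\<bar>e\<bar> \<le> 355/1000" for e
    using that s0 \<rho> by auto
  show "norm (x - u) \<noteq> 0" "norm (x + u) \<noteq> 0" "norm (x - u') \<noteq> 0" "norm (x + u') \<noteq> 0"
    unfolding e1 e2 e3 e4 using d by (intro nz; simp)+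
  have "1 / norm (x - u) + 1 / norm (x + u) + 1 / norm (x - u') + 1 / norm (x + u')
    \<le> (1 - (\<sigma> + - d) / 2 + 57/100 * (\<sigma> + - d)\<^sup>2) / \<rho> + (1 - (\<sigma> + d) / 2 + 57/100 * (\<sigma> + d)\<^sup>2) / \<rho>
     + (1 - (\<sigma> + - d') / 2 + 57/100 * (\<sigma> + - d')\<^sup>2) / \<rho> + (1 - (\<sigma> + d') / 2 + 57/100 * (\<sigma> + d')\<^sup>2) / \<rho>"
    unfolding e1 e2 e3 e4 using d by (intro add_mono q) auto
  also have "\<dots> = (4 - 2 * \<sigma> + 57/100 * (4 * \<sigma>\<^sup>2 + 2 * (d\<^sup>2 + d'\<^sup>2))) / \<rho>"
    unfolding add_divide_distrib[symmetric] by (intro arg_cong2[of _ _ _ _ "(/)"] refl) (simp add: power2_eq_square field_simps)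
  \<comment> \<open>With \<open>dd\<close> the numerator becomes 4 + 2.56 \<sigma> + 2.28
    \<sigma>^2, at most 4.083 for \<sigma> \<le> 0.0315.\<close>
  also have "\<dots> \<le> 4083/1000 / \<rho>"
  proof (rule divide_right_mono)
    have "\<sigma>\<^sup>2 \<le> (315/10000)\<^sup>2" using s0 by (intro power_mono) auto
    then have "\<sigma>\<^sup>2 \<le> 1/1000" by (simp add: power2_eq_square)
    then show "4 - 2 * \<sigma> + 57/100 * (4 * \<sigma>\<^sup>2 + 2 * (d\<^sup>2 + d'\<^sup>2)) \<le> 4083/1000"
      using s0 unfolding dd by (simp add: field_simps)
  qed (use \<rho> in simp)
  finally show "1 / norm (x - u) + 1 / norm (x + u) + 1 / norm (x - u') + 1 / norm (x + u') \<le> 4083/1000 / \<rho>" .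
qed

definition config_of :: "(real \<times> real) \<Rightarrow> (real \<times> real) \<Rightarrow> (real \<times> real) \<Rightarrow> (real \<times> real) \<Rightarrow> config" where
  "config_of a b c d = vector [vector [fst a, snd a], vector [fst b, snd b], vector [fst c, snd c], vector [fst d, snd d]]"

lemma config_of_components [simp]:
  "config_of a b c d $ 1 $ 1 = fst a" "config_of a b c d $ 1 $ 2 = snd a"
  "config_of a b c d $ 2 $ 1 = fst b" "config_of a b c d $ 2 $ 2 = snd b"
  "config_of a b c d $ 3 $ 1 = fst c" "config_of a b c d $ 3 $ 2 = snd c"
  "config_of a b c d $ 4 $ 1 = fst d" "config_of a b c d $ 4 $ 2 = snd d"
  by (simp_all add: config_of_def vector_4 vector_2)

lemma config_eqI:
  assumes "p $ 1 $ 1 = q $ 1 $ 1" "p $ 1 $ 2 = q $ 1 $ 2" "p $ 2 $ 1 = q $ 2 $ 1" "p $ 2 $ 2 = q $ 2 $ 2"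
    "p $ 3 $ 1 = q $ 3 $ 1" "p $ 3 $ 2 = q $ 3 $ 2" "p $ 4 $ 1 = q $ 4 $ 1" "p $ 4 $ 2 = q $ 4 $ 2"
  shows "p = (q :: config)"
  using assms by (simp add: vec_eq_iff forall_4 forall_2)

lemma chi_iff: "q \<in> chi \<longleftrightarrow> q $ 1 $ 1 + q $ 2 $ 1 + q $ 3 $ 1 + q $ 4 $ 1 = 0
    \<and> q $ 1 $ 2 + q $ 2 $ 2 + q $ 3 $ 2 + q $ 4 $ 2 = 0"
  unfolding chi_def sum_4 by (simp add: vec_eq_iff forall_2)

text \<open>Two circular binaries of diameter \<open>13/10\<close> turning by \<open>\<pi>/4 + \<theta>\<close>, always perpendicular to each
  other, whose centres turn by \<open>\<theta>\<close> at distance \<open>\<rho>\<close>.\<close>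

definition test_path :: "real \<Rightarrow> real \<Rightarrow> real \<Rightarrow> config" where
  "test_path \<rho> \<theta> t =
     cos (\<theta> * t) *\<^sub>R config_of (- \<rho>/2, 0) (- \<rho>/2, 0) (\<rho>/2, 0) (\<rho>/2, 0)
   + sin (\<theta> * t) *\<^sub>R config_of (0, - \<rho>/2) (0, - \<rho>/2) (0, \<rho>/2) (0, \<rho>/2)
   + cos ((pi/4 + \<theta>) * t) *\<^sub>R config_of (- 13/20, 0) (13/20, 0) (0, 13/20) (0, - 13/20)
   + sin ((pi/4 + \<theta>) * t) *\<^sub>R config_of (0, - 13/20) (0, 13/20) (- 13/20, 0) (13/20, 0)"

definition test_velocity :: "real \<Rightarrow> real \<Rightarrow> real \<Rightarrow> config" where
  "test_velocity \<rho> \<theta> t =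
     (- \<theta> * sin (\<theta> * t)) *\<^sub>R config_of (- \<rho>/2, 0) (- \<rho>/2, 0) (\<rho>/2, 0) (\<rho>/2, 0)
   + (\<theta> * cos (\<theta> * t)) *\<^sub>R config_of (0, - \<rho>/2) (0, - \<rho>/2) (0, \<rho>/2) (0, \<rho>/2)
   + (- (pi/4 + \<theta>) * sin ((pi/4 + \<theta>) * t)) *\<^sub>R config_of (- 13/20, 0) (13/20, 0) (0, 13/20) (0, - 13/20)
   + ((pi/4 + \<theta>) * cos ((pi/4 + \<theta>) * t)) *\<^sub>R config_of (0, - 13/20) (0, 13/20) (- 13/20, 0) (13/20, 0)"

lemma test_path_derivative: "(test_path \<rho> \<theta> has_vector_derivative test_velocity \<rho> \<theta> t) (at t)"
proof -
  have s: "((\<lambda>t. f t *\<^sub>R C) has_vector_derivative f' *\<^sub>R C) (at t)"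
    if "(f has_real_derivative f') (at t)" for f f' and C :: config
    using has_vector_derivative_scaleR[OF that has_vector_derivative_const[of C]] by simp
  show ?thesis unfolding test_path_def[abs_def] test_velocity_def
    by (intro has_vector_derivative_add s) (auto intro!: derivative_eq_intros simp: algebra_simps)
qed

lemma norm_test_velocity: "(norm (test_velocity \<rho> \<theta> t))\<^sup>2 = \<rho>\<^sup>2 * \<theta>\<^sup>2 + 169/100 * (pi/4 + \<theta>)\<^sup>2"
proof -
  define \<alpha> where "\<alpha> = pi/4 + \<theta>"
  have a: "(sin (\<theta> * t))\<^sup>2 + (cos (\<theta> * t))\<^sup>2 = 1" "(sin (\<alpha> * t))\<^sup>2 + (cos (\<alpha> * t))\<^sup>2 = 1" by simp_all
  define C S c s where "C = cos (\<theta> * t)" and "S = sin (\<theta> * t)" and "c = cos (\<alpha> * t)" and "s = sin (\<alpha> * t)"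
  have "(norm (test_velocity \<rho> \<theta> t))\<^sup>2 = \<rho>\<^sup>2 * \<theta>\<^sup>2 * (S\<^sup>2 + C\<^sup>2) + 169/100 * \<alpha>\<^sup>2 * (s\<^sup>2 + c\<^sup>2)"
    unfolding norm_config_square[symmetric] sum_4 norm_2_square test_velocity_def \<alpha>_def[symmetric]
      C_def[symmetric] S_def[symmetric] c_def[symmetric] s_def[symmetric]
    by (simp add: power2_eq_square algebra_simps)
  then show ?thesis unfolding C_def S_def c_def s_def a \<alpha>_def by simp
qed

lemma test_path_pot:
  assumes \<rho>: "0 < \<rho>" "845/1000 / \<rho>\<^sup>2 \<le> 315/10000"
  shows "\<not> has_collision (test_path \<rho> \<theta> t)"
    and "pot (test_path \<rho> \<theta> t) \<le> 20/13 + 4083/1000 / \<rho>"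
proof -
  define C S c s where "C = cos (\<theta> * t)" and "S = sin (\<theta> * t)" and "c = cos ((pi/4 + \<theta>) * t)" and "s = sin ((pi/4 + \<theta>) * t)"
  have sc: "C\<^sup>2 + S\<^sup>2 = 1" "c\<^sup>2 + s\<^sup>2 = 1" by (simp_all add: C_def S_def c_def s_def)
  \<comment> \<open>\<open>x\<close> joins the two centres, while \<open>u\<close> and
    \<open>u'\<close> are a difference and a negated sum of half-diameters of the two binaries.
    These are perpendicular and equally long, so the points \<plusminus>u, \<plusminus>u' form a
    square.\<close>
  define x u u' where "x = (vector [\<rho> * C, \<rho> * S] :: real^2)"
    and "u = (vector [13/20 * (s - c), - (13/20) * (c + s)] :: real^2)"
    and "u' = (vector [13/20 * (c + s), 13/20 * (s - c)] :: real^2)"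
  let ?q = "test_path \<rho> \<theta> t"
  have vq: "?q $ 1 - ?q $ 3 = - (x - u)" "?q $ 2 - ?q $ 4 = - (x + u)" "?q $ 2 - ?q $ 3 = - (x - u')" "?q $ 1 - ?q $ 4 = - (x + u')"
    unfolding vec_eq_iff forall_2 test_path_def x_def u_def u'_def C_def[symmetric] S_def[symmetric] c_def[symmetric] s_def[symmetric]
    by (simp_all add: vector_2 field_simps)
  have "(norm x)\<^sup>2 = \<rho>\<^sup>2 * (C\<^sup>2 + S\<^sup>2)" unfolding norm_2_square by (simp add: x_def vector_2 power_mult_distrib algebra_simps)
  then have nx: "norm x = \<rho>" using \<rho> sc by simp
  have *: "((13/20 * (s - c))\<^sup>2 + (- (13/20) * (c + s))\<^sup>2) = 845/1000 * (c\<^sup>2 + s\<^sup>2)"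
    by (simp add: power2_eq_square field_simps)
  have sg: "((13/20 * (s - c))\<^sup>2 + (- (13/20) * (c + s))\<^sup>2) / \<rho>\<^sup>2 \<le> 315/10000" unfolding * sc using \<rho> by simp
  note sq = inverse_distances_to_square_le[OF nx \<rho>(1) _ _ _ _ sg, of u u']
  have uc: "u $ 1 = 13/20 * (s - c)" "u $ 2 = - (13/20) * (c + s)" "u' $ 1 = - (- (13/20) * (c + s))" "u' $ 2 = 13/20 * (s - c)"
    by (simp_all add: u_def u'_def vector_2)
  note sq = sq[OF uc]
  have n12: "norm (?q $ 1 - ?q $ 2) = 13/10" and n34: "norm (?q $ 3 - ?q $ 4) = 13/10"
  proof -
    have "(norm (?q $ 1 - ?q $ 2))\<^sup>2 = 169/100 * (c\<^sup>2 + s\<^sup>2)" "(norm (?q $ 3 - ?q $ 4))\<^sup>2 = 169/100 * (c\<^sup>2 + s\<^sup>2)"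
      unfolding norm_2_square test_path_def C_def[symmetric] S_def[symmetric] c_def[symmetric] s_def[symmetric]
      by (simp_all add: power2_eq_square algebra_simps)
    then have "(norm (?q $ 1 - ?q $ 2))\<^sup>2 = (13/10)\<^sup>2" "(norm (?q $ 3 - ?q $ 4))\<^sup>2 = (13/10)\<^sup>2"
      unfolding sc by (simp_all add: power2_eq_square)
    then show "norm (?q $ 1 - ?q $ 2) = 13/10" "norm (?q $ 3 - ?q $ 4) = 13/10"
      by - (rule power2_eq_imp_eq; simp)+
  qed
  have pw: "norm (?q $ 1 - ?q $ 3) = norm (x - u)" "norm (?q $ 2 - ?q $ 4) = norm (x + u)"
     "norm (?q $ 2 - ?q $ 3) = norm (x - u')" "norm (?q $ 1 - ?q $ 4) = norm (x + u')"
    unfolding vq norm_minus_cancel by (rule refl)+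
  show "\<not> has_collision ?q"
    unfolding not_has_collision_iff using sq(1-4)[folded pw] n12 n34 by auto
  show "pot ?q \<le> 20/13 + 4083/1000 / \<rho>"
    unfolding pot_def pw n12 n34 using sq(5) by simp
qed

text \<open>At t = 0 one binary lies along the axis and the other across it. Relative to the line of
  centres both turn by pi/4, which makes them the legs of an isosceles trapezoid, the shape of
  \<open>Q_E1\<close>.\<close>

lemma test_path_in_paths:
  assumes "13/10 \<le> \<rho>"
  shows "test_path \<rho> \<theta> \<in> paths Q_S (Q_E1 \<theta>)"
proof -
  have "continuous_on UNIV (test_velocity \<rho> \<theta>)"
    unfolding test_velocity_def[abs_def] by (intro continuous_intros)
  from C1_imp_H1(1)[OF test_path_derivative this] have "test_path \<rho> \<theta> \<in> H1" .
  moreover have "test_path \<rho> \<theta> t \<in> chi" for t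
    unfolding chi_iff test_path_def by simp
  moreover have "test_path \<rho> \<theta> 0 \<in> Q_S"
  proof -
    have "test_path \<rho> \<theta> 0 = vector [vector [- (\<rho>/2 - 13/20) - 13/10, 0], vector [- (\<rho>/2 - 13/20), 0],
       vector [(2 * (\<rho>/2 - 13/20) + 13/10) / 2, 13/20], vector [(2 * (\<rho>/2 - 13/20) + 13/10) / 2, - (13/20)]]"
      by (rule config_eqI) (simp_all add: test_path_def vector_4 vector_2 field_simps)
    then show ?thesis unfolding Q_S_def mem_Collect_eq
      by (intro exI[of _ "\<rho>/2 - 13/20"] exI[of _ "13/20"] exI[of _ "13/10"]) simp
  qed
  moreover have "test_path \<rho> \<theta> 1 \<in> Q_E1 \<theta>"
  proof -
    \<comment> \<open>Half a diameter projected on either axis at 45 degrees; e \<le> 13/20 \<le>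
      \<rho>/2 keeps the parameter \<open>c\<close> of \<open>Q_E1\<close> nonnegative.\<close>
    define e where "e = 13/20 * (sqrt 2 / 2)"
    have c: "cos (pi/4 + \<theta>) = sqrt 2 / 2 * cos \<theta> - sqrt 2 / 2 * sin \<theta>" and s: "sin (pi/4 + \<theta>) = sqrt 2 / 2 * cos \<theta> + sqrt 2 / 2 * sin \<theta>"
      by (simp_all add: cos_add sin_add cos_45 sin_45)
    have "test_path \<rho> \<theta> 1 = (vector [vector [- (\<rho>/2 + e), - e], vector [- (\<rho>/2 - e), e], vector [\<rho>/2 - e, e], vector [\<rho>/2 + e, - e]] :: config) ** R \<theta>"
      by (rule config_eqI) (simp_all add: test_path_def row_R vector_4 vector_2 c s e_def, simp_all add: field_simps)
    moreover have "0 \<le> e" "e \<le> 13/20"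
    proof -
      have "sqrt 2 \<le> sqrt (2\<^sup>2)" by (rule real_sqrt_le_mono) simp
      then show "0 \<le> e" "e \<le> 13/20" by (simp_all add: e_def)
    qed
    ultimately show ?thesis unfolding Q_E1_def mem_Collect_eq using assms
      by (intro exI[of _ e] exI[of _ "\<rho>/2 + e"] exI[of _ "\<rho>/2 - e"]) simp
  qed
  ultimately show ?thesis by (simp add: paths_def)
qed

text \<open>The terms come from the turning of the centres, the turning of the binaries, the
  potentials inside the binaries and the cross potentials. Binaries of diameter d cost d^2
  \<alpha>^2/2 + 2/d with \<alpha> = pi/4 + \<theta>; the minimum is at d^3 = 2/\<alpha>^2, so d =
  13/10 is nearly optimal at \<theta> = 0.0539 pi.\<close>

lemma test_path_action:
  assumes \<rho>: "0 < \<rho>" "845/1000 / \<rho>\<^sup>2 \<le> 315/10000"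
  shows "action (test_path \<rho> \<theta>) \<le> ennreal (\<rho>\<^sup>2 * \<theta>\<^sup>2 / 2 + 845/1000 * (pi/4 + \<theta>)\<^sup>2 + 20/13 + 4083/1000 / \<rho>)"
proof -
  let ?q = "test_path \<rho> \<theta>"
  have cv: "continuous_on UNIV (test_velocity \<rho> \<theta>)"
    unfolding test_velocity_def[abs_def] by (intro continuous_intros)
  note C1 = C1_imp_H1[OF test_path_derivative cv]
  note h = H1_imp_H1_deriv[OF C1(1)]
  note ac = action_collision_free[OF h test_path_pot(1)[OF \<rho>]]
  have "integral {0..1} (lagrangian ?q)
     \<le> integral {0..1::real} (\<lambda>t. \<rho>\<^sup>2 * \<theta>\<^sup>2 / 2 + 845/1000 * (pi/4 + \<theta>)\<^sup>2 + 20/13 + 4083/1000 / \<rho>)"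
  proof (rule integral_le)
    show "(lagrangian ?q) integrable_on {0..1}"
      by (intro integrable_add integrable_on_mult_right H1_derivD(2)[OF h] ac(1))
    show "1/2 * (norm (vector_derivative ?q (at t)))\<^sup>2 + pot (?q t)
       \<le> \<rho>\<^sup>2 * \<theta>\<^sup>2 / 2 + 845/1000 * (pi/4 + \<theta>)\<^sup>2 + 20/13 + 4083/1000 / \<rho>" for t
      unfolding C1(2) norm_test_velocity using test_path_pot(2)[OF \<rho>, of \<theta> t] by (simp add: field_simps)
  qed (rule integrable_const_ivl)
  then show ?thesis unfolding ac(2) by (intro ennreal_leI) simp
qed

text \<open>Since \<rho>^3 \<theta>^2 = 4, the rotation term is 2/\<rho>, and everything is linear
  in 1/\<rho> and (pi/4 + \<theta>)^2. From \<theta> \<le> 0.1694 follow \<rho> \<ge> 5.18 and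
  0.845/\<rho>^2 \<le> 0.0315, the bound required of the square. At the largest \<theta> the
  competitor costs less than 3.49 and a collision at least 3.58.\<close>

lemma test_action_less_collision_action:
  assumes th: "0 < \<theta>" "\<theta> \<le> 0.0539 * pi" and \<rho>: "0 < \<rho>" "\<rho> ^ 3 = 4 / \<theta>\<^sup>2"
  shows "\<theta> \<le> 1694/10000" "13/10 \<le> \<rho>" "845/1000 / \<rho>\<^sup>2 \<le> 315/10000"
    "\<rho>\<^sup>2 * \<theta>\<^sup>2 / 2 + 845/1000 * (pi/4 + \<theta>)\<^sup>2 + 20/13 + 4083/1000 / \<rho>
      < min (6 / \<rho> + 9 / (2 * (185/100))) (6 / 4 + 9 / (2 * (215/100)))"
proof -
  have pi: "pi \<le> 31416/10000" using pi_approx(2) by simp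
  show th': "\<theta> \<le> 1694/10000" using th(2) pi by simp
  have "\<theta>\<^sup>2 \<le> (1694/10000)\<^sup>2" using th th' by (intro power_mono) auto
  then have t2: "\<theta>\<^sup>2 \<le> 287/10000" by (simp add: power2_eq_square)
  have "4 / (287/10000) \<le> 4 / \<theta>\<^sup>2" using th t2 by (intro divide_left_mono) auto
  then have "(518/100) ^ 3 \<le> \<rho> ^ 3" unfolding \<rho>(2) by (simp add: power3_eq_cube)
  then have r: "518/100 \<le> \<rho>" using \<rho>(1) power_mono_iff[of "518/100" \<rho> 3] by simp
  then show "13/10 \<le> \<rho>" by simp
  have "(518/100)\<^sup>2 \<le> \<rho>\<^sup>2" using r by (intro power_mono) auto
  then show "845/1000 / \<rho>\<^sup>2 \<le> 315/10000" using \<rho>(1) by (simp add: field_simps power2_eq_square)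
  have "\<rho>\<^sup>2 * \<theta>\<^sup>2 / 2 = \<rho> ^ 3 * \<theta>\<^sup>2 / 2 / \<rho>" using \<rho>(1) by (simp add: power2_eq_square power3_eq_cube)
  also have "\<dots> = 2 / \<rho>" unfolding \<rho>(2) using th by simp
  finally have e: "\<rho>\<^sup>2 * \<theta>\<^sup>2 / 2 = 2 / \<rho>" .
  have "1 / \<rho> \<le> 1 / (518/100)" using r by (intro divide_left_mono) auto
  then have ir: "1 / \<rho> \<le> 19306/100000" by simp
  have "pi/4 + \<theta> \<le> 9549/10000" using th(2) pi by simp
  then have "(pi/4 + \<theta>)\<^sup>2 \<le> (9549/10000)\<^sup>2" using th pi_gt_zero by (intro power_mono) auto
  then have a: "(pi/4 + \<theta>)\<^sup>2 \<le> 912/1000" by (simp add: power2_eq_square)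
  define X Z where "X = 1 / \<rho>" and "Z = (pi/4 + \<theta>)\<^sup>2"
  have k: "x / \<rho> = x * X" for x by (simp add: X_def)
  have "2 / \<rho> + 845/1000 * (pi/4 + \<theta>)\<^sup>2 + 20/13 + 4083/1000 / \<rho> < 6 / \<rho> + 9 / (2 * (185/100))"
    unfolding k Z_def[symmetric] using ir a unfolding X_def[symmetric] Z_def[symmetric] by simp
  moreover have "2 / \<rho> + 845/1000 * (pi/4 + \<theta>)\<^sup>2 + 20/13 + 4083/1000 / \<rho> < 6 / 4 + 9 / (2 * (215/100))"
    unfolding k Z_def[symmetric] using ir a unfolding X_def[symmetric] Z_def[symmetric] by simp
  ultimately show "\<rho>\<^sup>2 * \<theta>\<^sup>2 / 2 + 845/1000 * (pi/4 + \<theta>)\<^sup>2 + 20/13 + 4083/1000 / \<rho>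
      < min (6 / \<rho> + 9 / (2 * (185/100))) (6 / 4 + 9 / (2 * (215/100)))"
    unfolding e by simp
qed

lemma minimizer_collision_free:
  assumes th: "0 < \<theta>" "\<theta> \<le> 0.0539 * pi" and q: "is_minimizer q Q_S (Q_E1 \<theta>)" and s: "s \<in> {0..1}"
  shows "\<not> has_collision (q s)"
proof
  assume col: "has_collision (q s)"
  define \<rho> where "\<rho> = (4 / \<theta>\<^sup>2) powr (1/3)"
  have "0 < x powr (1/3)" "(x powr (1/3)) ^ 3 = x" if "0 < x" for x :: real
    using that by (simp_all add: powr_powr flip: powr_realpow)
  from this[of "4 / \<theta>\<^sup>2"] have \<rho>: "0 < \<rho>" "\<rho> ^ 3 = 4 / \<theta>\<^sup>2" using th(1) unfolding \<rho>_def by auto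
  note num = test_action_less_collision_action[OF th \<rho>]
  let ?T = "\<rho>\<^sup>2 * \<theta>\<^sup>2 / 2 + 845/1000 * (pi/4 + \<theta>)\<^sup>2 + 20/13 + 4083/1000 / \<rho>"
  have qp: "q \<in> paths Q_S (Q_E1 \<theta>)" and qm: "action q = (INF p\<in>paths Q_S (Q_E1 \<theta>). action p)"
    using q by (auto simp: is_minimizer_def)
  have "action q \<le> action (test_path \<rho> \<theta>)"
    unfolding qm by (rule INF_lower[OF test_path_in_paths[OF num(2)]])
  also have "\<dots> \<le> ennreal ?T" by (rule test_path_action[OF \<rho>(1) num(3)])
  finally have up: "action q \<le> ennreal ?T" .
  then have fin: "action q < \<infinity>" using le_less_trans[OF up ennreal_less_top] by simp
  have h: "H1_deriv 0 1 q (\<lambda>t. vector_derivative q (at t))"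
    using qp by (intro H1_imp_H1_deriv) (auto simp: paths_def)
  note af = action_finite_imp[OF h fin]
  have "min (6 / \<rho> + 9 / (2 * (185/100))) (6 / 4 + 9 / (2 * (215/100)))
    \<le> integral {0..1} (lagrangian q)"
    by (rule collision_action_bound[OF qp th(1) num(1) af(1,2) s col \<rho>])
  then have "?T < integral {0..1} (lagrangian q)"
    using num(4) by linarith
  moreover have "0 \<le> ?T" using \<rho>(1) by simp
  ultimately have "ennreal ?T < action q" unfolding af(3) by (simp add: ennreal_less_iff)
  then show False using up by simp
qed

section \<open>The first variation\<close>

text \<open>A first-order expansion with explicit remainder, one-sided because it serves to estimate
  the action of a competitor from above. For \<open>l\<close> \<le> 1/6 one has |\<zeta>| \<le>
  13/36, inside the range of \<open>inverse_sqrt_le_quadratic\<close>, and the constant 3 exceeds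
  0.57 (13/6)^2.\<close>

lemma inverse_norm_upper:
  fixes w z :: "'a::real_inner"
  assumes "w \<noteq> 0" and z: "norm z \<le> norm w / 6"
  shows "1 / norm (w + z) \<le> 1 / norm w - (w \<bullet> z) / norm w ^ 3 + 3 * (norm z)\<^sup>2 / norm w ^ 3"
proof -
  define r where "r = norm w"
  have r: "0 < r" using assms by (simp add: r_def)
  define k where "k = (w \<bullet> z) / r\<^sup>2"
  define l where "l = norm z / r"
  define \<zeta> where "\<zeta> = 2 * k + l\<^sup>2"
  have l: "0 \<le> l" "l \<le> 1/6" using z r by (auto simp: l_def r_def field_simps)
  have "\<bar>w \<bullet> z\<bar> \<le> r * norm z" unfolding r_def by (rule Cauchy_Schwarz_ineq2)
  then have kl: "\<bar>k\<bar> \<le> l" using r by (simp add: k_def l_def abs_div power2_eq_square field_simps)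
  have l2: "l\<^sup>2 \<le> l * (1/6)" unfolding power2_eq_square using l by (intro mult_left_mono) auto
  have "\<bar>2 * k + l\<^sup>2\<bar> \<le> 2 * \<bar>k\<bar> + l\<^sup>2" using zero_le_power2[of l] by linarith
  then have zl: "\<bar>\<zeta>\<bar> \<le> 13/6 * l" using kl l2 by (simp add: \<zeta>_def)
  then have zs: "\<bar>\<zeta>\<bar> \<le> 387/1000" using l by simp
  have "(norm (w + z))\<^sup>2 = r\<^sup>2 * (1 + \<zeta>)"
    using r unfolding \<zeta>_def k_def l_def power_divide
    by (simp add: power2_norm_eq_inner inner_add r_def inner_commute field_simps)
  then have "sqrt ((norm (w + z))\<^sup>2) = sqrt (r\<^sup>2 * (1 + \<zeta>))" by simp
  then have "norm (w + z) = r * sqrt (1 + \<zeta>)" using r by (simp add: real_sqrt_mult)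
  then have "1 / norm (w + z) = (1 / sqrt (1 + \<zeta>)) / r" by (simp add: mult.commute)
  also have "\<dots> \<le> (1 - \<zeta> / 2 + 57/100 * \<zeta>\<^sup>2) / r"
    using r by (intro divide_right_mono inverse_sqrt_le_quadratic zs) auto
  also have "\<dots> \<le> (1 - k + 3 * l\<^sup>2) / r"
  proof (rule divide_right_mono)
    have "\<zeta>\<^sup>2 \<le> (13/6 * l)\<^sup>2" using zl power_mono[of "\<bar>\<zeta>\<bar>" "13/6 * l" 2] by simp
    also have "\<dots> = 169/36 * l\<^sup>2" by (simp add: power2_eq_square)
    finally have "57/100 * \<zeta>\<^sup>2 \<le> 3 * l\<^sup>2" using zero_le_power2[of l] by linarith
    moreover have "\<zeta> / 2 = k + l\<^sup>2 / 2" by (simp add: \<zeta>_def)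
    ultimately show "1 - \<zeta> / 2 + 57/100 * \<zeta>\<^sup>2 \<le> 1 - k + 3 * l\<^sup>2"
      using zero_le_power2[of l] by linarith
  qed (use r in simp)
  also have "\<dots> = 1 / r - (w \<bullet> z) / r ^ 3 + 3 * (norm z)\<^sup>2 / r ^ 3"
    using r by (simp add: k_def l_def power2_eq_square power3_eq_cube field_simps)
  finally show ?thesis by (simp add: r_def)
qed

text \<open>The acceleration of body \<open>i\<close> caused by body \<open>j\<close>. The value on
  the diagonal is 0, so sums may run over all indices and be reindexed by permutations.\<close>

definition pair_force :: "config \<Rightarrow> 4 \<Rightarrow> 4 \<Rightarrow> real^2" where
  "pair_force q i j = (q $ j - q $ i) /\<^sub>R (norm (q $ j - q $ i)) ^ 3"

lemma force_component: "force q $ i = (\<Sum>j\<in>UNIV. pair_force q i j)"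
proof -
  have "(\<Sum>j\<in>UNIV. pair_force q i j) = pair_force q i i + (\<Sum>j\<in>UNIV - {i}. pair_force q i j)"
    by (rule sum.remove) auto
  then show ?thesis by (simp add: force_def pair_force_def)
qed

lemma pair_force_swap: "pair_force q j i = - pair_force q i j"
  by (simp add: pair_force_def norm_minus_commute[of "q $ i"] flip: scaleR_minus_right)

lemma force_inner:
  "force q \<bullet> z = pair_force q 1 2 \<bullet> (z $ 1 - z $ 2) + pair_force q 1 3 \<bullet> (z $ 1 - z $ 3)
     + pair_force q 1 4 \<bullet> (z $ 1 - z $ 4) + pair_force q 2 3 \<bullet> (z $ 2 - z $ 3)
     + pair_force q 2 4 \<bullet> (z $ 2 - z $ 4) + pair_force q 3 4 \<bullet> (z $ 3 - z $ 4)"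
proof -
  have d: "pair_force q i i = 0" for i by (simp add: pair_force_def)
  show ?thesis
    unfolding inner_vec_def[of "force q" z] sum_4 force_component d
      pair_force_swap[of q 2 1] pair_force_swap[of q 3 1] pair_force_swap[of q 4 1]
      pair_force_swap[of q 3 2] pair_force_swap[of q 4 2] pair_force_swap[of q 4 3]
    by (simp add: inner_add_left inner_diff_left inner_diff_right inner_minus_left)
qed

text \<open>Each pair sees a displacement of at most 2 |z|. This turns the radius \<delta>/6 of
  \<open>inverse_norm_upper\<close> into \<delta>/12 and its constant 3 into 12 per pair, 72 for all
  six.\<close>

lemma pot_upper:
  assumes \<delta>: "0 < \<delta>" "\<And>i j. i \<noteq> j \<Longrightarrow> \<delta> \<le> norm (q $ i - q $ j)" and z: "norm z \<le> \<delta> / 12"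
  shows "\<not> has_collision (q + z)"
    and "pot (q + z) \<le> pot q + force q \<bullet> z + 72 / \<delta> ^ 3 * (norm z)\<^sup>2"
proof -
  have zij: "norm (z $ i - z $ j) \<le> 2 * norm z" for i j
    using norm_triangle_ineq4[of "z $ i" "z $ j"] Finite_Cartesian_Product.norm_nth_le[of z i] Finite_Cartesian_Product.norm_nth_le[of z j] by linarith
  have pair: "1 / norm ((q + z) $ i - (q + z) $ j) \<le> 1 / norm (q $ i - q $ j) + pair_force q i j \<bullet> (z $ i - z $ j) + 12 / \<delta> ^ 3 * (norm z)\<^sup>2"
    and nz: "(q + z) $ i \<noteq> (q + z) $ j"
    if ij: "i \<noteq> j" for i j
  proof -
    define w where "w = q $ i - q $ j"
    have w: "\<delta> \<le> norm w" using \<delta>(2)[OF ij] by (simp add: w_def)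
    have w0: "0 < norm w" using w \<delta>(1) by linarith
    have sm: "norm (z $ i - z $ j) \<le> norm w / 6" using zij[of i j] z w by linarith
    show "(q + z) $ i \<noteq> (q + z) $ j"
    proof
      assume "(q + z) $ i = (q + z) $ j"
      then have "(q $ i + z $ i) - (q $ j + z $ j) = 0" by simp
      then have "w = - (z $ i - z $ j)" by (simp add: w_def algebra_simps)
      then have "norm w = norm (z $ i - z $ j)" by (simp add: norm_minus_commute)
      then show False using sm w0 by linarith
    qed
    have "1 / norm ((q + z) $ i - (q + z) $ j) = 1 / norm (w + (z $ i - z $ j))" by (simp add: w_def algebra_simps)
    also have "\<dots> \<le> 1 / norm w - (w \<bullet> (z $ i - z $ j)) / norm w ^ 3 + 3 * (norm (z $ i - z $ j))\<^sup>2 / norm w ^ 3"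
      by (rule inverse_norm_upper[OF _ sm]) (use w0 in auto)
    also have "(w \<bullet> (z $ i - z $ j)) / norm w ^ 3 = - (pair_force q i j \<bullet> (z $ i - z $ j))"
    proof -
      have "pair_force q i j = - (w /\<^sub>R norm w ^ 3)"
        unfolding pair_force_def w_def by (simp add: norm_minus_commute flip: scaleR_minus_right)
      then show ?thesis by (simp add: divide_inverse)
    qed
    also have "3 * (norm (z $ i - z $ j))\<^sup>2 / norm w ^ 3 \<le> 12 / \<delta> ^ 3 * (norm z)\<^sup>2"
    proof -
      have "(norm (z $ i - z $ j))\<^sup>2 \<le> (2 * norm z)\<^sup>2" by (intro power_mono zij) simp
      then have "3 * (norm (z $ i - z $ j))\<^sup>2 \<le> 12 * (norm z)\<^sup>2" by (simp add: power2_eq_square)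
      then have "3 * (norm (z $ i - z $ j))\<^sup>2 / norm w ^ 3 \<le> 12 * (norm z)\<^sup>2 / \<delta> ^ 3"
        using \<delta>(1) w by (intro frac_le power_mono) auto
      then show ?thesis by simp
    qed
    finally show "1 / norm ((q + z) $ i - (q + z) $ j) \<le> 1 / norm (q $ i - q $ j) + pair_force q i j \<bullet> (z $ i - z $ j) + 12 / \<delta> ^ 3 * (norm z)\<^sup>2"
      by (simp add: w_def)
  qed
  show "\<not> has_collision (q + z)" using nz unfolding has_collision_def by blast
  have e: "72 / \<delta> ^ 3 * (norm z)\<^sup>2 = 6 * (12 / \<delta> ^ 3 * (norm z)\<^sup>2)" by simp
  show "pot (q + z) \<le> pot q + force q \<bullet> z + 72 / \<delta> ^ 3 * (norm z)\<^sup>2"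
    unfolding e pot_def force_inner
    using pair[OF distinct_4(1)] pair[OF distinct_4(2)] pair[OF distinct_4(3)]
      pair[OF distinct_4(4)] pair[OF distinct_4(5)] pair[OF distinct_4(6)] by linarith
qed

text \<open>On the compact interval \<open>pot\<close> is bounded by some \<open>K\<close>; each of
  its summands is then at most \<open>K\<close>, which bounds every distance below by 1/K.\<close>

lemma minimal_distance:
  fixes q :: "real \<Rightarrow> config"
  assumes q: "continuous_on {0..1} q" and nc: "\<And>t. t \<in> {0..1} \<Longrightarrow> \<not> has_collision (q t)"
  obtains \<delta> where "0 < \<delta>" "\<And>t i j. t \<in> {0..1} \<Longrightarrow> i \<noteq> j \<Longrightarrow> \<delta> \<le> norm (q t $ i - q t $ j)"
proof -
  have "continuous_on {0..1} (\<lambda>t. pot (q t))" by (rule pot_continuous_on[OF q nc])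
  from compact_imp_bounded[OF compact_continuous_image[OF this compact_Icc]]
  obtain K where "\<forall>x\<in>(\<lambda>t. pot (q t)) ` {0..1}. norm x \<le> K" unfolding bounded_iff by blast
  then have K: "pot (q t) \<le> K" if "t \<in> {0..1}" for t using that by force
  have "0 < pot (q 0)"
    using nc[of 0] unfolding not_has_collision_iff pot_def by (intro add_pos_nonneg) auto
  then have K0: "0 < K" using K[of 0] by simp
  have term_le: "1 / norm (p $ i - p $ j) \<le> pot p" if "i \<noteq> j" for p i j
  proof -
    define f where "f i j = 1 / norm (p $ i - p $ j)" for i j
    have nn: "0 \<le> f i j" for i j by (simp add: f_def)
    have sym: "f i j = f j i" for i j by (simp add: f_def norm_minus_commute)
    have pf: "pot p = f 1 2 + f 1 3 + f 1 4 + f 2 3 + f 2 4 + f 3 4" by (simp add: pot_def f_def)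
    have "f i j \<le> pot p"
      using that exhaust_4[of i] exhaust_4[of j] nn[of 1 2] nn[of 1 3] nn[of 1 4] nn[of 2 3] nn[of 2 4] nn[of 3 4]
      unfolding pf by (elim disjE) (simp_all add: sym[of 2 1] sym[of 3 1] sym[of 3 2] sym[of 4 1] sym[of 4 2] sym[of 4 3])
    then show ?thesis by (simp add: f_def)
  qed
  show thesis
  proof (rule that[of "1 / K"])
    show "0 < 1 / K" using K0 by simp
    fix t :: real and i j :: 4 assume t: "t \<in> {0..1}" "i \<noteq> j"
    have "0 < norm (q t $ i - q t $ j)" using nc[OF t(1)] t(2) unfolding has_collision_def by auto
    moreover have "1 / norm (q t $ i - q t $ j) \<le> K" using term_le[OF t(2), of "q t"] K[OF t(1)] by linarith
    ultimately show "1 / K \<le> norm (q t $ i - q t $ j)" using K0 by (simp add: field_simps)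
  qed
qed

lemma force_continuous_on:
  fixes q :: "'a::topological_space \<Rightarrow> config"
  assumes q: "continuous_on S q" and nc: "\<And>t. t \<in> S \<Longrightarrow> \<not> has_collision (q t)"
  shows "continuous_on S (\<lambda>t. force (q t))"
proof -
  have pf: "continuous_on S (\<lambda>t. pair_force (q t) i j)" for i j
  proof (cases "i = j")
    case False
    have nz: "\<forall>t\<in>S. norm (q t $ j - q t $ i) ^ 3 \<noteq> 0"
    proof
      fix t assume "t \<in> S"
      from nc[OF this] False have "q t $ j \<noteq> q t $ i" unfolding has_collision_def by metis
      then show "norm (q t $ j - q t $ i) ^ 3 \<noteq> 0" by simp
    qed
    have d: "continuous_on S (\<lambda>t. q t $ j - q t $ i)"
      by (intro continuous_on_diff continuous_on_component q)
    show ?thesis unfolding pair_force_def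
      by (intro continuous_on_scaleR continuous_on_inverse continuous_on_power continuous_on_norm d nz)
  qed (simp add: pair_force_def)
  have "continuous_on S (\<lambda>t. \<chi> i. \<Sum>j\<in>UNIV. pair_force (q t) i j)"
    by (intro continuous_on_vec_lambda continuous_on_sum pf)
  moreover have "force (q t) = (\<chi> i. \<Sum>j\<in>UNIV. pair_force (q t) i j)" for t
    by (simp add: vec_eq_iff force_component)
  ultimately show ?thesis by simp
qed

text \<open>The competitor differs from \<open>q\<close> by \<open>\<epsilon> (c q + \<psi>)\<close>; taking \<open>\<psi>\<close> differentiable, it is
  differentiable wherever \<open>q\<close> is.\<close>

lemma H1_affine:
  fixes q \<psi> :: "real \<Rightarrow> 'a::euclidean_space" and a :: real
  assumes q: "q \<in> H1" and h\<psi>: "H1_deriv 0 1 \<psi> \<psi>'"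
    and \<psi>: "\<And>t. 0 < t \<Longrightarrow> t < 1 \<Longrightarrow> (\<psi> has_vector_derivative \<psi>' t) (at t)"
  defines "p \<equiv> \<lambda>t. a *\<^sub>R q t + \<psi> t"
  shows "p \<in> H1"
    and "negligible {t\<in>{0..1}. vector_derivative p (at t) \<noteq> a *\<^sub>R vector_derivative q (at t) + \<psi>' t}"
proof -
  let ?M = "lebesgue_on {0..1::real}"
  let ?v = "\<lambda>t. vector_derivative q (at t)"
  have h: "H1_deriv 0 1 p (\<lambda>t. a *\<^sub>R ?v t + \<psi>' t)"
    unfolding p_def
    by (intro H1_deriv_add h\<psi> H1_deriv_linear[OF H1_imp_H1_deriv[OF q] bounded_linear_scaleR_right])
  have ends: "AE t in ?M. t \<noteq> 0 \<and> t \<noteq> 1"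
  proof -
    have "AE t in lebesgue. t \<noteq> (0::real) \<and> t \<noteq> 1"
      by (rule AE_I'[of "{0, 1}"]) (auto simp flip: negligible_iff_null_sets)
    then show ?thesis by (subst AE_restrict_space_iff) auto
  qed
  have qd: "AE t in ?M. q differentiable (at t)" using q by (simp add: H1_def)
  have sp: "AE t in ?M. t \<in> space ?M" by (rule AE_space)
  have ae: "AE t in ?M. (p has_vector_derivative a *\<^sub>R ?v t + \<psi>' t) (at t)"
    using qd ends sp
  proof eventually_elim
    case (elim t)
    then have "0 < t" "t < 1" by auto
    moreover have "(q has_vector_derivative ?v t) (at t)"
      using elim vector_derivative_works by blast
    ultimately show ?case unfolding p_def
      by (intro has_vector_derivative_add \<psi> bounded_linear.has_vector_derivative[OF bounded_linear_scaleR_right])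
  qed
  have ae2: "AE t in ?M. vector_derivative p (at t) = a *\<^sub>R ?v t + \<psi>' t"
    using ae by eventually_elim (rule vector_derivative_at)
  from negligible_of_AE[OF this]
  show neg: "negligible {t\<in>{0..1}. vector_derivative p (at t) \<noteq> a *\<^sub>R ?v t + \<psi>' t}" .
  have m: "(\<lambda>t. vector_derivative p (at t)) \<in> borel_measurable ?M"
  proof -
    have "(\<lambda>t. if t \<in> {0..1} then a *\<^sub>R ?v t + \<psi>' t else 0) \<in> borel_measurable lebesgue"
      using H1_derivD(1)[OF h] by (subst borel_measurable_if) auto
    moreover have "AE t in lebesgue. (if t \<in> {0..1} then a *\<^sub>R ?v t + \<psi>' t else 0) =
        (if t \<in> {0..1} then vector_derivative p (at t) else 0)"
      using ae2 by (subst (asm) AE_restrict_space_iff) (auto elim!: eventually_mono)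
    ultimately have "(\<lambda>t. if t \<in> {0..1} then vector_derivative p (at t) else 0) \<in> borel_measurable lebesgue"
      by (rule borel_measurable_AE)
    then show ?thesis by (subst (asm) borel_measurable_if) auto
  qed
  have d: "AE t in ?M. p differentiable (at t)"
    using ae by eventually_elim (rule differentiableI_vector)
  have i: "integrable ?M (\<lambda>t. (norm (vector_derivative p (at t)))\<^sup>2)"
  proof -
    have "(\<lambda>t. (norm (a *\<^sub>R ?v t + \<psi>' t))\<^sup>2) absolutely_integrable_on {0..1}"
      by (rule nonnegative_absolutely_integrable_1[OF H1_derivD(2)[OF h]]) simp
    then have "integrable ?M (\<lambda>t. (norm (a *\<^sub>R ?v t + \<psi>' t))\<^sup>2)"
      by (subst integrable_lebesgue_on_iff) auto
    then show ?thesis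
    proof (rule integrable_cong_AE_imp)
      show "(\<lambda>t. (norm (vector_derivative p (at t)))\<^sup>2) \<in> borel_measurable ?M" using m by measurable
      show "AE t in ?M. (norm (a *\<^sub>R ?v t + \<psi>' t))\<^sup>2 = (norm (vector_derivative p (at t)))\<^sup>2"
        using ae2 by eventually_elim simp
    qed
  qed
  have "((\<lambda>s. vector_derivative p (at s)) has_integral (p t - p 0)) {0..t}" if t: "t \<in> {0..1}" for t
  proof -
    have f: "((\<lambda>t. a *\<^sub>R ?v t + \<psi>' t) has_integral (p t - p 0)) {0..t}"
      using h t by (simp add: H1_deriv_def)
    show ?thesis by (rule has_integral_spike[OF neg _ f]) (use t in auto)
  qed
  then show "p \<in> H1" unfolding H1_def using d m i by blast
qed

lemma zero_of_quadratic_nonneg: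
  fixes L M e :: real
  assumes e: "0 < e" and ge: "\<And>\<epsilon>. \<bar>\<epsilon>\<bar> < e \<Longrightarrow> 0 \<le> \<epsilon> * L + \<epsilon>\<^sup>2 * M"
  shows "L = 0"
proof (rule ccontr)
  assume L: "L \<noteq> 0"
  \<comment> \<open>The test value is \<epsilon> = - L k; the first bound gives k M < 1, the second
    |\<epsilon>| < e.\<close>
  define k where "k = min (1 / (2 * (\<bar>M\<bar> + 1))) (e / (2 * \<bar>L\<bar>))"
  have k: "0 < k" using e L by (simp add: k_def)
  have kM: "k * M < 1"
  proof -
    have "k * M \<le> k * (\<bar>M\<bar> + 1)" using k by (intro mult_left_mono) auto
    also have "\<dots> \<le> 1 / (2 * (\<bar>M\<bar> + 1)) * (\<bar>M\<bar> + 1)" by (intro mult_right_mono) (auto simp: k_def)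
    also have "\<dots> = 1/2" by (simp add: field_simps)
    finally show ?thesis by simp
  qed
  have "\<bar>L\<bar> * k \<le> \<bar>L\<bar> * (e / (2 * \<bar>L\<bar>))" by (intro mult_left_mono) (auto simp: k_def)
  also have "\<dots> < e" using L e by simp
  finally have "\<bar>- (L * k)\<bar> < e" using k by (simp add: abs_mult)
  from ge[OF this] have "0 \<le> L\<^sup>2 * k * (k * M - 1)" by (simp add: power2_eq_square algebra_simps)
  moreover have "0 < L\<^sup>2 * k" using L k by simp
  ultimately show False using kM by (simp add: zero_le_mult_iff)
qed

text \<open>In the direction \<eta> = c q + \<psi> the action of q + \<epsilon> \<eta> is at most E0
  + \<epsilon> L + \<epsilon>^2 M, so minimality makes \<epsilon> L + \<epsilon>^2 M nonnegative
  near 0, and L vanishes. The multiple c q admits test directions that contain the rough path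
  itself.\<close>

lemma first_variation:
  fixes q \<psi> :: "real \<Rightarrow> config"
  defines "v \<equiv> \<lambda>t. vector_derivative q (at t)"
  assumes q: "q \<in> H1" and nc: "\<And>t. t \<in> {0..1} \<Longrightarrow> \<not> has_collision (q t)"
    and h\<psi>: "H1_deriv 0 1 \<psi> \<psi>'"
    and \<psi>: "\<And>t. 0 < t \<Longrightarrow> t < 1 \<Longrightarrow> (\<psi> has_vector_derivative \<psi>' t) (at t)"
    and e0: "0 < e0"
    and min: "\<And>\<epsilon>. \<bar>\<epsilon>\<bar> < e0 \<Longrightarrow> action q \<le> action (\<lambda>t. (1 + \<epsilon> * c) *\<^sub>R q t + \<epsilon> *\<^sub>R \<psi> t)"
  shows "((\<lambda>t. v t \<bullet> (c *\<^sub>R v t + \<psi>' t) + force (q t) \<bullet> (c *\<^sub>R q t + \<psi> t)) has_integral 0) {0..1}"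
proof -
  have h: "H1_deriv 0 1 q v" unfolding v_def by (rule H1_imp_H1_deriv[OF q])
  have qc: "continuous_on {0..1} q" by (rule H1_deriv_continuous[OF h])
  define \<eta> \<eta>' where "\<eta> t = c *\<^sub>R q t + \<psi> t" and "\<eta>' t = c *\<^sub>R v t + \<psi>' t" for t
  have h\<eta>: "H1_deriv 0 1 \<eta> \<eta>'"
    unfolding \<eta>_def \<eta>'_def by (intro H1_deriv_add h\<psi> H1_deriv_linear[OF h bounded_linear_scaleR_right])
  have \<eta>c: "continuous_on {0..1} \<eta>" by (rule H1_deriv_continuous[OF h\<eta>])
  obtain \<delta> where \<delta>: "0 < \<delta>" "\<And>t i j. t \<in> {0..1} \<Longrightarrow> i \<noteq> j \<Longrightarrow> \<delta> \<le> norm (q t $ i - q t $ j)"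
    using minimal_distance[OF qc nc] by blast
  obtain B where "\<forall>x\<in>\<eta> ` {0..1}. norm x \<le> B"
    using compact_imp_bounded[OF compact_continuous_image[OF \<eta>c compact_Icc]] unfolding bounded_iff by blast
  then have B: "norm (\<eta> t) \<le> B" if "t \<in> {0..1}" for t using that by blast
  have B0: "0 \<le> B" using B[of 0] norm_ge_zero[of "\<eta> 0"] by (simp del: norm_ge_zero)
  \<comment> \<open>Keeps |\<epsilon> \<eta>| within the radius \<delta>/12 of
    \<open>pot_upper\<close>, so the competitors are collision-free.\<close>
  define e1 where "e1 = min e0 (\<delta> / (12 * (B + 1)))"
  have e1: "0 < e1" using e0 \<delta>(1) B0 by (simp add: e1_def)
  have vi: "(\<lambda>t. v t \<bullet> \<eta>' t) integrable_on {0..1}"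
    by (intro set_lebesgue_integral_eq_integral(1)[OF inner_L2_abs_integrable] H1_derivD[OF h] H1_derivD[OF h\<eta>])
  have Fi: "(\<lambda>t. force (q t) \<bullet> \<eta> t) integrable_on {0..1}"
    by (intro integrable_continuous_real continuous_on_inner force_continuous_on qc nc \<eta>c)
  note Li = integrable_add[OF vi Fi]
  define L where "L = integral {0..1} (\<lambda>t. v t \<bullet> \<eta>' t + force (q t) \<bullet> \<eta> t)"
  have Mi: "(\<lambda>t. 1/2 * (norm (\<eta>' t))\<^sup>2 + 72 / \<delta> ^ 3 * (norm (\<eta> t))\<^sup>2) integrable_on {0..1}"
    by (intro integrable_add integrable_on_mult_right H1_derivD[OF h\<eta>] continuous_norm_square_integrable \<eta>c)
  define M where "M = integral {0..1} (\<lambda>t. 1/2 * (norm (\<eta>' t))\<^sup>2 + 72 / \<delta> ^ 3 * (norm (\<eta> t))\<^sup>2)"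
  note aq = action_collision_free[OF H1_imp_H1_deriv[OF q] nc, folded v_def]
  have E0i: "(\<lambda>t. 1/2 * (norm (v t))\<^sup>2 + pot (q t)) integrable_on {0..1}"
    by (intro integrable_add integrable_on_mult_right H1_derivD[OF h] aq(1))
  define E0 where "E0 = integral {0..1} (\<lambda>t. 1/2 * (norm (v t))\<^sup>2 + pot (q t))"
  have E0: "0 \<le> E0" unfolding E0_def by (rule integral_nonneg[OF E0i]) (simp add: pot_nonneg)
  have "0 \<le> \<epsilon> * L + \<epsilon>\<^sup>2 * M" if \<epsilon>: "\<bar>\<epsilon>\<bar> < e1" for \<epsilon>
  proof -
    define p where "p t = (1 + \<epsilon> * c) *\<^sub>R q t + \<epsilon> *\<^sub>R \<psi> t" for t
    have p_eq: "p t = q t + \<epsilon> *\<^sub>R \<eta> t" for t by (simp add: p_def \<eta>_def algebra_simps)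
    have h\<psi>\<epsilon>: "H1_deriv 0 1 (\<lambda>t. \<epsilon> *\<^sub>R \<psi> t) (\<lambda>t. \<epsilon> *\<^sub>R \<psi>' t)"
      by (rule H1_deriv_linear[OF h\<psi> bounded_linear_scaleR_right])
    have pd: "((\<lambda>t. \<epsilon> *\<^sub>R \<psi> t) has_vector_derivative \<epsilon> *\<^sub>R \<psi>' t) (at t)" if "0 < t" "t < 1" for t
      by (rule bounded_linear.has_vector_derivative[OF bounded_linear_scaleR_right \<psi>[OF that]])
    note aff = H1_affine[OF q h\<psi>\<epsilon> pd, of "1 + \<epsilon> * c", folded p_def]
    have pH: "p \<in> H1" using aff(1) by (simp add: p_def[abs_def])
    let ?N = "{t\<in>{0..1}. vector_derivative p (at t) \<noteq> (1 + \<epsilon> * c) *\<^sub>R vector_derivative q (at t) + \<epsilon> *\<^sub>R \<psi>' t}"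
    have neg: "negligible ?N" using aff(2) by (simp add: p_def[abs_def])
    have small: "norm (\<epsilon> *\<^sub>R \<eta> t) \<le> \<delta> / 12" if t: "t \<in> {0..1}" for t
    proof -
      have "\<bar>\<epsilon>\<bar> * norm (\<eta> t) \<le> \<delta> / (12 * (B + 1)) * (B + 1)"
        using \<epsilon> B[OF t] B0 \<delta>(1) by (intro mult_mono) (auto simp: e1_def)
      also have "\<dots> = \<delta> / 12" using B0 by (simp add: field_simps)
      finally show ?thesis by simp
    qed
    have pnc: "\<not> has_collision (p t)" if "t \<in> {0..1}" for t
      unfolding p_eq by (rule pot_upper(1)[OF \<delta>(1) \<delta>(2)[OF that] small[OF that]])
    note ap = action_collision_free[OF H1_imp_H1_deriv[OF pH] pnc]
    have Epi: "(lagrangian p) integrable_on {0..1}"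
      by (intro integrable_add integrable_on_mult_right H1_derivD[OF H1_imp_H1_deriv[OF pH]] ap(1))
    have I: "((\<lambda>t. (1/2 * (norm (v t))\<^sup>2 + pot (q t)) + \<epsilon> * (v t \<bullet> \<eta>' t + force (q t) \<bullet> \<eta> t)
         + \<epsilon>\<^sup>2 * (1/2 * (norm (\<eta>' t))\<^sup>2 + 72 / \<delta> ^ 3 * (norm (\<eta> t))\<^sup>2)) has_integral (E0 + \<epsilon> * L + \<epsilon>\<^sup>2 * M)) {0..1}"
      unfolding E0_def L_def M_def
      by (intro has_integral_add has_integral_mult_right integrable_integral E0i Li Mi)
    have "action q \<le> action p" unfolding p_def using \<epsilon> by (intro min) (simp add: e1_def)
    moreover have "action q = ennreal E0" using aq(2) by (simp add: E0_def v_def)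
    ultimately have "ennreal E0 \<le> ennreal (integral {0..1} (lagrangian p))"
      using ap(2) by simp
    then have "E0 \<le> integral {0..1} (lagrangian p)"
      by (subst (asm) ennreal_le_iff) (rule integral_nonneg[OF Epi], simp_all add: pot_nonneg)
    also have "\<dots> \<le> integral {0..1} (\<lambda>t. (1/2 * (norm (v t))\<^sup>2 + pot (q t)) + \<epsilon> * (v t \<bullet> \<eta>' t + force (q t) \<bullet> \<eta> t)
         + \<epsilon>\<^sup>2 * (1/2 * (norm (\<eta>' t))\<^sup>2 + 72 / \<delta> ^ 3 * (norm (\<eta> t))\<^sup>2))"
    proof (rule integral_mono_negligible[OF Epi has_integral_integrable[OF I] neg])
      fix t assume t: "t \<in> {0..1}" "t \<notin> ?N"
      have "vector_derivative p (at t) = v t + \<epsilon> *\<^sub>R \<eta>' t"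
        using t by (simp add: v_def \<eta>'_def algebra_simps)
      then have 1: "(norm (vector_derivative p (at t)))\<^sup>2 = (norm (v t))\<^sup>2 + 2 * \<epsilon> * (v t \<bullet> \<eta>' t) + \<epsilon>\<^sup>2 * (norm (\<eta>' t))\<^sup>2"
        unfolding power2_norm_eq_inner
        by (simp add: inner_add inner_commute power2_eq_square algebra_simps)
      have "pot (p t) \<le> pot (q t) + force (q t) \<bullet> (\<epsilon> *\<^sub>R \<eta> t) + 72 / \<delta> ^ 3 * (norm (\<epsilon> *\<^sub>R \<eta> t))\<^sup>2"
        unfolding p_eq by (rule pot_upper(2)[OF \<delta>(1) \<delta>(2)[OF t(1)] small[OF t(1)]])
      then have 2: "pot (p t) \<le> pot (q t) + \<epsilon> * (force (q t) \<bullet> \<eta> t) + \<epsilon>\<^sup>2 * (72 / \<delta> ^ 3 * (norm (\<eta> t))\<^sup>2)"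
        by (simp add: power_mult_distrib mult.left_commute)
      show "1/2 * (norm (vector_derivative p (at t)))\<^sup>2 + pot (p t) \<le> (1/2 * (norm (v t))\<^sup>2 + pot (q t))
        + \<epsilon> * (v t \<bullet> \<eta>' t + force (q t) \<bullet> \<eta> t) + \<epsilon>\<^sup>2 * (1/2 * (norm (\<eta>' t))\<^sup>2 + 72 / \<delta> ^ 3 * (norm (\<eta> t))\<^sup>2)"
        using 2 unfolding 1 by (simp add: algebra_simps)
    qed
    also have "\<dots> = E0 + \<epsilon> * L + \<epsilon>\<^sup>2 * M" by (rule integral_unique[OF I])
    finally show ?thesis by simp
  qed
  then have "L = 0" by (rule zero_of_quadratic_nonneg[OF e1])
  then show ?thesis using integrable_integral[OF Li] unfolding L_def \<eta>_def \<eta>'_def by simp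
qed

section \<open>Minimizers solve Newton's equations\<close>

lemma S_config_affine: "S_config a b c + \<epsilon> *\<^sub>R S_config a' b' c' = S_config (a + \<epsilon> * a') (b + \<epsilon> * b') (c + \<epsilon> * c')"
  by (rule config_eqI) (simp_all add: S_config_components field_simps)

lemma E_config_affine: "E_config \<theta> a b c + \<epsilon> *\<^sub>R E_config \<theta> a' b' c' = E_config \<theta> (a + \<epsilon> * a') (b + \<epsilon> * b') (c + \<epsilon> * c')"
  by (rule config_eqI) (simp_all add: E_config_components algebra_simps)

lemma S_config_chi: "S_config a b c \<in> chi"
  unfolding chi_iff by (simp add: S_config_components field_simps)

lemma E_config_chi: "E_config \<theta> a b c \<in> chi"
  unfolding chi_iff by (simp add: E_config_components)

lemma small_perturbation_nonneg:
  fixes b b' :: real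
  assumes "0 < b"
  shows "\<exists>e>0. \<forall>\<epsilon>. \<bar>\<epsilon>\<bar> < e \<longrightarrow> 0 \<le> b + \<epsilon> * b'"
proof (intro exI conjI allI impI)
  show "0 < b / (\<bar>b'\<bar> + 1)" using assms by simp
  fix \<epsilon> assume e: "\<bar>\<epsilon>\<bar> < b / (\<bar>b'\<bar> + 1)"
  have "\<bar>\<epsilon> * b'\<bar> \<le> \<bar>\<epsilon>\<bar> * (\<bar>b'\<bar> + 1)" unfolding abs_mult by (intro mult_left_mono) auto
  also have "\<dots> \<le> b" using e by (simp add: field_simps)
  finally show "0 \<le> b + \<epsilon> * b'" by linarith
qed

text \<open>If \<open>b0\<close> or \<open>c0\<close> were 0, two bodies would coincide. So both
  inequalities are strict, variations of either sign stay in \<open>Q_S\<close>, and the first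
  variation gives an equation rather than an inequality.\<close>

lemma Q_S_perturbation:
  assumes "q \<in> Q_S" "\<not> has_collision q"
  shows "\<exists>e>0. \<forall>\<epsilon>. \<bar>\<epsilon>\<bar> < e \<longrightarrow> q + \<epsilon> *\<^sub>R S_config a b c \<in> Q_S"
proof -
  from assms obtain a0 b0 c0 where q: "q = S_config a0 b0 c0" "0 \<le> b0" "0 \<le> c0" by (auto simp: Q_S_iff)
  have "b0 \<noteq> 0"
  proof
    assume "b0 = 0" then have "q $ 3 = q $ 4" by (simp add: q vec_eq_iff forall_2 S_config_components)
    then show False using assms(2) not_has_collision_iff by blast
  qed
  moreover have "c0 \<noteq> 0"
  proof
    assume "c0 = 0" then have "q $ 1 = q $ 2" by (simp add: q vec_eq_iff forall_2 S_config_components)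
    then show False using assms(2) not_has_collision_iff by blast
  qed
  ultimately obtain e1 e2 where e: "0 < e1" "\<And>\<epsilon>. \<bar>\<epsilon>\<bar> < e1 \<Longrightarrow> 0 \<le> b0 + \<epsilon> * b" "0 < e2" "\<And>\<epsilon>. \<bar>\<epsilon>\<bar> < e2 \<Longrightarrow> 0 \<le> c0 + \<epsilon> * c"
    using small_perturbation_nonneg[of b0 b] small_perturbation_nonneg[of c0 c] q by force
  show ?thesis
  proof (intro exI conjI allI impI)
    show "0 < min e1 e2" using e by simp
    fix \<epsilon> assume "\<bar>\<epsilon>\<bar> < min e1 e2"
    then have "0 \<le> b0 + \<epsilon> * b" "0 \<le> c0 + \<epsilon> * c" using e by auto
    then show "q + \<epsilon> *\<^sub>R S_config a b c \<in> Q_S" unfolding q(1) S_config_affine Q_S_iff by blast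
  qed
qed

lemma Q_E1_perturbation:
  assumes "q \<in> Q_E1 \<theta>" "\<not> has_collision q"
  shows "\<exists>e>0. \<forall>\<epsilon>. \<bar>\<epsilon>\<bar> < e \<longrightarrow> q + \<epsilon> *\<^sub>R E_config \<theta> a b c \<in> Q_E1 \<theta>"
proof -
  from assms obtain a0 b0 c0 where q: "q = E_config \<theta> a0 b0 c0" "0 \<le> b0" "0 \<le> c0" by (auto simp: Q_E1_iff)
  have "b0 \<noteq> 0"
  proof
    assume "b0 = 0" then have "q $ 1 = q $ 4" by (simp add: q vec_eq_iff forall_2 E_config_components)
    then show False using assms(2) not_has_collision_iff by blast
  qed
  moreover have "c0 \<noteq> 0"
  proof
    assume "c0 = 0" then have "q $ 2 = q $ 3" by (simp add: q vec_eq_iff forall_2 E_config_components)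
    then show False using assms(2) not_has_collision_iff by blast
  qed
  ultimately obtain e1 e2 where e: "0 < e1" "\<And>\<epsilon>. \<bar>\<epsilon>\<bar> < e1 \<Longrightarrow> 0 \<le> b0 + \<epsilon> * b" "0 < e2" "\<And>\<epsilon>. \<bar>\<epsilon>\<bar> < e2 \<Longrightarrow> 0 \<le> c0 + \<epsilon> * c"
    using small_perturbation_nonneg[of b0 b] small_perturbation_nonneg[of c0 c] q by force
  show ?thesis
  proof (intro exI conjI allI impI)
    show "0 < min e1 e2" using e by simp
    fix \<epsilon> assume "\<bar>\<epsilon>\<bar> < min e1 e2"
    then have "0 \<le> b0 + \<epsilon> * b" "0 \<le> c0 + \<epsilon> * c" using e by auto
    then show "q + \<epsilon> *\<^sub>R E_config \<theta> a b c \<in> Q_E1 \<theta>" unfolding q(1) E_config_affine Q_E1_iff by blast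
  qed
qed

definition row_sum :: "config \<Rightarrow> real^2" where
  "row_sum q = (\<Sum>i\<in>UNIV. q $ i)"

lemma chi_row_sum: "q \<in> chi \<longleftrightarrow> row_sum q = 0" by (simp add: chi_def row_sum_def)

lemma bounded_linear_row_sum: "bounded_linear row_sum"
  unfolding row_sum_def[abs_def] by (intro bounded_linear_sum bounded_linear_vec_nth)

lemma row_sum_force: "row_sum (force q) = 0"
  unfolding row_sum_def force_component sum_4
    pair_force_swap[of q 2 1] pair_force_swap[of q 3 1] pair_force_swap[of q 4 1]
    pair_force_swap[of q 3 2] pair_force_swap[of q 4 2] pair_force_swap[of q 4 3]
  by (simp add: pair_force_def[of q 1 1] pair_force_def[of q 2 2] pair_force_def[of q 3 3] pair_force_def[of q 4 4])

text \<open>Testing with the difference of \<open>q\<close> and the solution \<open>y\<close> of \<open>y'' = force (q t)\<close> with the same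
  end points shows that the two coincide.\<close>

lemma minimizer_is_solution:
  fixes q :: "real \<Rightarrow> config"
  assumes th: "0 < \<theta>" "\<theta> \<le> 0.0539 * pi" and qmin: "is_minimizer q Q_S (Q_E1 \<theta>)"
  obtains u where "\<And>t. t \<in> {0..1} \<Longrightarrow> (q has_vector_derivative u t) (at t within {0..1})"
    "\<And>t. t \<in> {0..1} \<Longrightarrow> (u has_vector_derivative force (q t)) (at t within {0..1})"
    "\<And>t. t \<in> {0..1} \<Longrightarrow> u t \<in> chi"
    "\<And>a b c. u 0 \<bullet> S_config a b c = 0" "\<And>a b c. u 1 \<bullet> E_config \<theta> a b c = 0"
proof -
  let ?v = "\<lambda>t. vector_derivative q (at t)"
  have nc: "\<not> has_collision (q t)" if "t \<in> {0..1}" for t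
    by (rule minimizer_collision_free[OF th qmin that])
  have qp: "q \<in> paths Q_S (Q_E1 \<theta>)" and qm: "action q = (INF p\<in>paths Q_S (Q_E1 \<theta>). action p)"
    using qmin by (auto simp: is_minimizer_def)
  have qH: "q \<in> H1" and qchi: "\<And>t. t \<in> {0..1} \<Longrightarrow> row_sum (q t) = 0" and q0: "q 0 \<in> Q_S" and q1: "q 1 \<in> Q_E1 \<theta>"
    using qp by (auto simp: paths_def chi_row_sum)
  have min: "action q \<le> action p" if "p \<in> paths Q_S (Q_E1 \<theta>)" for p
    unfolding qm by (rule INF_lower[OF that])
  have h: "H1_deriv 0 1 q ?v" by (rule H1_imp_H1_deriv[OF qH])
  have qc: "continuous_on {0..1} q" by (rule H1_deriv_continuous[OF h])
  interpret T: bounded_linear row_sum by (rule bounded_linear_row_sum)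
  define F where "F t = force (q t)" for t
  have Fc: "continuous_on {0..1} F" unfolding F_def by (rule force_continuous_on[OF qc nc])
  define G where "G t = integral {0..t} F" for t
  have dG: "(G has_vector_derivative F t) (at t within {0..1})" if "t \<in> {0..1}" for t
    unfolding G_def by (rule integral_has_vector_derivative[OF Fc that])
  have Gc: "continuous_on {0..1} G"
    by (rule continuous_on_vector_derivative[OF dG])
  \<comment> \<open>The initial velocity with which the solution of y'' = F starting at
    \<open>q 0\<close> reaches \<open>q 1\<close> at t = 1.\<close>
  define m where "m = q 1 - q 0 - integral {0..1} G"
  define u where "u t = m + G t" for t
  define y where "y t = q 0 + t *\<^sub>R m + integral {0..t} G" for t
  have du: "(u has_vector_derivative F t) (at t within {0..1})" if "t \<in> {0..1}" for t
    unfolding u_def using has_vector_derivative_add[OF has_vector_derivative_const dG[OF that]] by simp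
  have uc: "continuous_on {0..1} u" by (rule continuous_on_vector_derivative[OF du])
  have dy: "(y has_vector_derivative u t) (at t within {0..1})" if t: "t \<in> {0..1}" for t
  proof -
    have "((\<lambda>t. t *\<^sub>R m) has_vector_derivative 1 *\<^sub>R m) (at t within {0..1})"
      using has_vector_derivative_scaleR[OF DERIV_ident has_vector_derivative_const[of m], of t "{0..1}"] by simp
    from has_vector_derivative_add[OF has_vector_derivative_add[OF has_vector_derivative_const this]
      integral_has_vector_derivative[OF Gc t]]
    show ?thesis unfolding y_def u_def by simp
  qed
  have hu: "H1_deriv 0 1 u F" by (rule H1_deriv_C1[OF du Fc])
  have hy: "H1_deriv 0 1 y u" by (rule H1_deriv_C1[OF dy uc])
  have y0: "y 0 = q 0" and y1: "y 1 = q 1" by (simp_all add: y_def m_def)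
  have at_in: "at t within {0..1} = at t" if "0 < t" "t < 1" for t :: real
    using that by (intro at_within_interior) simp
  \<comment> \<open>The forces add up to zero, so \<open>y\<close> stays in \<open>chi\<close> and
    the competitors built from it are admissible.\<close>
  have Gt: "row_sum (G t) = 0" if "t \<in> {0..1}" for t
  proof -
    have "F integrable_on {0..t}"
      using that by (intro integrable_continuous_real continuous_on_subset[OF Fc]) auto
    from integral_linear[OF this bounded_linear_row_sum]
    show ?thesis by (simp add: G_def o_def F_def row_sum_force)
  qed
  have IG: "row_sum (integral {0..t} G) = 0" if t: "t \<in> {0..1}" for t
  proof -
    have "G integrable_on {0..t}"
      using t by (intro integrable_continuous_real continuous_on_subset[OF Gc]) auto
    from integral_linear[OF this bounded_linear_row_sum]
    have "row_sum (integral {0..t} G) = integral {0..t} (\<lambda>s. row_sum (G s))" by (simp add: o_def)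
    also have "\<dots> = integral {0..t} (\<lambda>s. 0)" using t by (intro integral_cong Gt) auto
    finally show ?thesis by simp
  qed
  have mt: "row_sum m = 0" unfolding m_def T.diff using IG[of 1] qchi[of 0] qchi[of 1] by simp
  have uchi: "u t \<in> chi" if "t \<in> {0..1}" for t
    unfolding chi_row_sum u_def T.add using mt Gt[OF that] by simp
  have ychi: "row_sum (y t) = 0" if "t \<in> {0..1}" for t
    unfolding y_def T.add T.scaleR using mt IG[OF that] qchi[of 0] by simp
  have yq: "q t = y t" if t: "t \<in> {0..1}" for t
  proof -
    have hn: "H1_deriv 0 1 (\<lambda>t. - y t) (\<lambda>t. - u t)"
      by (rule H1_deriv_linear[OF hy bounded_linear_minus[OF bounded_linear_ident]])
    have dn: "((\<lambda>t. - y t) has_vector_derivative - u t) (at t)" if "0 < t" "t < 1" for t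
      using has_vector_derivative_minus[OF dy[of t]] that by (simp add: at_in)
    have "((\<lambda>t. ?v t \<bullet> (1 *\<^sub>R ?v t + - u t) + force (q t) \<bullet> (1 *\<^sub>R q t + - y t)) has_integral 0) {0..1}"
    proof (rule first_variation[OF qH nc hn dn zero_less_one])
      fix \<epsilon> :: real
      have hn': "H1_deriv 0 1 (\<lambda>t. \<epsilon> *\<^sub>R - y t) (\<lambda>t. \<epsilon> *\<^sub>R - u t)"
        by (rule H1_deriv_linear[OF hn bounded_linear_scaleR_right])
      have "((\<lambda>t. \<epsilon> *\<^sub>R - y t) has_vector_derivative \<epsilon> *\<^sub>R - u t) (at t)" if "0 < t" "t < 1" for t
        by (rule bounded_linear.has_vector_derivative[OF bounded_linear_scaleR_right dn[OF that]])
      note H1_affine(1)[OF qH hn' this, of "1 + \<epsilon> * 1"]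
      moreover have "(1 + \<epsilon> * 1) *\<^sub>R q t + \<epsilon> *\<^sub>R - y t \<in> chi" if "t \<in> {0..1}" for t
        unfolding chi_row_sum T.add T.scaleR linear_neg[OF bounded_linear.linear[OF bounded_linear_row_sum]] qchi[OF that] ychi[OF that] by simp
      moreover have "(1 + \<epsilon> * 1) *\<^sub>R q 0 + \<epsilon> *\<^sub>R - y 0 = q 0" "(1 + \<epsilon> * 1) *\<^sub>R q 1 + \<epsilon> *\<^sub>R - y 1 = q 1"
        by (simp_all add: y0 y1 algebra_simps)
      ultimately show "action q \<le> action (\<lambda>t. (1 + \<epsilon> * 1) *\<^sub>R q t + \<epsilon> *\<^sub>R - y t)"
        using q0 q1 by (intro min) (simp add: paths_def)
    qed
    then have A: "((\<lambda>t. ?v t \<bullet> (?v t - u t) + F t \<bullet> (q t - y t)) has_integral 0) {0..1}"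
      by (simp add: F_def)
    have hd: "H1_deriv 0 1 (\<lambda>t. q t - y t) (\<lambda>t. ?v t - u t)" by (rule H1_deriv_diff[OF h hy])
    have "((\<lambda>t. F t \<bullet> (q t - y t) + u t \<bullet> (?v t - u t)) has_integral 0) {0..1}"
      using H1_deriv_inner[OF hu hd] by (simp add: y0 y1)
    \<comment> \<open>The weak equation minus the integration by parts of \<open>u\<close> against q
      - y: the force terms cancel, and |v - u|^2 has integral 0.\<close>
    from has_integral_diff[OF A this] have "((\<lambda>t. (norm (?v t - u t))\<^sup>2) has_integral 0) {0..1}"
      by (simp add: power2_norm_eq_inner inner_diff inner_commute algebra_simps)
    then have E: "integral {0..1} (\<lambda>t. (norm (?v t - u t))\<^sup>2) = 0" by (rule integral_unique)
    have "(norm ((q t - y t) - (q 0 - y 0)))\<^sup>2 \<le> 0"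
      using H1_deriv_increment_energy[OF hd, of 0 t] t unfolding E by simp
    then show ?thesis by (simp add: y0)
  qed
  have dq: "(q has_vector_derivative u t) (at t within {0..1})" if t: "t \<in> {0..1}" for t
    by (rule has_vector_derivative_transform[OF t yq dy[OF t]])
  have vu: "?v t = u t" if "0 < t" "t < 1" for t
    using dq[of t] that by (intro vector_derivative_at) (simp add: at_in)
  \<comment> \<open>The natural boundary conditions: testing with the affine path from
    \<open>e0\<close> to \<open>e1\<close>, integration by parts leaves only boundary terms. Taking
    one of the two vectors to be 0 separates the ends.\<close>
  have bc: "u 1 \<bullet> e1 = u 0 \<bullet> e0"
    if e: "0 < e" "\<And>\<epsilon>. \<bar>\<epsilon>\<bar> < e \<Longrightarrow> q 0 + \<epsilon> *\<^sub>R e0 \<in> Q_S" "\<And>\<epsilon>. \<bar>\<epsilon>\<bar> < e \<Longrightarrow> q 1 + \<epsilon> *\<^sub>R e1 \<in> Q_E1 \<theta>"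
      and et: "row_sum e0 = 0" "row_sum e1 = 0" for e e0 e1
  proof -
    define \<psi> where "\<psi> t = e0 + t *\<^sub>R (e1 - e0)" for t :: real
    have d\<psi>: "(\<psi> has_vector_derivative e1 - e0) (at t within S)" for t S
    proof -
      have "((\<lambda>t. t *\<^sub>R (e1 - e0)) has_vector_derivative 1 *\<^sub>R (e1 - e0)) (at t within S)"
        using has_vector_derivative_scaleR[OF DERIV_ident has_vector_derivative_const[of "e1 - e0"], of t S] by simp
      from has_vector_derivative_add[OF has_vector_derivative_const this]
      show ?thesis unfolding \<psi>_def by simp
    qed
    have h\<psi>: "H1_deriv 0 1 \<psi> (\<lambda>t. e1 - e0)" by (rule H1_deriv_C1[OF d\<psi>]) simp
    have "((\<lambda>t. ?v t \<bullet> (0 *\<^sub>R ?v t + (e1 - e0)) + force (q t) \<bullet> (0 *\<^sub>R q t + \<psi> t)) has_integral 0) {0..1}"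
    proof (rule first_variation[OF qH nc h\<psi> d\<psi> e(1)])
      fix \<epsilon> :: real assume \<epsilon>: "\<bar>\<epsilon>\<bar> < e"
      have hn': "H1_deriv 0 1 (\<lambda>t. \<epsilon> *\<^sub>R \<psi> t) (\<lambda>t. \<epsilon> *\<^sub>R (e1 - e0))"
        by (rule H1_deriv_linear[OF h\<psi> bounded_linear_scaleR_right])
      have "((\<lambda>t. \<epsilon> *\<^sub>R \<psi> t) has_vector_derivative \<epsilon> *\<^sub>R (e1 - e0)) (at t)" for t
        by (rule bounded_linear.has_vector_derivative[OF bounded_linear_scaleR_right d\<psi>])
      note H1_affine(1)[OF qH hn' this, of "1 + \<epsilon> * 0"]
      moreover have "(1 + \<epsilon> * 0) *\<^sub>R q t + \<epsilon> *\<^sub>R \<psi> t \<in> chi" if "t \<in> {0..1}" for t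
        unfolding chi_row_sum T.add T.scaleR \<psi>_def T.diff qchi[OF that] et by simp
      moreover have "(1 + \<epsilon> * 0) *\<^sub>R q 0 + \<epsilon> *\<^sub>R \<psi> 0 \<in> Q_S" "(1 + \<epsilon> * 0) *\<^sub>R q 1 + \<epsilon> *\<^sub>R \<psi> 1 \<in> Q_E1 \<theta>"
        using e(2,3)[OF \<epsilon>] by (simp_all add: \<psi>_def)
      ultimately show "action q \<le> action (\<lambda>t. (1 + \<epsilon> * 0) *\<^sub>R q t + \<epsilon> *\<^sub>R \<psi> t)"
        by (intro min) (simp add: paths_def)
    qed
    then have A: "((\<lambda>t. ?v t \<bullet> (e1 - e0) + F t \<bullet> \<psi> t) has_integral 0) {0..1}" by (simp add: F_def)
    have B: "((\<lambda>t. F t \<bullet> \<psi> t + u t \<bullet> (e1 - e0)) has_integral (u 1 \<bullet> \<psi> 1 - u 0 \<bullet> \<psi> 0)) {0..1}"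
      by (rule H1_deriv_inner[OF hu h\<psi>]) simp
    have "((\<lambda>t. ?v t \<bullet> (e1 - e0) + F t \<bullet> \<psi> t) has_integral (u 1 \<bullet> \<psi> 1 - u 0 \<bullet> \<psi> 0)) {0..1}"
    \<comment> \<open>At 0 and 1 the two-sided derivative depends on values of \<open>q\<close>
      outside \<open>{0..1}\<close>, so the velocities are compared in the interior only.\<close>
    proof (rule has_integral_spike[of "{0, 1}", OF _ _ B])
      show "?v t \<bullet> (e1 - e0) + F t \<bullet> \<psi> t = F t \<bullet> \<psi> t + u t \<bullet> (e1 - e0)" if "t \<in> {0..1} - {0, 1}" for t
        using vu[of t] that by simp
    qed simp
    from has_integral_unique[OF this A] show ?thesis by (simp add: \<psi>_def)
  qed
  show thesis
  proof (rule that[OF dq _ uchi])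
    show "(u has_vector_derivative force (q t)) (at t within {0..1})" if "t \<in> {0..1}" for t
      using du[OF that] by (simp add: F_def)
    show "u 0 \<bullet> S_config a b c = 0" for a b c
    proof -
      obtain e where e: "0 < e" "\<And>\<epsilon>. \<bar>\<epsilon>\<bar> < e \<Longrightarrow> q 0 + \<epsilon> *\<^sub>R S_config a b c \<in> Q_S"
        using Q_S_perturbation[OF q0 nc, of a b c] by auto
      have "u 1 \<bullet> 0 = u 0 \<bullet> S_config a b c"
        by (rule bc[OF e]) (use q1 S_config_chi in \<open>simp_all add: chi_row_sum T.zero\<close>)
      then show ?thesis by simp
    qed
    show "u 1 \<bullet> E_config \<theta> a b c = 0" for a b c
    proof -
      obtain e where e: "0 < e" "\<And>\<epsilon>. \<bar>\<epsilon>\<bar> < e \<Longrightarrow> q 1 + \<epsilon> *\<^sub>R E_config \<theta> a b c \<in> Q_E1 \<theta>"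
        using Q_E1_perturbation[OF q1 nc, of a b c] by auto
      have "u 1 \<bullet> E_config \<theta> a b c = u 0 \<bullet> 0"
        by (rule bc[OF e(1) _ e(2)]) (use q0 E_config_chi in \<open>simp_all add: chi_row_sum T.zero\<close>)
      then show ?thesis by simp
    qed
  qed
qed

section \<open>Reflection symmetries\<close>

text \<open>Such a map takes collision-free solutions of Newton's equations to collision-free
  solutions.\<close>

definition symmetry :: "(config \<Rightarrow> config) \<Rightarrow> bool" where
  "symmetry T \<longleftrightarrow> bounded_linear T \<and> (\<forall>q. force (T q) = T (force q)) \<and> (\<forall>q. has_collision (T q) = has_collision q)"

lemma symmetry_id: "symmetry (\<lambda>q. q)"
  by (simp add: symmetry_def bounded_linear_ident)

lemma symmetry_compose:
  assumes "symmetry T" "symmetry T'"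
  shows "symmetry (\<lambda>q. T (T' q))"
  using assms bounded_linear_compose[of T T'] by (simp add: symmetry_def)

definition relabel :: "(real^2 \<Rightarrow> real^2) \<Rightarrow> (4 \<Rightarrow> 4) \<Rightarrow> config \<Rightarrow> config" where
  "relabel L \<tau> q = (\<chi> i. L (q $ \<tau> i))"

lemma relabel_component [simp]: "relabel L \<tau> q $ i = L (q $ \<tau> i)"
  by (simp add: relabel_def)

lemma symmetry_relabel:
  assumes L: "bounded_linear L" and n: "\<And>x. norm (L x) = norm x" and \<tau>: "\<And>i. \<tau> (\<tau> i) = i"
  shows "symmetry (relabel L \<tau>)"
  unfolding symmetry_def
proof (intro conjI allI)
  interpret L: bounded_linear L by fact
  have bij: "bij \<tau>" by (rule o_bij[of \<tau>]) (auto simp: \<tau>)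
  have inj: "inj L"
  proof (rule injI)
    fix x y assume "L x = L y"
    then have "norm (L (x - y)) = 0" by (simp add: L.diff)
    then show "x = y" by (simp add: n)
  qed
  show "bounded_linear (relabel L \<tau>)"
  proof (rule linear_conv_bounded_linear[THEN iffD1], rule linearI)
    show "relabel L \<tau> (p + q) = relabel L \<tau> p + relabel L \<tau> q" for p q by (simp add: vec_eq_iff[where ?'b=4] L.add)
    show "relabel L \<tau> (r *\<^sub>R q) = r *\<^sub>R relabel L \<tau> q" for r q by (simp add: vec_eq_iff[where ?'b=4] L.scaleR)
  qed
  fix q
  have pf: "pair_force (relabel L \<tau> q) i j = L (pair_force q (\<tau> i) (\<tau> j))" for i j
    unfolding pair_force_def by (simp add: L.diff[symmetric] L.scaleR n)
  have "force (relabel L \<tau> q) $ i = relabel L \<tau> (force q) $ i" for i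
  proof -
    have "force (relabel L \<tau> q) $ i = L (\<Sum>j\<in>UNIV. pair_force q (\<tau> i) (\<tau> j))"
      unfolding force_component pf by (simp add: L.sum)
    also have "(\<Sum>j\<in>UNIV. pair_force q (\<tau> i) (\<tau> j)) = (\<Sum>j\<in>UNIV. pair_force q (\<tau> i) j)"
      by (rule sum.reindex_bij_betw[OF bij])
    finally show ?thesis by (simp add: force_component)
  qed
  then show "force (relabel L \<tau> q) = relabel L \<tau> (force q)" unfolding vec_eq_iff[where ?'b=4] by blast
  have "has_collision q" if "has_collision (relabel L \<tau> q)"
  proof -
    from that obtain i j where "i \<noteq> j" "L (q $ \<tau> i) = L (q $ \<tau> j)" by (auto simp: has_collision_def)
    then show ?thesis using inj bij unfolding has_collision_def by (metis bij_pointE injD)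
  qed
  moreover have "has_collision (relabel L \<tau> q)" if "has_collision q"
  proof -
    from that obtain i j where ij: "i \<noteq> j" "q $ i = q $ j" by (auto simp: has_collision_def)
    have "\<tau> i \<noteq> \<tau> j" using ij(1) \<tau> by metis
    moreover have "relabel L \<tau> q $ \<tau> i = relabel L \<tau> q $ \<tau> j" using ij(2) by (simp add: \<tau>)
    ultimately show ?thesis unfolding has_collision_def by blast
  qed
  ultimately show "has_collision (relabel L \<tau> q) = has_collision q" by blast
qed

text \<open>Reflection in the line through the origin at angle \<phi>/2.\<close>

definition mirror :: "real \<Rightarrow> real^2 \<Rightarrow> real^2" where
  "mirror \<phi> x = vector [cos \<phi> * x $ 1 + sin \<phi> * x $ 2, sin \<phi> * x $ 1 - cos \<phi> * x $ 2]"

text \<open>Counterclockwise rotation, the map that right multiplication by \<open>R \<phi>\<close>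
  induces on row vectors.\<close>

definition rot :: "real \<Rightarrow> real^2 \<Rightarrow> real^2" where
  "rot \<phi> x = vector [cos \<phi> * x $ 1 - sin \<phi> * x $ 2, sin \<phi> * x $ 1 + cos \<phi> * x $ 2]"

lemma mirror_components [simp]:
  "mirror \<phi> x $ 1 = cos \<phi> * x $ 1 + sin \<phi> * x $ 2" "mirror \<phi> x $ 2 = sin \<phi> * x $ 1 - cos \<phi> * x $ 2"
  by (simp_all add: mirror_def vector_2)

lemma rot_components [simp]:
  "rot \<phi> x $ 1 = cos \<phi> * x $ 1 - sin \<phi> * x $ 2" "rot \<phi> x $ 2 = sin \<phi> * x $ 1 + cos \<phi> * x $ 2"
  by (simp_all add: rot_def vector_2)

lemma rot_rot: "rot a (rot b x) = rot (a + b) x"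
  unfolding vec_eq_iff forall_2 by (simp add: cos_add sin_add algebra_simps)

lemma rot_0 [simp]: "rot 0 x = x"
  unfolding vec_eq_iff forall_2 by simp

lemma mirror_mirror: "mirror a (mirror b x) = rot (a - b) x"
  unfolding vec_eq_iff forall_2 by (simp add: cos_diff sin_diff algebra_simps)

lemma norm_mirror: "norm (mirror \<phi> x) = norm x"
proof (rule norm_2_eqI)
  define c s where "c = cos \<phi>" and "s = sin \<phi>"
  have "(mirror \<phi> x $ 1)\<^sup>2 + (mirror \<phi> x $ 2)\<^sup>2 = (c\<^sup>2 + s\<^sup>2) * ((x $ 1)\<^sup>2 + (x $ 2)\<^sup>2)"
    unfolding mirror_components c_def[symmetric] s_def[symmetric] by (simp add: power2_eq_square algebra_simps)
  also have "c\<^sup>2 + s\<^sup>2 = 1" by (simp add: c_def s_def)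
  finally show "(mirror \<phi> x $ 1)\<^sup>2 + (mirror \<phi> x $ 2)\<^sup>2 = (x $ 1)\<^sup>2 + (x $ 2)\<^sup>2" by simp
qed

lemma bounded_linear_mirror: "bounded_linear (mirror \<phi>)"
  by (rule linear_conv_bounded_linear[THEN iffD1], rule linearI) (simp_all add: vec_eq_iff forall_2 algebra_simps)

definition S_perm :: "4 \<Rightarrow> 4" where "S_perm i = (if i = 3 then 4 else if i = 4 then 3 else i)"
definition E_perm :: "4 \<Rightarrow> 4" where "E_perm i = (if i = 1 then 4 else if i = 4 then 1 else if i = 2 then 3 else 2)"

lemma S_perm_simps [simp]: "S_perm 1 = 1" "S_perm 2 = 2" "S_perm 3 = 4" "S_perm 4 = 3"
  using distinct_4 by (auto simp: S_perm_def)
lemma E_perm_simps [simp]: "E_perm 1 = 4" "E_perm 2 = 3" "E_perm 3 = 2" "E_perm 4 = 1"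
  using distinct_4 by (auto simp: E_perm_def)

text \<open>The isotropy reflections of the two boundary sets; \<open>turn\<close> is the return map of the extension.\<close>

definition S_refl :: "config \<Rightarrow> config" where "S_refl = relabel (mirror 0) S_perm"
definition E_refl :: "real \<Rightarrow> config \<Rightarrow> config" where "E_refl \<theta> = relabel (mirror (pi + 2 * \<theta>)) E_perm"
definition turn :: "real \<Rightarrow> config \<Rightarrow> config" where "turn \<theta> q = E_refl \<theta> (S_refl q)"
definition turn_inv :: "real \<Rightarrow> config \<Rightarrow> config" where "turn_inv \<theta> q = S_refl (E_refl \<theta> q)"

lemma S_perm_invol: "S_perm (S_perm i) = i"
  using exhaust_4[of i] by auto

lemma E_perm_invol: "E_perm (E_perm i) = i"
  using exhaust_4[of i] by auto

lemma symmetry_S: "symmetry S_refl"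
  unfolding S_refl_def by (rule symmetry_relabel[OF bounded_linear_mirror norm_mirror S_perm_invol])

lemma symmetry_E: "symmetry (E_refl \<theta>)"
  unfolding E_refl_def by (rule symmetry_relabel[OF bounded_linear_mirror norm_mirror E_perm_invol])

lemma S_S [simp]: "S_refl (S_refl q) = q"
  by (simp add: S_refl_def vec_eq_iff[where ?'b=4] S_perm_invol mirror_mirror)

lemma E_E [simp]: "E_refl \<theta> (E_refl \<theta> q) = q"
  by (simp add: E_refl_def vec_eq_iff[where ?'b=4] E_perm_invol mirror_mirror)

lemma turn_inv_turn [simp]: "turn_inv \<theta> (turn \<theta> q) = q" "turn \<theta> (turn_inv \<theta> q) = q"
  by (simp_all add: turn_def turn_inv_def)

lemma symmetry_turn: "symmetry (turn \<theta>)" "symmetry (turn_inv \<theta>)"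
  unfolding turn_def[abs_def] turn_inv_def[abs_def]
  by (rule symmetry_compose[OF symmetry_E symmetry_S], rule symmetry_compose[OF symmetry_S symmetry_E])

lemma turn_component: "turn \<theta> q $ i = rot (pi + 2 * \<theta>) (q $ S_perm (E_perm i))"
  by (simp add: turn_def E_refl_def S_refl_def mirror_mirror)

text \<open>The map from \<open>i\<close> to \<open>S_perm (E_perm i)\<close> is the cycle 1, 3, 2,
  4, so four turns restore the labels; the four half turns cancel, and four times the angle 2
  \<theta> remains.\<close>

lemma turn_4: "turn \<theta> (turn \<theta> (turn \<theta> (turn \<theta> q))) = (\<chi> i. rot (8 * \<theta>) (q $ i))"
proof -
  have r: "rot (pi + 2 * \<theta> + (pi + 2 * \<theta> + (pi + 2 * \<theta> + (pi + 2 * \<theta>)))) x = rot (8 * \<theta>) x" for x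
  proof -
    have "pi + 2 * \<theta> + (pi + 2 * \<theta> + (pi + 2 * \<theta> + (pi + 2 * \<theta>))) = 8 * \<theta> + 2 * pi + 2 * pi" by simp
    then show ?thesis unfolding vec_eq_iff forall_2 rot_components by (simp only: cos_periodic sin_periodic)
  qed
  have "turn \<theta> (turn \<theta> (turn \<theta> (turn \<theta> q))) $ i = rot (8 * \<theta>) (q $ i)" for i
    unfolding turn_component rot_rot r using exhaust_4[of i] by auto
  then show ?thesis by (simp add: vec_eq_iff[where ?'b=4])
qed

definition turns :: "real \<Rightarrow> int \<Rightarrow> config \<Rightarrow> config" where
  "turns \<theta> n = (if 0 \<le> n then (turn \<theta> ^^ nat n) else (turn_inv \<theta> ^^ nat (- n)))"

lemma turns_0 [simp]: "turns \<theta> 0 q = q"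
  by (simp add: turns_def)

lemma turns_add_1: "turns \<theta> (n + 1) q = turns \<theta> n (turn \<theta> q)"
proof (cases "0 \<le> n")
  case True
  then have "nat (n + 1) = Suc (nat n)" by simp
  then show ?thesis using True by (simp add: turns_def funpow_swap1)
next
  case False
  define k where "k = nat (- 1 - n)"
  have "nat (- n) = Suc k" using False by (simp add: k_def)
  then have "turns \<theta> n (turn \<theta> q) = turn_inv \<theta> ((turn_inv \<theta> ^^ k) (turn \<theta> q))"
    using False by (simp add: turns_def)
  also have "\<dots> = (turn_inv \<theta> ^^ k) q" by (simp add: funpow_swap1)
  also have "\<dots> = turns \<theta> (n + 1) q"
  proof -
    have "n + 1 = - int k" using False by (simp add: k_def)
    then show ?thesis by (cases "k = 0") (auto simp: turns_def)
  qed
  finally show ?thesis by simp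
qed

lemma symmetry_turns: "symmetry (turns \<theta> n)"
proof -
  have "symmetry (T ^^ k)" if "symmetry T" for T and k :: nat
  proof (induction k)
    case 0 then show ?case using symmetry_id by (simp add: id_def)
  next
    case (Suc k)
    then show ?case using symmetry_compose[OF that Suc.IH] by (simp add: o_def)
  qed
  then show ?thesis using symmetry_turn by (simp add: turns_def)
qed

lemma turns_turn: "turns \<theta> n (turn \<theta> q) = turn \<theta> (turns \<theta> n q)"
proof -
  have "turns \<theta> n (turn \<theta> q) = turn \<theta> (turns \<theta> n q) \<and> turns \<theta> n (turn_inv \<theta> q) = turn_inv \<theta> (turns \<theta> n q)"
    for q
  proof (cases "0 \<le> n")
    case True
    have a: "(turn \<theta> ^^ k) (turn_inv \<theta> q) = turn_inv \<theta> ((turn \<theta> ^^ k) q)" for k q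
      by (induction k arbitrary: q) simp_all
    show ?thesis using True by (simp add: turns_def a funpow_swap1)
  next
    case False
    have a: "(turn_inv \<theta> ^^ k) (turn \<theta> q) = turn \<theta> ((turn_inv \<theta> ^^ k) q)" for k q
      by (induction k arbitrary: q) simp_all
    show ?thesis using False by (simp add: turns_def a funpow_swap1)
  qed
  then show ?thesis by blast
qed

lemma turns_add_4: "turns \<theta> (n + 4) q = (\<chi> i. rot (8 * \<theta>) (turns \<theta> n q $ i))"
proof -
  have n: "n + 4 = n + 1 + 1 + 1 + 1" by simp
  show ?thesis unfolding n turns_add_1 turns_turn turn_4 ..
qed

lemma inner_config: "(p::config) \<bullet> q = p $ 1 $ 1 * q $ 1 $ 1 + p $ 1 $ 2 * q $ 1 $ 2 + p $ 2 $ 1 * q $ 2 $ 1 + p $ 2 $ 2 * q $ 2 $ 2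
   + p $ 3 $ 1 * q $ 3 $ 1 + p $ 3 $ 2 * q $ 3 $ 2 + p $ 4 $ 1 * q $ 4 $ 1 + p $ 4 $ 2 * q $ 4 $ 2"
  unfolding inner_vec_def sum_4 sum_2 by simp

lemma S_refl_fixes:
  assumes "q \<in> Q_S"
  shows "S_refl q = q"
proof -
  obtain a b c where q: "q = S_config a b c" using assms unfolding Q_S_iff by blast
  show ?thesis by (rule config_eqI) (simp_all add: q S_refl_def S_config_components)
qed

text \<open>In the coordinates along \<open>(cos \<theta>, sin \<theta>)\<close> and its normal the mirror flips the first one.\<close>

lemma mirror_frame:
  "mirror (pi + 2 * \<theta>) x = y \<longleftrightarrow> x $ 1 * cos \<theta> + x $ 2 * sin \<theta> = - (y $ 1 * cos \<theta> + y $ 2 * sin \<theta>)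
     \<and> x $ 2 * cos \<theta> - x $ 1 * sin \<theta> = y $ 2 * cos \<theta> - y $ 1 * sin \<theta>"
proof -
  define c s where "c = cos \<theta>" and "s = sin \<theta>"
  have sc: "s\<^sup>2 + c\<^sup>2 = 1" by (simp add: c_def s_def)
  have p: "cos (pi + 2 * \<theta>) = - (c\<^sup>2 - s\<^sup>2)" "sin (pi + 2 * \<theta>) = - (2 * s * c)"
    by (simp_all add: cos_add sin_add cos_double sin_double c_def s_def)
  define P Q where "P = x $ 1 * c + x $ 2 * s" and "Q = x $ 2 * c - x $ 1 * s"
  have m: "mirror (pi + 2 * \<theta>) x $ 1 = - P * c - Q * s" "mirror (pi + 2 * \<theta>) x $ 2 = - P * s + Q * c"
    unfolding mirror_components p P_def Q_def by (simp_all add: power2_eq_square algebra_simps)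
  have "- P * c - Q * s = y $ 1 \<and> - P * s + Q * c = y $ 2 \<longleftrightarrow> P = - (y $ 1 * c + y $ 2 * s) \<and> Q = y $ 2 * c - y $ 1 * s"
  proof
    assume "- P * c - Q * s = y $ 1 \<and> - P * s + Q * c = y $ 2"
    then have y: "y $ 1 = - P * c - Q * s" "y $ 2 = - P * s + Q * c" by auto
    have "- (y $ 1 * c + y $ 2 * s) = P * (s\<^sup>2 + c\<^sup>2)" "y $ 2 * c - y $ 1 * s = Q * (s\<^sup>2 + c\<^sup>2)"
      unfolding y by (simp_all add: power2_eq_square algebra_simps)
    then show "P = - (y $ 1 * c + y $ 2 * s) \<and> Q = y $ 2 * c - y $ 1 * s" unfolding sc mult_1_right by simp
  next
    assume "P = - (y $ 1 * c + y $ 2 * s) \<and> Q = y $ 2 * c - y $ 1 * s"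
    then have y: "P = - (y $ 1 * c + y $ 2 * s)" "Q = y $ 2 * c - y $ 1 * s" by auto
    have "- P * c - Q * s = y $ 1 * (s\<^sup>2 + c\<^sup>2)" "- P * s + Q * c = y $ 2 * (s\<^sup>2 + c\<^sup>2)"
      unfolding y by (simp_all add: power2_eq_square algebra_simps)
    then show "- P * c - Q * s = y $ 1 \<and> - P * s + Q * c = y $ 2" unfolding sc mult_1_right by blast
  qed
  then show ?thesis
    unfolding vec_eq_iff[of "mirror (pi + 2 * \<theta>) x"] forall_2 m unfolding P_def Q_def c_def s_def .
qed

lemma E_refl_iff:
  "E_refl \<theta> p = q \<longleftrightarrow> mirror (pi + 2 * \<theta>) (p $ 4) = q $ 1 \<and> mirror (pi + 2 * \<theta>) (p $ 3) = q $ 2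
     \<and> mirror (pi + 2 * \<theta>) (p $ 2) = q $ 3 \<and> mirror (pi + 2 * \<theta>) (p $ 1) = q $ 4"
proof -
  have "E_refl \<theta> p = q \<longleftrightarrow> (\<forall>i. E_refl \<theta> p $ i = q $ i)" by (rule vec_eq_iff)
  also have "\<dots> \<longleftrightarrow> E_refl \<theta> p $ 1 = q $ 1 \<and> E_refl \<theta> p $ 2 = q $ 2 \<and> E_refl \<theta> p $ 3 = q $ 3 \<and> E_refl \<theta> p $ 4 = q $ 4"
    by (rule forall_4)
  finally show ?thesis by (simp only: E_refl_def relabel_component E_perm_simps)
qed

lemma E_refl_fixes:
  assumes "q \<in> Q_E1 \<theta>"
  shows "E_refl \<theta> q = q"
proof -
  obtain a b c where q: "q = E_config \<theta> a b c" using assms unfolding Q_E1_iff by blast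
  show ?thesis unfolding E_refl_iff mirror_frame q E_config_components by (simp add: algebra_simps)
qed

text \<open>\<open>S_refl\<close> is an orthogonal involution whose fixed space in
  \<open>chi\<close> is the span of \<open>Q_S\<close>, so it is minus the identity on the
  orthogonal complement within \<open>chi\<close>.\<close>

lemma S_refl_normal:
  assumes "u \<in> chi" "\<And>a b c. u \<bullet> S_config a b c = 0"
  shows "S_refl u = - u"
proof -
  note e = assms(2)[unfolded inner_config S_config_components]
  have 1: "u $ 3 $ 1 + u $ 4 $ 1 = u $ 1 $ 1 + u $ 2 $ 1" using e[where a=1 and b=0 and c=0] by simp
  have 2: "u $ 3 $ 2 = u $ 4 $ 2" using e[where a=0 and b=1 and c=0] by simp
  have 3: "2 * u $ 1 $ 1 = u $ 3 $ 1 + u $ 4 $ 1" using e[where a=0 and b=0 and c=1] by simp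
  show ?thesis
    by (rule config_eqI) (use 1 2 3 assms(1) in \<open>auto simp: S_refl_def chi_iff\<close>)
qed

text \<open>As for \<open>S_refl_normal\<close>, in the coordinates \<open>X\<close> along (cos
  \<theta>, sin \<theta>) and \<open>Y\<close> along its normal: the fixed space of
  \<open>E_refl \<theta>\<close> in \<open>chi\<close> is the span of
  \<open>Q_E1 \<theta>\<close>.\<close>

lemma E_refl_normal:
  assumes "u \<in> chi" "\<And>a b c. u \<bullet> E_config \<theta> a b c = 0"
  shows "E_refl \<theta> u = - u"
proof -
  define c s where "c = cos \<theta>" and "s = sin \<theta>"
  define X Y where "X i = u $ i $ 1 * c + u $ i $ 2 * s" and "Y i = u $ i $ 2 * c - u $ i $ 1 * s" for i
  note e = assms(2)[unfolded inner_config E_config_components c_def[symmetric] s_def[symmetric]]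
  have 1: "- Y 1 + Y 2 + Y 3 - Y 4 = 0" using e[where a=1 and b=0 and c=0] by (simp add: Y_def algebra_simps)
  have 2: "X 4 = X 1" using e[where a=0 and b=1 and c=0] by (simp add: X_def algebra_simps)
  have 3: "X 3 = X 2" using e[where a=0 and b=0 and c=1] by (simp add: X_def algebra_simps)
  have 4: "Y 1 + Y 2 + Y 3 + Y 4 = 0"
  proof -
    have "Y 1 + Y 2 + Y 3 + Y 4 = (u $ 1 $ 2 + u $ 2 $ 2 + u $ 3 $ 2 + u $ 4 $ 2) * c - (u $ 1 $ 1 + u $ 2 $ 1 + u $ 3 $ 1 + u $ 4 $ 1) * s"
      by (simp add: Y_def algebra_simps)
    then show ?thesis using assms(1) by (simp add: chi_iff)
  qed
  have Y: "Y 4 = - Y 1" "Y 3 = - Y 2" using 1 4 by linarith+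
  show ?thesis unfolding E_refl_iff mirror_frame c_def[symmetric] s_def[symmetric]
    using 2 3 Y by (auto simp: X_def Y_def algebra_simps)
qed

section \<open>Extension to all times\<close>

text \<open>For gluing at a common end point. Closedness matters: at a point outside
  \<open>S\<close> the filter \<open>at t within S\<close> is trivial, so that piece imposes no
  condition.\<close>

lemma has_vector_derivative_within_Un:
  assumes S: "t \<in> S \<Longrightarrow> (f has_vector_derivative f') (at t within S)" "closed S"
    and T: "t \<in> T \<Longrightarrow> (f has_vector_derivative f') (at t within T)" "closed T"
  shows "(f has_vector_derivative f') (at t within S \<union> T)"
proof -
  have *: "((\<lambda>y. (1 / norm (y - t)) *\<^sub>R (f y - (f t + (y - t) *\<^sub>R f'))) \<longlongrightarrow> 0) (at t within A)"
    if "t \<in> A \<Longrightarrow> (f has_vector_derivative f') (at t within A)" "closed A" for A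
  proof (cases "t \<in> A")
    case True
    then show ?thesis using that(1) unfolding has_vector_derivative_def has_derivative_within by blast
  next
    case False
    then have "at t within A = bot"
      using that(2) by (metis closed_limpt trivial_limit_within)
    then show ?thesis by simp
  qed
  have "((\<lambda>y. (1 / norm (y - t)) *\<^sub>R (f y - (f t + (y - t) *\<^sub>R f'))) \<longlongrightarrow> 0) (at t within S \<union> T)"
    unfolding at_within_union by (rule filterlim_sup[OF *[OF S] *[OF T]])
  then show ?thesis unfolding has_vector_derivative_def has_derivative_within using bounded_linear_scaleR_left by blast
qed

lemma has_vector_derivative_reflect:
  assumes f: "\<And>t. t \<in> {0..1} \<Longrightarrow> (f has_vector_derivative f' t) (at t within {0..1})" and t: "t \<in> {1..2::real}"
  shows "((\<lambda>t. f (2 - t)) has_vector_derivative - f' (2 - t)) (at t within {1..2})"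
proof -
  have d: "((\<lambda>t. 2 - t) has_vector_derivative - 1) (at t within {1..2})"
    by (auto intro!: derivative_eq_intros)
  have im: "(\<lambda>t. 2 - t) ` {1..2::real} = {0..1}"
    by (simp add: image_diff_atLeastAtMost)
  have "(f has_vector_derivative f' (2 - t)) (at (2 - t) within (\<lambda>t. 2 - t) ` {1..2})"
    unfolding im by (rule f) (use t in auto)
  from vector_diff_chain_within[OF d this] show ?thesis by (simp add: o_def)
qed

text \<open>Reflecting at \<open>t = 1\<close> and repeating with \<open>turn\<close>. At \<open>t = 2 n\<close> the pieces fit because the
  reflections fix \<open>q 0\<close>, \<open>q 1\<close> and reverse \<open>u 0\<close>, \<open>u 1\<close>.\<close>

lemma reflected_extension:
  fixes q u :: "real \<Rightarrow> config"
  assumes q: "\<And>t. t \<in> {0..1} \<Longrightarrow> (q has_vector_derivative u t) (at t within {0..1})"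
    and u: "\<And>t. t \<in> {0..1} \<Longrightarrow> (u has_vector_derivative force (q t)) (at t within {0..1})"
    and nc: "\<And>t. t \<in> {0..1} \<Longrightarrow> \<not> has_collision (q t)"
    and S: "S_refl (q 0) = q 0" "S_refl (u 0) = - u 0"
    and E: "E_refl \<theta> (q 1) = q 1" "E_refl \<theta> (u 1) = - u 1"
  obtains x where "is_orbit x" "\<And>t. t \<in> {0..1} \<Longrightarrow> x t = q t" "\<And>t i. x (t + 8) $ i = rot (8 * \<theta>) (x t $ i)"
proof -
  have El: "bounded_linear (E_refl \<theta>)" and Ef: "\<And>q. force (E_refl \<theta> q) = E_refl \<theta> (force q)"
    and Ec: "\<And>q. has_collision (E_refl \<theta> q) = has_collision q"
    using symmetry_E by (auto simp: symmetry_def)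
  have Tl: "bounded_linear (turns \<theta> n)" and Tf: "force (turns \<theta> n q) = turns \<theta> n (force q)"
    and Tc: "has_collision (turns \<theta> n q) = has_collision q" for n q
    using symmetry_turns[of \<theta> n] by (auto simp: symmetry_def)
  have Em: "E_refl \<theta> (- p) = - E_refl \<theta> p" for p by (rule linear_neg[OF bounded_linear.linear[OF El]])
  have Tm: "turns \<theta> n (- p) = - turns \<theta> n p" for n p by (rule linear_neg[OF bounded_linear.linear[OF Tl]])
  \<comment> \<open>\<open>q\<close> followed by its mirror image run backwards; the assumptions
    \<open>E\<close> make position and velocity of the two branches agree at t = 1.\<close>
  define z where "z t = (if t \<le> 1 then q t else E_refl \<theta> (q (2 - t)))" for t :: real
  define z' where "z' t = (if t \<le> 1 then u t else - E_refl \<theta> (u (2 - t)))" for t :: real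
  have z2: "z t = E_refl \<theta> (q (2 - t))" "z' t = - E_refl \<theta> (u (2 - t))" if "t \<in> {1..2}" for t
    using that E by (cases "t = 1"; simp add: z_def z'_def)+
  have dz: "(z has_vector_derivative z' t) (at t within {0..2})" "(z' has_vector_derivative force (z t)) (at t within {0..2})"
    if t: "t \<in> {0..2}" for t
  proof -
    have U: "{0..2} = {0..1} \<union> {1..2::real}" by auto
    show "(z has_vector_derivative z' t) (at t within {0..2})" unfolding U
    proof (rule has_vector_derivative_within_Un)
      assume t: "t \<in> {0..1}"
      show "(z has_vector_derivative z' t) (at t within {0..1})"
        by (rule has_vector_derivative_transform[OF t]) (use q[OF t] t in \<open>auto simp: z_def z'_def\<close>)
    next
      assume t: "t \<in> {1..2}"
      have "((\<lambda>t. E_refl \<theta> (q (2 - t))) has_vector_derivative E_refl \<theta> (- u (2 - t))) (at t within {1..2})"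
        by (rule bounded_linear.has_vector_derivative[OF El has_vector_derivative_reflect[OF q t]])
      then have "((\<lambda>t. E_refl \<theta> (q (2 - t))) has_vector_derivative z' t) (at t within {1..2})"
        using z2[OF t] by (simp add: Em)
      then show "(z has_vector_derivative z' t) (at t within {1..2})"
        by (rule has_vector_derivative_transform[OF t, rotated]) (simp add: z2)
    qed auto
    show "(z' has_vector_derivative force (z t)) (at t within {0..2})" unfolding U
    proof (rule has_vector_derivative_within_Un)
      assume t: "t \<in> {0..1}"
      show "(z' has_vector_derivative force (z t)) (at t within {0..1})"
        by (rule has_vector_derivative_transform[OF t]) (use u[OF t] t in \<open>auto simp: z_def z'_def\<close>)
    next
      assume t: "t \<in> {1..2}"
      have "((\<lambda>t. - E_refl \<theta> (u (2 - t))) has_vector_derivative - E_refl \<theta> (- force (q (2 - t)))) (at t within {1..2})"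
        by (intro has_vector_derivative_minus bounded_linear.has_vector_derivative[OF El has_vector_derivative_reflect[OF u t]])
      then have "((\<lambda>t. - E_refl \<theta> (u (2 - t))) has_vector_derivative force (z t)) (at t within {1..2})"
        using z2[OF t] by (simp add: Em Ef)
      then show "(z' has_vector_derivative force (z t)) (at t within {1..2})"
        by (rule has_vector_derivative_transform[OF t, rotated]) (simp add: z2)
    qed auto
  qed
  have znc: "\<not> has_collision (z t)" if "t \<in> {0..2}" for t
    using nc[of t] nc[of "2 - t"] that by (auto simp: z_def Ec)
  \<comment> \<open>Since \<open>S_refl\<close> fixes \<open>q 0\<close> and reverses
    \<open>u 0\<close>, position and velocity at t = 2 are the \<open>turn\<close> of those at t =
    0.\<close>
  have z0: "z 2 = turn \<theta> (z 0)" "z' 2 = turn \<theta> (z' 0)"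
    using S by (simp_all add: z_def z'_def turn_def Em)
  define m where "m t = \<lfloor>t / 2\<rfloor>" for t :: real
  define x where "x t = turns \<theta> (m t) (z (t - 2 * of_int (m t)))" for t
  define v where "v t = turns \<theta> (m t) (z' (t - 2 * of_int (m t)))" for t
  have m_in: "t - 2 * of_int (m t) \<in> {0..2}" for t
  proof -
    have "of_int (m t) \<le> t / 2" "t / 2 < of_int (m t) + 1" unfolding m_def by linarith+
    then show ?thesis by auto
  qed
  \<comment> \<open>At t = 2 n + 2 the floor already selects the next piece; by \<open>z0\<close>
    both formulas agree there, so each one holds on a closed interval.\<close>
  have piece: "x t = turns \<theta> n (z (t - 2 * of_int n)) \<and> v t = turns \<theta> n (z' (t - 2 * of_int n))"
    if t: "t \<in> {2 * of_int n..2 * of_int n + 2}" for t n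
  proof (cases "t = 2 * of_int n + 2")
    case True
    then have "t / 2 = of_int (n + 1)" by simp
    then have "m t = n + 1" unfolding m_def by (simp only: floor_of_int)
    then show ?thesis using True z0 by (simp add: x_def v_def turns_add_1)
  next
    case False
    then have "m t = n" unfolding m_def using t by (intro floor_unique) auto
    then show ?thesis by (simp add: x_def v_def)
  qed
  have dpiece: "(x has_vector_derivative v t) (at t within {2 * of_int n..2 * of_int n + 2})"
    "(v has_vector_derivative force (x t)) (at t within {2 * of_int n..2 * of_int n + 2})"
    if t: "t \<in> {2 * of_int n..2 * of_int n + 2}" for t n
  proof -
    let ?I = "{2 * of_int n..2 * of_int n + 2 :: real}"
    have im: "(\<lambda>t. t - 2 * of_int n) ` ?I = {0..2}"
      by (simp add: image_minus_const_atLeastAtMost')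
    have tm: "t - 2 * of_int n \<in> {0..2}" using t by auto
    have d: "((\<lambda>t. t - 2 * of_int n) has_vector_derivative 1) (at t within ?I)"
      by (auto intro!: derivative_eq_intros)
    have "(z has_vector_derivative z' (t - 2 * of_int n)) (at (t - 2 * of_int n) within (\<lambda>t. t - 2 * of_int n) ` ?I)"
      unfolding im by (rule dz(1)[OF tm])
    from bounded_linear.has_vector_derivative[OF Tl vector_diff_chain_within[OF d this], of n]
    have "((\<lambda>t. turns \<theta> n (z (t - 2 * of_int n))) has_vector_derivative v t) (at t within ?I)"
      using piece[OF t] by (simp add: o_def)
    then show "(x has_vector_derivative v t) (at t within ?I)"
      by (rule has_vector_derivative_transform[OF t, rotated]) (use piece in blast)
    have "(z' has_vector_derivative force (z (t - 2 * of_int n))) (at (t - 2 * of_int n) within (\<lambda>t. t - 2 * of_int n) ` ?I)"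
      unfolding im by (rule dz(2)[OF tm])
    from bounded_linear.has_vector_derivative[OF Tl vector_diff_chain_within[OF d this], of n]
    have "((\<lambda>t. turns \<theta> n (z' (t - 2 * of_int n))) has_vector_derivative force (x t)) (at t within ?I)"
      using piece[OF t] by (simp add: o_def Tf)
    then show "(v has_vector_derivative force (x t)) (at t within ?I)"
      by (rule has_vector_derivative_transform[OF t, rotated]) (use piece in blast)
  qed
  have glob: "(f has_vector_derivative f' t) (at t)"
    if "\<And>t n. t \<in> {2 * of_int n..2 * of_int n + 2} \<Longrightarrow> (f has_vector_derivative f' t) (at t within {2 * of_int n..2 * of_int n + 2})"
    for f f' :: "real \<Rightarrow> config" and t
  proof -
    \<comment> \<open>The window from 2 m - 2 to 2 m + 2 has \<open>t\<close> in its interior even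
      when \<open>t\<close> is the seam 2 m.\<close>
    define a where "a = 2 * of_int (m t) - (2 :: real)"
    have a: "a = 2 * of_int (m t - 1)" "a + 2 = 2 * of_int (m t)" by (simp_all add: a_def)
    have "(f has_vector_derivative f' t) (at t within {a..a + 2} \<union> {a + 2..a + 2 + 2})"
      by (rule has_vector_derivative_within_Un) (use that[of t "m t - 1"] that[of t "m t"] in \<open>auto simp flip: a\<close>)
    moreover have "at t within {a..a + 2} \<union> {a + 2..a + 2 + 2} = at t"
    proof (rule at_within_open_subset[of t "{a<..<a + 4}"])
      have "of_int (m t) \<le> t / 2" "t / 2 < of_int (m t) + 1" unfolding m_def by linarith+
      then show "t \<in> {a<..<a + 4}" by (auto simp: a_def)
    qed auto
    ultimately show ?thesis by simp
  qed
  have "is_orbit x"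
    unfolding is_orbit_def
  proof (intro conjI allI exI[of _ v])
    show "\<not> has_collision (x t)" for t unfolding x_def Tc by (rule znc[OF m_in])
    show "(x has_vector_derivative v t) (at t)" for t by (rule glob[OF dpiece(1)])
    show "(v has_vector_derivative force (x t)) (at t)" for t by (rule glob[where f=v and f'="\<lambda>t. force (x t)", OF dpiece(2)])
  qed
  moreover have "x t = q t" if "t \<in> {0..1}" for t
    using piece[of t 0] that by (simp add: z_def)
  moreover have "x (t + 8) $ i = rot (8 * \<theta>) (x t $ i)" for t i
  proof -
    have "(t + 8) / 2 = t / 2 + of_int 4" by simp
    then have "m (t + 8) = m t + 4" unfolding m_def by (simp only: floor_add_int)
    then show ?thesis by (simp add: x_def turns_add_4 algebra_simps)
  qed
  ultimately show thesis by (rule that)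
qed

section \<open>Orbits that are periodic up to a rotation\<close>

lemma rot_periodic_multiple: "rot (2 * pi * of_int n) x = x"
  unfolding vec_eq_iff forall_2 rot_components cos_int_2pin sin_int_2pin by simp

text \<open>Seen in the frame turning at rate \<theta>, the path has period 8. If 8 \<theta> is a
  rational multiple of 2 pi, finitely many periods bring the frame back; otherwise the frequencies
  1/8 and \<theta>/(2 pi) are rationally independent, and the path is quasi-periodic on a
  2-torus.\<close>

lemma rotating_orbit_recurrent:
  fixes x :: "real \<Rightarrow> config"
  assumes x: "continuous_on UNIV x" and th: "0 < \<theta>"
    and shift: "\<And>t i. x (t + 8) $ i = rot (8 * \<theta>) (x t $ i)"
  shows "periodic x \<or> quasi_periodic x"
proof (cases "\<exists>(k::nat) (j::int). k \<noteq> 0 \<and> 8 * \<theta> * real k = 2 * pi * of_int j")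
  case True
  then obtain k :: nat and j :: int where k: "k \<noteq> 0" "8 * \<theta> * real k = 2 * pi * of_int j" by blast
  have "x (t + 8 * real n) $ i = rot (8 * \<theta> * real n) (x t $ i)" for t :: real and i and n :: nat
  proof (induction n)
    case (Suc n)
    have "x (t + 8 * real (Suc n)) = x (t + 8 * real n + 8)" by (simp add: algebra_simps)
    then show ?case using shift[of "t + 8 * real n" i] Suc.IH by (simp add: rot_rot algebra_simps)
  qed simp
  from this[of _ k] have "x (t + 8 * real k) = x t" for t :: real
    unfolding k(2) rot_periodic_multiple by (simp add: vec_eq_iff[where ?'b=4])
  then show ?thesis unfolding periodic_def using k(1) by (intro disjI1 exI[of _ "8 * real k"]) auto
next
  case False
  \<comment> \<open>The path in the turning frame, with time rescaled so that its period is
    1.\<close>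
  define Y where "Y s i = rot (- 8 * \<theta> * s) (x (8 * s) $ i)" for s i
  have Y1: "Y (s + 1) i = Y s i" for s i
    using shift[of "8 * s" i] by (simp add: Y_def rot_rot algebra_simps)
  define \<omega> :: "nat \<Rightarrow> real" where "\<omega> i = (if i = 0 then 1/8 else \<theta> / (2 * pi))" for i
  define F :: "(nat \<Rightarrow> real) \<Rightarrow> config" where "F u = (\<chi> i. rot (2 * pi * u 1) (Y (u 0) i))" for u
  have xF: "x t = F (\<lambda>i. if i < 2 then t * \<omega> i else 0)" for t
    by (simp add: F_def \<omega>_def Y_def rot_rot vec_eq_iff[where ?'b=4])
  have ind: "\<forall>i<2. n i = 0" if "(\<Sum>i<2. of_int (n i) * \<omega> i) = 0" for n :: "nat \<Rightarrow> int"
  proof -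
    have "(\<Sum>i<2. of_int (n i) * \<omega> i) = of_int (n 0) / 8 + of_int (n 1) * \<theta> / (2 * pi)"
      by (simp add: numeral_2_eq_2 \<omega>_def)
    then have e: "8 * \<theta> * of_int (n 1) = 2 * pi * of_int (- n 0)" using that by (simp add: field_simps)
    have "n 1 = 0"
    proof (rule ccontr)
      assume n1: "n 1 \<noteq> 0"
      \<comment> \<open>The case assumption speaks of a natural number \<open>k\<close>, so the sign
        of \<open>n 1\<close> is moved to the other integer.\<close>
      define k where "k = nat \<bar>n 1\<bar>"
      have k: "k \<noteq> 0" using n1 by (simp add: k_def)
      have "real k = of_int \<bar>n 1\<bar>" by (simp add: k_def)
      then have "8 * \<theta> * real k = 2 * pi * of_int (sgn (n 1) * - n 0)"
        using e by (cases "0 < n 1") (use n1 in \<open>auto simp: sgn_if algebra_simps\<close>)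
      then show False using False k by blast
    qed
    then have "n 0 = 0" using e by simp
    with \<open>n 1 = 0\<close> show ?thesis by (auto simp: less_2_cases_iff)
  qed
  have Fc: "continuous_on A F" for A
  proof -
    have c: "continuous_on A (\<lambda>u :: nat \<Rightarrow> real. u i)" for i
      by (rule continuous_on_subset[OF continuous_on_product_coordinates]) simp
    have xc: "continuous_on A (\<lambda>u. x (8 * u 0) $ i $ j)" for i j
      by (intro continuous_on_component continuous_on_compose2[OF x] continuous_on_mult continuous_on_const c) simp
    define \<phi> where "\<phi> u = 2 * pi * u 1 - 8 * \<theta> * u 0" for u :: "nat \<Rightarrow> real"
    have \<phi>: "continuous_on A (\<lambda>u. cos (\<phi> u))" "continuous_on A (\<lambda>u. sin (\<phi> u))"
      unfolding \<phi>_def by (intro continuous_intros c)+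
    have F: "F u = (\<chi> i. \<chi> j. if j = 1 then cos (\<phi> u) * x (8 * u 0) $ i $ 1 - sin (\<phi> u) * x (8 * u 0) $ i $ 2
       else sin (\<phi> u) * x (8 * u 0) $ i $ 1 + cos (\<phi> u) * x (8 * u 0) $ i $ 2)" for u
      by (simp add: F_def Y_def rot_rot vec_eq_iff forall_2 \<phi>_def)
    have "continuous_on A (\<lambda>u. if j = 1 then cos (\<phi> u) * x (8 * u 0) $ i $ 1 - sin (\<phi> u) * x (8 * u 0) $ i $ 2
       else sin (\<phi> u) * x (8 * u 0) $ i $ 1 + cos (\<phi> u) * x (8 * u 0) $ i $ 2)" for i :: 4 and j :: 2
    proof (cases "j = 1")
      case True
      then show ?thesis by (simp only: refl if_True) (intro continuous_on_diff continuous_on_mult \<phi> xc)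
    next
      case False
      then show ?thesis by (simp only: refl if_False) (intro continuous_on_add continuous_on_mult \<phi> xc)
    qed
    then show ?thesis unfolding F[abs_def] by (intro continuous_on_vec_lambda)
  qed
  have per: "F (u(i := u i + 1)) = F u" if "i < 2" for u i
  proof -
    have "rot (2 * pi * (u 1 + 1)) y = rot (2 * pi * u 1) y" for y
      unfolding vec_eq_iff forall_2 by (simp add: distrib_left)
    then show ?thesis using that Y1 by (auto simp: less_2_cases_iff F_def)
  qed
  show ?thesis unfolding quasi_periodic_def
    by (intro disjI2 exI[of _ 2] exI[of _ \<omega>] exI[of _ F] conjI allI impI)
      (use ind Fc per xF in blast)+
qed

theorem theorem1p1:
  fixes \<theta> :: real and q :: "real \<Rightarrow> config"
  assumes "0 < \<theta>" and "\<theta> \<le> 0.0539 * pi"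
    and "is_minimizer q Q_S (Q_E1 \<theta>)"
  shows "(\<forall>t\<in>{0..1}. \<not> has_collision (q t)) \<and>
    (\<exists>x. is_orbit x \<and> (\<forall>t\<in>{0..1}. x t = q t) \<and> (periodic x \<or> quasi_periodic x))"
proof -
  have nc: "\<not> has_collision (q t)" if "t \<in> {0..1}" for t
    by (rule minimizer_collision_free[OF assms that])
  have q: "q 0 \<in> Q_S" "q 1 \<in> Q_E1 \<theta>" using assms(3) by (auto simp: is_minimizer_def paths_def)
  obtain u where u: "\<And>t. t \<in> {0..1} \<Longrightarrow> (q has_vector_derivative u t) (at t within {0..1})"
    "\<And>t. t \<in> {0..1} \<Longrightarrow> (u has_vector_derivative force (q t)) (at t within {0..1})"
    "\<And>t. t \<in> {0..1} \<Longrightarrow> u t \<in> chi"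
    "\<And>a b c. u 0 \<bullet> S_config a b c = 0" "\<And>a b c. u 1 \<bullet> E_config \<theta> a b c = 0"
    using minimizer_is_solution[OF assms] by blast
  have S: "S_refl (u 0) = - u 0" by (rule S_refl_normal[OF u(3,4)]) simp
  have E: "E_refl \<theta> (u 1) = - u 1" by (rule E_refl_normal[OF u(3,5)]) simp
  obtain x where x: "is_orbit x" "\<And>t. t \<in> {0..1} \<Longrightarrow> x t = q t"
    "\<And>t i. x (t + 8) $ i = rot (8 * \<theta>) (x t $ i)"
    using reflected_extension[OF u(1,2) nc S_refl_fixes[OF q(1)] S E_refl_fixes[OF q(2)] E] by blast
  have "continuous_on UNIV x"
    using x(1) unfolding is_orbit_def by (meson continuous_at_imp_continuous_on has_vector_derivative_continuous)
  from rotating_orbit_recurrent[OF this assms(1) x(3)] show ?thesis using nc x by blast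
qed

end
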